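(* Let $\mathcal G$ be a finite connected groupoid, $x\in\mathcal G_0$, $\tau(x)=\{\tau_y\}_{y\in\mathcal G_0}$ a transversal for $x$, $A$ a ring, and $\beta=(B_g,\beta_g)_{g\in\mathcal G}$ the lifted partial action of $\mathcal G$ on $A$ coming from a datum $(I,\gamma_{\tau(x)},\gamma_{(x)})\in\mathcal D_{\tau(x)}(A)$. Assume that $\beta$ is $\tau(x)$-global and $\gamma$-unital, and that $A=\bigoplus_{y\in\mathcal G_0}I_y=\bigoplus_{y\in\mathcal G_0}B_y$. If any one of the following (equivalent) statements holds: (i) there is an element $a$ in the center of $A$ such that $t_y(a)=1_y$ for all $y\in\mathcal G_0$; (ii) there is an element $b$ in the center of $B_x$ such that $t_{\beta_{(x)}}(b)=1_x$; (iii) the ring extension $B_x\subset B_x\star_{\beta_{(x)}}\mathcal G(x)$ is separable; (iv) the ring extension $A\subset A\star_\beta\mathcal G$ is separable; then the ring extensions $B_x\subset B_x\star_{\beta_{(x)}}\mathcal G(x)$ and $A\subset A\star_\beta\mathcal G$ are (left and right) semisimple.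
   Context: Conventions. Rings are associative, not necessarily unital; ideals are two-sided. A groupoid $\mathcal G$ is a small category in which every morphism is invertible; it is identified with its set of morphisms, and its set of objects $\mathcal G_0$ is identified with the set of identity morphisms. For $g\in\mathcal G$, $s(g)=g^{-1}g$ and $t(g)=gg^{-1}$; $gh$ is defined iff $s(g)=t(h)$. Put $\mathcal G(y,z)=\{g: s(g)=y,\ t(g)=z\}$ and $\mathcal G(x)=\mathcal G(x,x)$ (a group). $\mathcal G$ is connected if $\mathcal G(y,z)\neq\emptyset$ for all $y,z\in\mathcal G_0$. A transversal for $x$ is a family $\tau(x)=\{\tau_y: y\in\mathcal G_0\}$ with $\tau_y\in\mathcal G(x,y)$ and $\tau_x=x$. Put $g_x=\tau_{t(g)}^{-1}g\tau_{s(g)}\in\mathcal G(x)$. For partial bijections, $u\circ v$ has domain $v^{-1}(\mathrm{dom}(u)\cap\mathrm{ran}(v))$ and range $u(\mathrm{dom}(u)\cap\mathrm{ran}(v))$. A partial action of a groupoid $\mathcal G$ on a ring $A$ is a family $\alpha=(A_g,\alpha_g)_{g\in\mathcal G}$ where, for each $g$, $A_{t(g)}$ is an ideal of $A$, $A_g$ is an ideal of $A_{t(g)}$, $\alpha_g:A_{g^{-1}}\to A_g$ is a ring isomorphism, $\alpha_y=\mathrm{id}_{A_y}$ for $y\in\mathcal G_0$, and $\alpha_{gh}$ extends $\alpha_g\circ\alpha_h$ whenever $s(g)=t(h)$. A partial action of a group $H$ on a ring $R$ is the one-object case with the ideal attached to the identity equal to $R$; it is unital if each of its ideals is a unital ring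 whose identity is a central idempotent of $R$. The partial action $\alpha$ is $\tau(x)$-global if $A_{\tau_y^{-1}}=A_x$ and $A_{\tau_y}=A_y$ for all $y\in\mathcal G_0$. An object of $\mathcal D_{\tau(x)}(A)$ is a datum $(I,\gamma_{\tau(x)},\gamma_{(x)})$ consisting of: (a) a family $I=\{I_y\}_{y\in\mathcal G_0}$ of ideals of $A$; (b) ring isomorphisms $\gamma_{\tau(x)}=\{\gamma_{\tau_y}:I_{\tau_y^{-1}}\to I_{\tau_y}\}_{y\in\mathcal G_0}$; (c) a partial action $\gamma_{(x)}=(I_h,\gamma_h)_{h\in\mathcal G(x)}$ of the group $\mathcal G(x)$ on $I_x$; such that (d) $\gamma_x=\gamma_{\tau_x}$ is the identity map of $I_x=I_{\tau_x}$; (e) $I_{\tau_y}$ is an ideal of $I_y$ and $I_{\tau_y^{-1}}$ is an ideal of $I_x$ for all $y$; (f) $\gamma_{\tau_{t(g)}}\big(I_{\tau_{t(g)}^{-1}}\cap\gamma_{g_x}(I_{\tau_{s(g)}^{-1}}\cap I_{g_x^{-1}})\big)$ is an ideal of $I_{t(g)}$ for all $g\in\mathcal G$. The lifted partial action coming from it is $\beta=(B_g,\beta_g)_{g\in\mathcal G}$ with $\beta_y=\mathrm{id}_{I_y}$ for $y\in\mathcal G_0$, $\beta_g=\gamma_{\tau_{t(g)}}\circ\gamma_{g_x}\circ\gamma_{\tau_{s(g)}}^{-1}$ for $g\notin\mathcal G_0$ (composition of partial bijections), and $B_g$ the range of $\beta_g$; it is a partial action of $\mathcal G$ on $A$. It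 is called $\gamma$-unital if $I_x$ is a unital ring and $\gamma_{(x)}$ is a unital partial group action. When $\beta$ is $\tau(x)$-global and $\gamma$-unital, $B_g=\gamma_{\tau_{t(g)}}(I_{g_x})=A1_g$ for all $g\in\mathcal G$, where $1_h$ is the identity of $I_h$ for $h\in\mathcal G(x)$ and $1_g=\gamma_{\tau_{t(g)}}(1_{g_x})$ is the identity of $B_g$, a central idempotent of $A$. The restriction $\beta_{(x)}=(B_h,\beta_h)_{h\in\mathcal G(x)}$ is a partial action of $\mathcal G(x)$ on $B_x$; it equals $\gamma_{(x)}$. The partial skew groupoid ring is $A\star_\beta\mathcal G=\bigoplus_{g\in\mathcal G}B_g\delta_g$ ($\delta_g$ placeholder symbols), with multiplication determined by $(a\delta_g)(b\delta_h)=a\beta_g(b1_{g^{-1}})\delta_{gh}$ if $s(g)=t(h)$ and $0$ otherwise ($a\in B_g$, $b\in B_h$); its identity is $\sum_{y\in\mathcal G_0}1_y\delta_y$. It is an extension of $A$ via $a\mapsto\sum_{y\in\mathcal G_0}(a1_y)\delta_y$. Similarly $B_x\star_{\beta_{(x)}}\mathcal G(x)=\bigoplus_{h\in\mathcal G(x)}B_h\delta_h$ is an extension of $B_x$ via $b\mapsto b\delta_x$. Trace maps: $t_{\beta_{(x)}}(b)=\sum_{h\in\mathcal G(x)}\beta_h(b1_{h^{-1}})$ for $b\in B_x$; for $y,z\in\mathcal G_0$ and $a\in A$, $t_{y,z}(a)=\sum_{g\in\mathcal G(y,z)}\beta_g(a1_{g^{-1}})$ and $t_z(a)=\sum_{y\in\mathcal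 G_0}t_{y,z}(a)$. A unital ring extension $R\subset S$ is separable if the multiplication map $m:S\otimes_RS\to S$ is a split epimorphism of $S$-bimodules. It is left (right) semisimple if every left (right) $S$-submodule $N$ of a left (right) $S$-module $M$ which has an $R$-complement in $M$ has an $S$-complement in $M$. *)

theory Defs
  imports "HOL-Algebra.Module" "HOL-Algebra.RingHom" "HOL-Algebra.Free_Abelian_Groups"
begin

section \<open>Groupoids\<close>

text \<open>
  A groupoid is identified with its set of morphisms, and an object with its identity morphism.
  The composition is a total function that is only meaningful when the source of the left factor
  is the target of the right factor.
\<close>

record 'g groupoid = "'g partial_object" +
  comp :: "'g \<Rightarrow> 'g \<Rightarrow> 'g"
  source :: "'g \<Rightarrow> 'g"
  target :: "'g \<Rightarrow> 'g"
  ginv :: "'g \<Rightarrow> 'g"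

locale groupoid =
  fixes G :: "'g groupoid"
  assumes source_closed: "g \<in> carrier G \<Longrightarrow> source G g \<in> carrier G"
    and target_closed: "g \<in> carrier G \<Longrightarrow> target G g \<in> carrier G"
    and source_source: "g \<in> carrier G \<Longrightarrow> source G (source G g) = source G g"
    and target_source: "g \<in> carrier G \<Longrightarrow> target G (source G g) = source G g"
    and source_target: "g \<in> carrier G \<Longrightarrow> source G (target G g) = target G g"
    and target_target: "g \<in> carrier G \<Longrightarrow> target G (target G g) = target G g"
    and comp_closed: "\<lbrakk>g \<in> carrier G; h \<in> carrier G; source G g = target G h\<rbrakk>
          \<Longrightarrow> comp G g h \<in> carrier G"
    and source_comp: "\<lbrakk>g \<in> carrier G; h \<in> carrier G; source G g = target G h\<rbrakk>
          \<Longrightarrow> source G (comp G g h) = source G h"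
    and target_comp: "\<lbrakk>g \<in> carrier G; h \<in> carrier G; source G g = target G h\<rbrakk>
          \<Longrightarrow> target G (comp G g h) = target G g"
    and comp_assoc: "\<lbrakk>g \<in> carrier G; h \<in> carrier G; k \<in> carrier G;
            source G g = target G h; source G h = target G k\<rbrakk>
          \<Longrightarrow> comp G (comp G g h) k = comp G g (comp G h k)"
    and comp_source: "g \<in> carrier G \<Longrightarrow> comp G g (source G g) = g"
    and target_comp_id: "g \<in> carrier G \<Longrightarrow> comp G (target G g) g = g"
    and ginv_closed: "g \<in> carrier G \<Longrightarrow> ginv G g \<in> carrier G"
    and source_ginv: "g \<in> carrier G \<Longrightarrow> source G (ginv G g) = target G g"
    and target_ginv: "g \<in> carrier G \<Longrightarrow> target G (ginv G g) = source G g"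
    and ginv_comp: "g \<in> carrier G \<Longrightarrow> comp G (ginv G g) g = source G g"
    and comp_ginv: "g \<in> carrier G \<Longrightarrow> comp G g (ginv G g) = target G g"

definition objs :: "'g groupoid \<Rightarrow> 'g set" where
  "objs G = {y \<in> carrier G. source G y = y}"

definition homs :: "'g groupoid \<Rightarrow> 'g \<Rightarrow> 'g \<Rightarrow> 'g set" where
  "homs G y z = {g \<in> carrier G. source G g = y \<and> target G g = z}"

definition connected_groupoid :: "'g groupoid \<Rightarrow> bool" where
  "connected_groupoid G \<longleftrightarrow> (\<forall>y\<in>objs G. \<forall>z\<in>objs G. homs G y z \<noteq> {})"

definition isotropy :: "'g groupoid \<Rightarrow> 'g \<Rightarrow> 'g groupoid" where
  "isotropy G x = G\<lparr>carrier := homs G x x\<rparr>"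

definition transversal :: "'g groupoid \<Rightarrow> 'g \<Rightarrow> ('g \<Rightarrow> 'g) \<Rightarrow> bool" where
  "transversal G x \<tau> \<longleftrightarrow> (\<forall>y\<in>objs G. \<tau> y \<in> homs G x y) \<and> \<tau> x = x"

text \<open>The element \<open>g\<^sub>x\<close> of the isotropy group at \<open>x\<close>.\<close>

definition to_isotropy :: "'g groupoid \<Rightarrow> ('g \<Rightarrow> 'g) \<Rightarrow> 'g \<Rightarrow> 'g" where
  "to_isotropy G \<tau> g = comp G (comp G (ginv G (\<tau> (target G g))) g) (\<tau> (source G g))"

section \<open>Ideals of not necessarily unital rings\<close>

text \<open>
  The type class \<^class>\<open>ring\<close> does not require a unit, whereas the locale \<^locale>\<open>ring\<close> does. The
  ambient ring is a type of this class; its ideals, which are rings in their own right, are sets.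
\<close>

definition ideal_of :: "'a::ring set \<Rightarrow> 'a set \<Rightarrow> bool" where
  "ideal_of J R \<longleftrightarrow> J \<subseteq> R \<and> 0 \<in> J \<and> (\<forall>a\<in>J. \<forall>b\<in>J. a - b \<in> J) \<and>
     (\<forall>r\<in>R. \<forall>a\<in>J. r * a \<in> J \<and> a * r \<in> J)"

definition ring_iso_on :: "('a::ring \<Rightarrow> 'a) \<Rightarrow> 'a set \<Rightarrow> 'a set \<Rightarrow> bool" where
  "ring_iso_on f X Y \<longleftrightarrow> bij_betw f X Y \<and>
     (\<forall>a\<in>X. \<forall>b\<in>X. f (a + b) = f a + f b \<and> f (a * b) = f a * f b)"

definition center_of :: "'a::ring set \<Rightarrow> 'a set" where
  "center_of R = {a \<in> R. \<forall>c\<in>R. a * c = c * a}"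

definition is_identity :: "'a::ring \<Rightarrow> 'a set \<Rightarrow> bool" where
  "is_identity e R \<longleftrightarrow> e \<in> R \<and> (\<forall>a\<in>R. e * a = a \<and> a * e = a)"

definition identity_of :: "'a::ring set \<Rightarrow> 'a" where
  "identity_of R = (THE e. is_identity e R)"

definition unital_set :: "'a::ring set \<Rightarrow> bool" where
  "unital_set R \<longleftrightarrow> (\<exists>e. is_identity e R)"

definition direct_sum_of :: "'i set \<Rightarrow> ('i \<Rightarrow> 'a::ring set) \<Rightarrow> 'a set \<Rightarrow> bool" where
  "direct_sum_of Y I R \<longleftrightarrow> (\<forall>y\<in>Y. I y \<subseteq> R) \<and>
     (\<forall>a\<in>R. \<exists>!f. f \<in> (\<Pi>\<^sub>E y\<in>Y. I y) \<and> finite {y\<in>Y. f y \<noteq> 0} \<and> a = (\<Sum>y | y \<in> Y \<and> f y \<noteq> 0. f y))"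

text \<open>A unital subset of the ambient ring as a record in the sense of \<^locale>\<open>ring\<close>.\<close>

definition set_ring :: "'a::ring set \<Rightarrow> 'a ring" where
  "set_ring R = \<lparr>carrier = R, monoid.mult = (*), monoid.one = identity_of R, ring.zero = 0, ring.add = (+)\<rparr>"

section \<open>Partial actions\<close>

text \<open>
  In a partial action \<open>(D, \<alpha>)\<close> the map \<open>\<alpha> g\<close> is only meaningful on \<open>D (ginv G g)\<close>. The last clause
  says that \<open>\<alpha> (g h)\<close> extends the composite of the partial bijections \<open>\<alpha> g\<close> and \<open>\<alpha> h\<close>.
\<close>

definition partial_action ::
  "'g groupoid \<Rightarrow> 'a::ring set \<Rightarrow> ('g \<Rightarrow> 'a set) \<Rightarrow> ('g \<Rightarrow> 'a \<Rightarrow> 'a) \<Rightarrow> bool" where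
  "partial_action G R D \<alpha> \<longleftrightarrow>
     (\<forall>g\<in>carrier G. ideal_of (D (target G g)) R \<and> ideal_of (D g) (D (target G g)) \<and>
        ring_iso_on (\<alpha> g) (D (ginv G g)) (D g)) \<and>
     (\<forall>y\<in>objs G. \<forall>a\<in>D y. \<alpha> y a = a) \<and>
     (\<forall>g\<in>carrier G. \<forall>h\<in>carrier G. source G g = target G h \<longrightarrow>
        (\<forall>a\<in>D (ginv G h). \<alpha> h a \<in> D (ginv G g) \<longrightarrow>
           a \<in> D (ginv G (comp G g h)) \<and> \<alpha> (comp G g h) a = \<alpha> g (\<alpha> h a)))"

text \<open>The group is a groupoid with a single object.\<close>

definition partial_group_action ::
  "'g groupoid \<Rightarrow> 'a::ring set \<Rightarrow> ('g \<Rightarrow> 'a set) \<Rightarrow> ('g \<Rightarrow> 'a \<Rightarrow> 'a) \<Rightarrow> bool" where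
  "partial_group_action H R D \<alpha> \<longleftrightarrow> partial_action H R D \<alpha> \<and> (\<forall>e\<in>objs H. D e = R)"

definition unital_partial_group_action ::
  "'g groupoid \<Rightarrow> 'a::ring set \<Rightarrow> ('g \<Rightarrow> 'a set) \<Rightarrow> ('g \<Rightarrow> 'a \<Rightarrow> 'a) \<Rightarrow> bool" where
  "unital_partial_group_action H R D \<alpha> \<longleftrightarrow> partial_group_action H R D \<alpha> \<and>
     (\<forall>h\<in>carrier H. unital_set (D h) \<and> identity_of (D h) \<in> center_of R \<and>
        identity_of (D h) * identity_of (D h) = identity_of (D h))"

definition transversal_global ::
  "'g groupoid \<Rightarrow> 'g \<Rightarrow> ('g \<Rightarrow> 'g) \<Rightarrow> ('g \<Rightarrow> 'a::ring set) \<Rightarrow> bool" where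
  "transversal_global G x \<tau> D \<longleftrightarrow>
     (\<forall>y\<in>objs G. D (ginv G (\<tau> y)) = D x \<and> D (\<tau> y) = D y)"

section \<open>Lifted partial actions\<close>

text \<open>
  A datum is given by one family of sets \<open>I\<close> and one family of maps \<open>\<gamma>\<close>, both indexed by morphisms:
  \<open>I\<close> is used at the objects, at the \<open>\<tau> y\<close> and their inverses and on the isotropy group at \<open>x\<close>, and
  \<open>\<gamma>\<close> at the \<open>\<tau> y\<close> and on the isotropy group. These index sets meet only in \<open>x = \<tau> x\<close>, where the
  corresponding components of a datum coincide. All other values of \<open>I\<close> and \<open>\<gamma>\<close> are irrelevant.
\<close>

definition lifting_datum ::
  "'g groupoid \<Rightarrow> 'g \<Rightarrow> ('g \<Rightarrow> 'g) \<Rightarrow> 'a::ring set \<Rightarrow> ('g \<Rightarrow> 'a set) \<Rightarrow> ('g \<Rightarrow> 'a \<Rightarrow> 'a) \<Rightarrow> bool" where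
  "lifting_datum G x \<tau> A I \<gamma> \<longleftrightarrow>
     (\<forall>y\<in>objs G. ideal_of (I y) A) \<and>
     (\<forall>y\<in>objs G. ring_iso_on (\<gamma> (\<tau> y)) (I (ginv G (\<tau> y))) (I (\<tau> y))) \<and>
     partial_group_action (isotropy G x) (I x) I \<gamma> \<and>
     (\<forall>a\<in>I x. \<gamma> x a = a) \<and>
     (\<forall>y\<in>objs G. ideal_of (I (\<tau> y)) (I y) \<and> ideal_of (I (ginv G (\<tau> y))) (I x)) \<and>
     (\<forall>g\<in>carrier G.
        ideal_of
          (\<gamma> (\<tau> (target G g)) ` (I (ginv G (\<tau> (target G g))) \<inter>
             \<gamma> (to_isotropy G \<tau> g) `
               (I (ginv G (\<tau> (source G g))) \<inter> I (ginv G (to_isotropy G \<tau> g)))))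
          (I (target G g)))"

text \<open>
  Away from the objects, \<open>lifted_ideal\<close> is the range of the composite of the partial bijections
  \<open>\<gamma> (\<tau> (target G g))\<close>, \<open>\<gamma> (to_isotropy G \<tau> g)\<close> and the inverse of \<open>\<gamma> (\<tau> (source G g))\<close>; the range
  of the latter inverse is \<open>I (ginv G (\<tau> (source G g)))\<close>.
\<close>

definition lifted_ideal ::
  "'g groupoid \<Rightarrow> ('g \<Rightarrow> 'g) \<Rightarrow> ('g \<Rightarrow> 'a::ring set) \<Rightarrow> ('g \<Rightarrow> 'a \<Rightarrow> 'a) \<Rightarrow> 'g \<Rightarrow> 'a set" where
  "lifted_ideal G \<tau> I \<gamma> g =
     (if g \<in> objs G then I g
      else \<gamma> (\<tau> (target G g)) ` (I (ginv G (\<tau> (target G g))) \<inter>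
             \<gamma> (to_isotropy G \<tau> g) `
               (I (ginv G (\<tau> (source G g))) \<inter> I (ginv G (to_isotropy G \<tau> g)))))"

definition lifted_map ::
  "'g groupoid \<Rightarrow> ('g \<Rightarrow> 'g) \<Rightarrow> ('g \<Rightarrow> 'a::ring set) \<Rightarrow> ('g \<Rightarrow> 'a \<Rightarrow> 'a) \<Rightarrow> 'g \<Rightarrow> 'a \<Rightarrow> 'a" where
  "lifted_map G \<tau> I \<gamma> g a =
     (if g \<in> objs G then a
      else \<gamma> (\<tau> (target G g)) (\<gamma> (to_isotropy G \<tau> g)
             (inv_into (I (ginv G (\<tau> (source G g)))) (\<gamma> (\<tau> (source G g))) a)))"

definition datum_unital ::
  "'g groupoid \<Rightarrow> 'g \<Rightarrow> ('g \<Rightarrow> 'a::ring set) \<Rightarrow> ('g \<Rightarrow> 'a \<Rightarrow> 'a) \<Rightarrow> bool" where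
  "datum_unital G x I \<gamma> \<longleftrightarrow>
     unital_set (I x) \<and> unital_partial_group_action (isotropy G x) (I x) I \<gamma>"

section \<open>Partial skew groupoid rings and trace maps\<close>

text \<open>
  For a finite groupoid whose ideals \<open>D g\<close> are unital. The element
  \<open>\<Sum>g. a\<^sub>g \<delta>\<^sub>g\<close> is represented by the function \<open>g \<mapsto> a\<^sub>g\<close>, extended by 0 outside the groupoid.
\<close>

definition skew_groupoid_ring ::
  "'g groupoid \<Rightarrow> ('g \<Rightarrow> 'a::ring set) \<Rightarrow> ('g \<Rightarrow> 'a \<Rightarrow> 'a) \<Rightarrow> ('g \<Rightarrow> 'a) ring" where
  "skew_groupoid_ring G D \<alpha> =
     \<lparr>carrier = {u. (\<forall>g\<in>carrier G. u g \<in> D g) \<and> (\<forall>g. g \<notin> carrier G \<longrightarrow> u g = 0)},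
      monoid.mult = (\<lambda>u v k.
        \<Sum>(g, h) | g \<in> carrier G \<and> h \<in> carrier G \<and> source G g = target G h \<and> comp G g h = k.
          u g * \<alpha> g (v h * identity_of (D (ginv G g)))),
      monoid.one = (\<lambda>g. if g \<in> objs G then identity_of (D g) else 0),
      ring.zero = (\<lambda>_. 0),
      ring.add = (\<lambda>u v g. u g + v g)\<rparr>"

definition skew_embedding :: "'g groupoid \<Rightarrow> ('g \<Rightarrow> 'a::ring set) \<Rightarrow> 'a \<Rightarrow> 'g \<Rightarrow> 'a" where
  "skew_embedding G D a = (\<lambda>g. if g \<in> objs G then a * identity_of (D g) else 0)"

definition delta :: "'g \<Rightarrow> 'a::ring \<Rightarrow> 'g \<Rightarrow> 'a" where
  "delta g b = (\<lambda>_. 0)(g := b)"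

definition group_trace ::
  "'g groupoid \<Rightarrow> ('g \<Rightarrow> 'a::ring set) \<Rightarrow> ('g \<Rightarrow> 'a \<Rightarrow> 'a) \<Rightarrow> 'a \<Rightarrow> 'a" where
  "group_trace H D \<alpha> b = (\<Sum>h\<in>carrier H. \<alpha> h (b * identity_of (D (ginv H h))))"

definition trace_between ::
  "'g groupoid \<Rightarrow> ('g \<Rightarrow> 'a::ring set) \<Rightarrow> ('g \<Rightarrow> 'a \<Rightarrow> 'a) \<Rightarrow> 'g \<Rightarrow> 'g \<Rightarrow> 'a \<Rightarrow> 'a" where
  "trace_between G D \<alpha> y z a = (\<Sum>g\<in>homs G y z. \<alpha> g (a * identity_of (D (ginv G g))))"

definition trace_at ::
  "'g groupoid \<Rightarrow> ('g \<Rightarrow> 'a::ring set) \<Rightarrow> ('g \<Rightarrow> 'a \<Rightarrow> 'a) \<Rightarrow> 'g \<Rightarrow> 'a \<Rightarrow> 'a" where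
  "trace_at G D \<alpha> z a = (\<Sum>y\<in>objs G. trace_between G D \<alpha> y z a)"

section \<open>Separable and semisimple ring extensions\<close>

text \<open>
  A unital ring extension is an injective unital ring homomorphism \<open>\<phi>\<close> from \<open>R\<close> to \<open>S\<close>, in general
  not the inclusion of a subset.
\<close>

definition ring_extension :: "'r ring \<Rightarrow> 's ring \<Rightarrow> ('r \<Rightarrow> 's) \<Rightarrow> bool" where
  "ring_extension R S \<phi> \<longleftrightarrow>
     ring R \<and> ring S \<and> \<phi> \<in> ring_hom R S \<and> inj_on \<phi> (carrier R)"

text \<open>
  The tensor product of \<open>S\<close> with itself over \<open>R\<close>: the free abelian group on pairs modulo
  biadditivity and \<open>R\<close>-balancedness. Its elements are cosets; \<open>tensor_lmult s\<close> and \<open>tensor_rmult s\<close>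
  are the two \<open>S\<close>-actions, computed on representatives and saturated to a coset.
\<close>

definition tensor_free :: "'s ring \<Rightarrow> ('s \<times> 's \<Rightarrow>\<^sub>0 int) monoid" where
  "tensor_free S = free_Abelian_group (carrier S \<times> carrier S)"

definition tensor_rel :: "'r ring \<Rightarrow> 's ring \<Rightarrow> ('r \<Rightarrow> 's) \<Rightarrow> ('s \<times> 's \<Rightarrow>\<^sub>0 int) set" where
  "tensor_rel R S \<phi> = generate (tensor_free S)
     ({frag_of (a \<oplus>\<^bsub>S\<^esub> a', b) - frag_of (a, b) - frag_of (a', b) | a a' b.
         a \<in> carrier S \<and> a' \<in> carrier S \<and> b \<in> carrier S} \<union>
      {frag_of (a, b \<oplus>\<^bsub>S\<^esub> b') - frag_of (a, b) - frag_of (a, b') | a b b'.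
         a \<in> carrier S \<and> b \<in> carrier S \<and> b' \<in> carrier S} \<union>
      {frag_of (a \<otimes>\<^bsub>S\<^esub> \<phi> r, b) - frag_of (a, \<phi> r \<otimes>\<^bsub>S\<^esub> b) | a r b.
         a \<in> carrier S \<and> r \<in> carrier R \<and> b \<in> carrier S})"

definition tensor_self ::
  "'r ring \<Rightarrow> 's ring \<Rightarrow> ('r \<Rightarrow> 's) \<Rightarrow> ('s \<times> 's \<Rightarrow>\<^sub>0 int) set monoid" where
  "tensor_self R S \<phi> = tensor_free S Mod tensor_rel R S \<phi>"

definition tensor_lmult ::
  "'r ring \<Rightarrow> 's ring \<Rightarrow> ('r \<Rightarrow> 's) \<Rightarrow> 's \<Rightarrow> ('s \<times> 's \<Rightarrow>\<^sub>0 int) set \<Rightarrow> ('s \<times> 's \<Rightarrow>\<^sub>0 int) set" where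
  "tensor_lmult R S \<phi> s X = tensor_rel R S \<phi> <#>\<^bsub>tensor_free S\<^esub>
     (frag_extend (\<lambda>(a, b). frag_of (s \<otimes>\<^bsub>S\<^esub> a, b)) ` X)"

definition tensor_rmult ::
  "'r ring \<Rightarrow> 's ring \<Rightarrow> ('r \<Rightarrow> 's) \<Rightarrow> ('s \<times> 's \<Rightarrow>\<^sub>0 int) set \<Rightarrow> 's \<Rightarrow> ('s \<times> 's \<Rightarrow>\<^sub>0 int) set" where
  "tensor_rmult R S \<phi> X s = tensor_rel R S \<phi> <#>\<^bsub>tensor_free S\<^esub>
     (frag_extend (\<lambda>(a, b). frag_of (a, b \<otimes>\<^bsub>S\<^esub> s)) ` X)"

text \<open>The map induced by the multiplication of \<open>S\<close>; it is constant on each coset.\<close>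

definition tensor_mult :: "'s ring \<Rightarrow> ('s \<times> 's \<Rightarrow>\<^sub>0 int) set \<Rightarrow> 's" where
  "tensor_mult S X = the_elem
     ((\<lambda>c. \<Oplus>\<^bsub>S\<^esub>p\<in>Poly_Mapping.keys c.
             [Poly_Mapping.lookup c p] \<cdot>\<^bsub>S\<^esub> (fst p \<otimes>\<^bsub>S\<^esub> snd p)) ` X)"

definition separable_extension :: "'r ring \<Rightarrow> 's ring \<Rightarrow> ('r \<Rightarrow> 's) \<Rightarrow> bool" where
  "separable_extension R S \<phi> \<longleftrightarrow> ring_extension R S \<phi> \<and>
     (\<exists>\<sigma> \<in> hom (add_monoid S) (tensor_self R S \<phi>).
        (\<forall>s\<in>carrier S. \<forall>a\<in>carrier S.
           \<sigma> (s \<otimes>\<^bsub>S\<^esub> a) = tensor_lmult R S \<phi> s (\<sigma> a) \<and>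
           \<sigma> (a \<otimes>\<^bsub>S\<^esub> s) = tensor_rmult R S \<phi> (\<sigma> a) s) \<and>
        (\<forall>a\<in>carrier S. tensor_mult S (\<sigma> a) = a))"

text \<open>
  The library's \<^locale>\<open>module\<close> requires a commutative ring. In a right module, \<open>s \<odot>\<^bsub>M\<^esub> v\<close> stands
  for \<open>v\<close> multiplied by \<open>s\<close> from the right.
\<close>

locale left_module = S?: ring S + M?: abelian_group M
  for S :: "'s ring" and M :: "('s, 'm) module" (structure) +
  assumes smult_closed: "\<lbrakk>s \<in> carrier S; v \<in> carrier M\<rbrakk> \<Longrightarrow> s \<odot> v \<in> carrier M"
    and smult_l_distr: "\<lbrakk>s \<in> carrier S; r \<in> carrier S; v \<in> carrier M\<rbrakk>
          \<Longrightarrow> (s \<oplus>\<^bsub>S\<^esub> r) \<odot> v = s \<odot> v \<oplus> r \<odot> v"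
    and smult_r_distr: "\<lbrakk>s \<in> carrier S; v \<in> carrier M; w \<in> carrier M\<rbrakk>
          \<Longrightarrow> s \<odot> (v \<oplus> w) = s \<odot> v \<oplus> s \<odot> w"
    and smult_assoc: "\<lbrakk>s \<in> carrier S; r \<in> carrier S; v \<in> carrier M\<rbrakk>
          \<Longrightarrow> (s \<otimes>\<^bsub>S\<^esub> r) \<odot> v = s \<odot> (r \<odot> v)"
    and smult_one: "v \<in> carrier M \<Longrightarrow> \<one>\<^bsub>S\<^esub> \<odot> v = v"

locale right_module = S?: ring S + M?: abelian_group M
  for S :: "'s ring" and M :: "('s, 'm) module" (structure) +
  assumes smult_closed: "\<lbrakk>s \<in> carrier S; v \<in> carrier M\<rbrakk> \<Longrightarrow> s \<odot> v \<in> carrier M"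
    and smult_l_distr: "\<lbrakk>s \<in> carrier S; r \<in> carrier S; v \<in> carrier M\<rbrakk>
          \<Longrightarrow> (s \<oplus>\<^bsub>S\<^esub> r) \<odot> v = s \<odot> v \<oplus> r \<odot> v"
    and smult_r_distr: "\<lbrakk>s \<in> carrier S; v \<in> carrier M; w \<in> carrier M\<rbrakk>
          \<Longrightarrow> s \<odot> (v \<oplus> w) = s \<odot> v \<oplus> s \<odot> w"
    and smult_assoc: "\<lbrakk>s \<in> carrier S; r \<in> carrier S; v \<in> carrier M\<rbrakk>
          \<Longrightarrow> (s \<otimes>\<^bsub>S\<^esub> r) \<odot> v = r \<odot> (s \<odot> v)"
    and smult_one: "v \<in> carrier M \<Longrightarrow> \<one>\<^bsub>S\<^esub> \<odot> v = v"

definition restrict_scalars :: "('r \<Rightarrow> 's) \<Rightarrow> ('s, 'm) module \<Rightarrow> ('r, 'm) module" where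
  "restrict_scalars \<phi> M =
     \<lparr>carrier = carrier M, monoid.mult = monoid.mult M, monoid.one = monoid.one M, ring.zero = ring.zero M, ring.add = ring.add M,
      smult = (\<lambda>r. smult M (\<phi> r))\<rparr>"

text \<open>The library's \<^locale>\<open>submodule\<close> only asks for a subgroup closed under scalars, so it serves
  left and right modules over noncommutative rings alike.\<close>

definition has_complement :: "'r ring \<Rightarrow> ('r, 'm) module \<Rightarrow> 'm set \<Rightarrow> bool" where
  "has_complement R M N \<longleftrightarrow>
     (\<exists>K. submodule K R M \<and> N \<inter> K = {\<zero>\<^bsub>M\<^esub>} \<and> N <+>\<^bsub>M\<^esub> K = carrier M)"

text \<open>
  The type argument is the type of the elements of the modules considered; a statement about all
  modules leaves it as a type variable.
\<close>

definition left_semisimple_extension ::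
  "'m itself \<Rightarrow> 'r ring \<Rightarrow> 's ring \<Rightarrow> ('r \<Rightarrow> 's) \<Rightarrow> bool" where
  "left_semisimple_extension _ R S \<phi> \<longleftrightarrow> ring_extension R S \<phi> \<and>
     (\<forall>(M :: ('s, 'm) module) N. left_module S M \<and> submodule N S M \<and>
        has_complement R (restrict_scalars \<phi> M) N \<longrightarrow> has_complement S M N)"

definition right_semisimple_extension ::
  "'m itself \<Rightarrow> 'r ring \<Rightarrow> 's ring \<Rightarrow> ('r \<Rightarrow> 's) \<Rightarrow> bool" where
  "right_semisimple_extension _ R S \<phi> \<longleftrightarrow> ring_extension R S \<phi> \<and>
     (\<forall>(M :: ('s, 'm) module) N. right_module S M \<and> submodule N S M \<and>
        has_complement R (restrict_scalars \<phi> M) N \<longrightarrow> has_complement S M N)"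

end

theory Submission
  imports Defs
begin

text \<open>
  For a unital action write \<open>act g r = \<alpha>\<^sub>g (r 1\<^bsub>g\<inverse>\<^esub>)\<close>. If \<open>a\<close> is central with trace \<open>1\<^sub>y\<close> at every
  object \<open>y\<close>, then \<open>\<Sum>g. act g a \<delta>\<^sub>g \<otimes> 1\<^bsub>g\<inverse>\<^esub> \<delta>\<^bsub>g\<inverse>\<^esub>\<close> is a separability element of the skew groupoid
  ring, and averaging a projection of modules over the base ring against it makes the projection
  linear over the skew groupoid ring; its kernel is the required complement. Conversely, the
  coefficients at the objects of a separability element yield such an \<open>a\<close>. A trace element \<open>b\<close> of
  the isotropy group is also one for the groupoid, and a trace element \<open>a\<close> of the groupoid gives
  \<open>b = \<Sum>y. act \<tau>\<^sub>y\<inverse> a\<close> for the isotropy group. So each of the four conditions provides trace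
  elements for both extensions.
\<close>

section \<open>Partial actions as families of endomorphisms\<close>

text \<open>The obstacle is partiality: \<open>act g\<close> after \<open>act h\<close> agrees with
  \<open>act (comp G g h)\<close> only up to the idempotent \<open>e g\<close>. The defect is
  harmless when a coefficient from \<open>D g\<close> stands to the left, as it does in every
  product of the skew groupoid ring. Along the transversal globality removes it altogether, because
  each \<open>\<gamma> (\<tau> y)\<close> is then an isomorphism from \<open>I x\<close> onto
  \<open>I y\<close>; this is why traces can be carried between the groupoid and its isotropy group.

  Both extensions are instances of the single locale \<open>unital_action\<close>: one over the
  whole ring, the other over \<open>D x\<close> with x as the only object. So the averaging argument
  and its converse are carried out once.

  The tensor square is a quotient of a free abelian group and awkward to compute in. It is replaced
  by balanced maps, evaluated either on an explicit family of pairs or on one representative of the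
  image of the identity under the splitting; cosets are handled only in
  \<open>separable_casimir\<close>.\<close>

context groupoid
begin

section \<open>Cancellation and translation in a groupoid\<close>

lemma objsD: "y \<in> objs G \<Longrightarrow> y \<in> carrier G \<and> source G y = y \<and> target G y = y"
  unfolding objs_def using target_source by force

lemma source_in_objs: "g \<in> carrier G \<Longrightarrow> source G g \<in> objs G"
  by (simp add: objs_def source_closed source_source)

lemma target_in_objs: "g \<in> carrier G \<Longrightarrow> target G g \<in> objs G"
  by (simp add: objs_def target_closed source_target)

lemma ginv_obj: "y \<in> objs G \<Longrightarrow> ginv G y = y"
  by (metis objsD comp_source ginv_closed ginv_comp source_ginv)

lemma ginv_comp_cancel:
  assumes "g \<in> carrier G" "h \<in> carrier G" "source G g = target G h"
  shows "comp G (ginv G g) (comp G g h) = h"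
  by (metis assms comp_assoc ginv_closed ginv_comp source_ginv target_comp_id)

lemma comp_ginv_cancel:
  assumes "g \<in> carrier G" "k \<in> carrier G" "target G g = target G k"
  shows "comp G g (comp G (ginv G g) k) = k"
  by (metis assms comp_assoc comp_ginv ginv_closed source_ginv target_comp_id target_ginv)

lemma comp_cancel_right:
  assumes "g \<in> carrier G" "h \<in> carrier G" "source G g = target G h"
  shows "comp G (comp G g h) (ginv G h) = g"
  by (metis assms comp_assoc comp_ginv comp_source ginv_closed target_ginv)

lemma comp_ginv_cancel_right:
  assumes "g \<in> carrier G" "h \<in> carrier G" "source G g = source G h"
  shows "comp G (comp G g (ginv G h)) h = g"
  by (metis assms comp_assoc comp_source ginv_closed ginv_comp source_ginv target_ginv)

lemma ginv_ginv: "g \<in> carrier G \<Longrightarrow> ginv G (ginv G g) = g"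
  using ginv_comp_cancel[of "ginv G g" g] comp_source[of "ginv G (ginv G g)"]
  by (simp add: ginv_closed source_ginv target_ginv ginv_comp)

lemma ginv_comp_distrib:
  assumes "g \<in> carrier G" "h \<in> carrier G" "source G g = target G h"
  shows "ginv G (comp G g h) = comp G (ginv G h) (ginv G g)"
proof -
  have k: "comp G g h \<in> carrier G" "ginv G (comp G g h) \<in> carrier G"
    using assms by (simp_all add: comp_closed ginv_closed)
  have "comp G (ginv G (comp G g h)) g = ginv G h"
    using ginv_comp_cancel[of "comp G g h" "ginv G h"] comp_cancel_right[OF assms] assms k
    by (simp add: ginv_closed source_comp target_ginv)
  then show ?thesis
    using comp_cancel_right[of "ginv G (comp G g h)" g] assms k
    by (simp add: source_ginv target_comp)
qed

text \<open>Translation by \<open>ginv G g\<close> is the inverse. This is the substitution k = g h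
  used for associativity and for the centralising identity of the separability element.\<close>

lemma bij_betw_comp_left:
  assumes "g \<in> carrier G"
  shows "bij_betw (comp G g) {h \<in> carrier G. target G h = source G g}
    {k \<in> carrier G. target G k = target G g}"
  by (rule bij_betw_byWitness [where f' = "comp G (ginv G g)"])
    (use assms in \<open>auto simp: ginv_comp_cancel comp_ginv_cancel comp_closed target_comp ginv_closed
      source_ginv target_ginv\<close>)

lemma isotropy_groupoid: "groupoid (isotropy G y)"
  unfolding isotropy_def homs_def
  by (standard, auto simp: source_closed target_closed source_source target_source source_target
      target_target comp_closed source_comp target_comp comp_assoc comp_source target_comp_id
      ginv_closed source_ginv target_ginv ginv_comp comp_ginv, metis target_comp_id)

lemma objs_isotropy: "y \<in> objs G \<Longrightarrow> objs (isotropy G y) = {y}"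
  unfolding objs_def isotropy_def homs_def using target_source[of y] by auto

end

text \<open>Multiplying by the central idempotent of \<open>ginv G g\<close> brings every element
  into the domain of \<open>\<alpha> g\<close>, so the partial isomorphism becomes a total map and
  later formulas need not carry domain conditions.\<close>

definition total_act ::
  "'g groupoid \<Rightarrow> ('g \<Rightarrow> 'a::ring set) \<Rightarrow> ('g \<Rightarrow> 'a \<Rightarrow> 'a) \<Rightarrow> 'g \<Rightarrow> 'a \<Rightarrow> 'a" where
  "total_act G D \<alpha> g r = \<alpha> g (r * identity_of (D (ginv G g)))"

text \<open>Kept apart from \<open>unital_action\<close> so that the abbreviations \<open>e\<close>
  and \<open>act\<close> can already be used in the assumptions of that locale.\<close>

locale action_data = groupoid G for G :: "'g groupoid" +
  fixes R :: "'a::ring set" and D :: "'g \<Rightarrow> 'a set" and \<alpha> :: "'g \<Rightarrow> 'a \<Rightarrow> 'a"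
begin

abbreviation e :: "'g \<Rightarrow> 'a" where "e g \<equiv> identity_of (D g)"
abbreviation act :: "'g \<Rightarrow> 'a \<Rightarrow> 'a" where "act \<equiv> total_act G D \<alpha>"

end

text \<open>
  A unital partial action enters the arguments below only through the ring endomorphisms \<open>act g\<close>
  and the central idempotents \<open>e g\<close>; the condition that \<open>\<alpha> (g h)\<close> extends \<open>\<alpha> g \<circ> \<alpha> h\<close> becomes
  the equation \<open>act_act\<close>.
\<close>

locale unital_action = action_data +
  assumes fin: "finite (carrier G)"
    and zero_in: "0 \<in> R"
    and diff_in: "\<lbrakk>r \<in> R; s \<in> R\<rbrakk> \<Longrightarrow> r - s \<in> R"
    and mult_in: "\<lbrakk>r \<in> R; s \<in> R\<rbrakk> \<Longrightarrow> r * s \<in> R"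
    and in_D_iff: "g \<in> carrier G \<Longrightarrow> r \<in> D g \<longleftrightarrow> r \<in> R \<and> r * e g = r"
    and e_in: "g \<in> carrier G \<Longrightarrow> e g \<in> R"
    and e_central: "\<lbrakk>g \<in> carrier G; r \<in> R\<rbrakk> \<Longrightarrow> e g * r = r * e g"
    and e_idem: "g \<in> carrier G \<Longrightarrow> e g * e g = e g"
    and e_target: "g \<in> carrier G \<Longrightarrow> e g * e (target G g) = e g"
    and e_orth: "\<lbrakk>y \<in> objs G; z \<in> objs G; y \<noteq> z\<rbrakk> \<Longrightarrow> e y * e z = 0"
    and e_sum: "r \<in> R \<Longrightarrow> (\<Sum>y\<in>objs G. r * e y) = r"
    and act_in: "\<lbrakk>g \<in> carrier G; r \<in> R\<rbrakk> \<Longrightarrow> act g r \<in> R"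
    and act_e: "\<lbrakk>g \<in> carrier G; r \<in> R\<rbrakk> \<Longrightarrow> act g r * e g = act g r"
    and act_add: "\<lbrakk>g \<in> carrier G; r \<in> R; s \<in> R\<rbrakk> \<Longrightarrow> act g (r + s) = act g r + act g s"
    and act_mult: "\<lbrakk>g \<in> carrier G; r \<in> R; s \<in> R\<rbrakk> \<Longrightarrow> act g (r * s) = act g r * act g s"
    and act_source: "g \<in> carrier G \<Longrightarrow> act g (e (source G g)) = e g"
    and act_act: "\<lbrakk>g \<in> carrier G; h \<in> carrier G; source G g = target G h; r \<in> R\<rbrakk>
          \<Longrightarrow> act g (act h r) = act (comp G g h) r * e g"
    and act_obj: "\<lbrakk>y \<in> objs G; r \<in> R\<rbrakk> \<Longrightarrow> act y r = r * e y"
begin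

section \<open>Calculus of the endomorphisms and their idempotents\<close>

lemma fin_objs: "finite (objs G)"
  using fin by (auto simp: objs_def)

lemma uminus_in: "r \<in> R \<Longrightarrow> - r \<in> R"
  using diff_in [OF zero_in] by simp

lemma add_in: "\<lbrakk>r \<in> R; s \<in> R\<rbrakk> \<Longrightarrow> r + s \<in> R"
  using diff_in [of r "- s"] uminus_in by simp

lemma sum_in: "(\<And>i. i \<in> J \<Longrightarrow> f i \<in> R) \<Longrightarrow> sum f J \<in> R"
  by (induction J rule: infinite_finite_induct) (auto simp: zero_in add_in)

lemma D_in: "\<lbrakk>g \<in> carrier G; r \<in> D g\<rbrakk> \<Longrightarrow> r \<in> R"
  by (simp add: in_D_iff)

lemma D_e: "\<lbrakk>g \<in> carrier G; r \<in> D g\<rbrakk> \<Longrightarrow> r * e g = r"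
  by (simp add: in_D_iff)

lemma e_in_D: "g \<in> carrier G \<Longrightarrow> e g \<in> D g"
  by (simp add: in_D_iff e_in e_idem)

lemma act_in_D: "\<lbrakk>g \<in> carrier G; r \<in> R\<rbrakk> \<Longrightarrow> act g r \<in> D g"
  by (simp add: in_D_iff act_in act_e)

lemma zero_in_D: "g \<in> carrier G \<Longrightarrow> 0 \<in> D g"
  by (simp add: in_D_iff zero_in)

lemma add_in_D: "\<lbrakk>g \<in> carrier G; r \<in> D g; s \<in> D g\<rbrakk> \<Longrightarrow> r + s \<in> D g"
  by (simp add: in_D_iff add_in distrib_right)

lemma uminus_in_D: "\<lbrakk>g \<in> carrier G; r \<in> D g\<rbrakk> \<Longrightarrow> - r \<in> D g"
  by (simp add: in_D_iff uminus_in)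

lemma mult_in_D_left: "\<lbrakk>g \<in> carrier G; r \<in> R; s \<in> D g\<rbrakk> \<Longrightarrow> r * s \<in> D g"
  by (simp add: in_D_iff mult_in mult.assoc)

lemma mult_in_D_right: "\<lbrakk>g \<in> carrier G; r \<in> D g; s \<in> R\<rbrakk> \<Longrightarrow> r * s \<in> D g"
  using e_central[of g s] by (simp add: in_D_iff mult_in mult.assoc) (metis mult.assoc)

lemma sum_in_D: "\<lbrakk>g \<in> carrier G; \<And>i. i \<in> J \<Longrightarrow> f i \<in> D g\<rbrakk> \<Longrightarrow> sum f J \<in> D g"
  by (induction J rule: infinite_finite_induct) (auto simp: zero_in_D add_in_D)

lemma D_target:
  assumes "g \<in> carrier G" "r \<in> D g"
  shows "r \<in> D (target G g)"
proof -
  have "r * e (target G g) = r * (e g * e (target G g))"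
    using D_e[OF assms] by (simp add: mult.assoc[symmetric])
  then have "r * e (target G g) = r"
    using assms by (simp add: e_target D_e)
  then show ?thesis
    using assms by (simp add: in_D_iff target_closed D_in)
qed

lemma act_zero: "g \<in> carrier G \<Longrightarrow> act g 0 = 0"
  using act_add [of g 0 0] zero_in by simp

lemma act_sum: "\<lbrakk>g \<in> carrier G; \<And>i. i \<in> J \<Longrightarrow> f i \<in> R\<rbrakk> \<Longrightarrow> act g (sum f J) = (\<Sum>i\<in>J. act g (f i))"
  by (induction J rule: infinite_finite_induct) (auto simp: act_zero act_add sum_in)

lemma act_mult_e_source:
  assumes "g \<in> carrier G" "r \<in> R"
  shows "act g (r * e (source G g)) = act g r"
  using assms by (simp add: act_mult act_source act_e e_in source_closed)

text \<open>\<open>act g\<close> sees only the component at \<open>source G g\<close>, and the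
  components at different objects are orthogonal.\<close>

lemma act_eq_zero:
  assumes "g \<in> carrier G" "r \<in> D y" "y \<in> objs G" "y \<noteq> source G g"
  shows "act g r = 0"
proof -
  have "r * e (source G g) = r * (e y * e (source G g))"
    using assms D_e objsD by (metis mult.assoc)
  also have "\<dots> = 0"
    using e_orth assms source_in_objs by simp
  finally show ?thesis
    using act_mult_e_source[of g r] assms D_in act_zero objsD by metis
qed

text \<open>Evaluate \<open>act_act\<close> at \<open>e (source G h)\<close>, which
  \<open>act h\<close> sends to \<open>e h\<close> and \<open>act (comp G g h)\<close> to
  \<open>e (comp G g h)\<close>. This is the familiar formula for the image of the identity of the
  intersection of \<open>D (ginv G g)\<close> and \<open>D h\<close>.\<close>

lemma act_e_eq:
  assumes "g \<in> carrier G" "h \<in> carrier G" "source G g = target G h"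
  shows "act g (e h) = e (comp G g h) * e g"
  using act_act[of g h "e (source G h)"] assms act_source[of h] act_source[of "comp G g h"]
  by (simp add: e_in source_closed source_comp comp_closed)

lemma act_e_ginv: "g \<in> carrier G \<Longrightarrow> act g (e (ginv G g)) = e g"
  using act_e_eq[of g "ginv G g"] e_target[of g] e_central[of g "e (target G g)"]
  by (simp add: ginv_closed target_ginv comp_ginv e_in target_closed)

lemma act_act_ginv:
  assumes "g \<in> carrier G" "r \<in> R"
  shows "act g (act (ginv G g) r) = r * e g"
proof -
  have "act g (act (ginv G g) r) = r * e (target G g) * e g"
    using assms act_act[of g "ginv G g" r] act_obj[of "target G g" r]
    by (simp add: ginv_closed target_ginv comp_ginv target_in_objs)
  then show ?thesis
    using assms e_target[of g] e_central[of g "e (target G g)"]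
    by (simp add: mult.assoc e_in target_closed)
qed

lemma act_mult_absorb:
  assumes "g \<in> carrier G" "r \<in> R" "s \<in> R"
  shows "act g r * (e g * s) = act g r * s"
  using assms act_e mult.assoc by metis

text \<open>Since r = r \<open>e h\<close>, the value contains the factor
  \<open>act g (e h)\<close>, which contains \<open>e (comp G g h)\<close>. Thus
  \<open>act g\<close> maps \<open>D h\<close> into \<open>D (comp G g h)\<close>, which keeps
  products in the right component.\<close>

lemma act_absorb:
  assumes "g \<in> carrier G" "h \<in> carrier G" "source G g = target G h" "r \<in> D h"
  shows "act g r * e (comp G g h) = act g r"
proof -
  have "act g r = act g r * act g (e h)"
    using assms D_e D_in act_mult e_in by metis
  also have "\<dots> = act g r * (e (comp G g h) * e g)"
    using act_e_eq assms by simp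
  also have "\<dots> = act g r * e (comp G g h)"
    using act_mult_absorb[OF assms(1) D_in[OF assms(2,4)] e_in[OF comp_closed[OF assms(1-3)]]]
      e_central[OF assms(1) e_in[OF comp_closed[OF assms(1-3)]]] by simp
  finally show ?thesis by simp
qed

text \<open>The factor c absorbs the idempotent \<open>e g\<close> left over by
  \<open>act_act\<close>, so behind such a factor \<open>act\<close> behaves like a genuine
  action.\<close>

lemma act_act_D:
  assumes "g \<in> carrier G" "h \<in> carrier G" "source G g = target G h" "r \<in> R" "c \<in> D g"
  shows "c * act g (act h r) = c * act (comp G g h) r"
proof -
  have "c * act g (act h r) = c * (e g * act (comp G g h) r)"
    using act_act[OF assms(1-4)] e_central[OF assms(1) act_in[OF comp_closed[OF assms(1-3)] assms(4)]] by simp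
  then show ?thesis
    using assms D_e by (metis mult.assoc)
qed

text \<open>Although \<open>act g\<close> need not be surjective, next to \<open>act g a\<close> any
  r may be replaced by r \<open>e g\<close>, which is the image of \<open>act (ginv G g) r\<close>;
  there the centrality of a applies.\<close>

lemma act_central:
  assumes "g \<in> carrier G" "a \<in> center_of R" "r \<in> R"
  shows "act g a * r = r * act g a"
proof -
  have a: "a \<in> R" "\<And>c. c \<in> R \<Longrightarrow> a * c = c * a"
    using assms by (auto simp: center_of_def)
  let ?r = "act (ginv G g) r"
  have r': "?r \<in> R"
    using assms by (simp add: act_in ginv_closed)
  have re: "act g ?r = r * e g"
    using assms by (simp add: act_act_ginv)
  have "act g a * r = act g a * (r * e g)"
    using act_mult_absorb[OF assms(1) a(1) assms(3)] e_central[OF assms(1,3)] by simp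
  also have "\<dots> = act g (?r * a)"
    using act_mult[OF assms(1) a(1) r'] re a(2)[OF r'] by simp
  also have "\<dots> = r * (e g * act g a)"
    using act_mult[OF assms(1) r' a(1)] re by (simp add: mult.assoc)
  also have "\<dots> = r * act g a"
    using e_central[OF assms(1) act_in[OF assms(1) a(1)]] act_e[OF assms(1) a(1)] by simp
  finally show ?thesis .
qed

section \<open>The convolution product and its associativity\<close>

abbreviation "S \<equiv> skew_groupoid_ring G D \<alpha>"
abbreviation "fibre z \<equiv> {g \<in> carrier G. target G g = z}"

lemma fin_fibre: "finite (fibre z)"
  using fin by simp

lemma carrier_S: "u \<in> carrier S \<longleftrightarrow>
    (\<forall>g\<in>carrier G. u g \<in> D g) \<and> (\<forall>g. g \<notin> carrier G \<longrightarrow> u g = 0)"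
  by (simp add: skew_groupoid_ring_def)

lemma S_in_D: "\<lbrakk>u \<in> carrier S; g \<in> carrier G\<rbrakk> \<Longrightarrow> u g \<in> D g"
  by (simp add: carrier_S)

lemma S_in_R: "\<lbrakk>u \<in> carrier S; g \<in> carrier G\<rbrakk> \<Longrightarrow> u g \<in> R"
  using S_in_D D_in by blast

lemma zero_S: "\<zero>\<^bsub>S\<^esub> = (\<lambda>_. 0)"
  by (simp add: skew_groupoid_ring_def)

lemma add_S: "u \<oplus>\<^bsub>S\<^esub> v = (\<lambda>g. u g + v g)"
  by (simp add: skew_groupoid_ring_def)

lemma one_S: "\<one>\<^bsub>S\<^esub> = (\<lambda>g. if g \<in> objs G then e g else 0)"
  by (simp add: skew_groupoid_ring_def)

text \<open>A factorisation k = g h is determined by g, which may be any morphism with the target of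
  k. Summing over g alone makes double sums easy to exchange.\<close>

lemma mult_S: "(u \<otimes>\<^bsub>S\<^esub> v) k = (if k \<in> carrier G then
    \<Sum>g\<in>fibre (target G k). u g * act g (v (comp G (ginv G g) k)) else 0)"
proof -
  let ?P = "{(g, h). g \<in> carrier G \<and> h \<in> carrier G \<and> source G g = target G h \<and> comp G g h = k}"
  have m: "(u \<otimes>\<^bsub>S\<^esub> v) k = (\<Sum>(g, h)\<in>?P. u g * act g (v h))"
    by (simp add: skew_groupoid_ring_def total_act_def)
  show ?thesis
  proof (cases "k \<in> carrier G")
    case False
    then have P: "?P = {}" using comp_closed by auto
    show ?thesis unfolding m P using False by simp
  next
    case True
    have "(\<Sum>g\<in>fibre (target G k). u g * act g (v (comp G (ginv G g) k)))
        = (\<Sum>(g, h)\<in>?P. u g * act g (v h))"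
      by (rule sum.reindex_bij_witness
          [where j = "\<lambda>g. (g, comp G (ginv G g) k)" and i = fst])
        (use True in \<open>auto simp: ginv_closed comp_closed source_ginv target_ginv target_comp
          comp_ginv_cancel ginv_comp_cancel\<close>)
    then show ?thesis
      using m True by simp
  qed
qed

lemma mult_S_closed: "\<lbrakk>u \<in> carrier S; v \<in> carrier S\<rbrakk> \<Longrightarrow> u \<otimes>\<^bsub>S\<^esub> v \<in> carrier S"
proof -
  assume u: "u \<in> carrier S" and v: "v \<in> carrier S"
  have "u g * act g (v (comp G (ginv G g) k)) \<in> D k"
    if "k \<in> carrier G" "g \<in> carrier G" "target G g = target G k" for g k
  proof -
    let ?h = "comp G (ginv G g) k"
    have h: "?h \<in> carrier G" "source G g = target G ?h" "comp G g ?h = k"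
      using that by (auto simp: ginv_closed comp_closed source_ginv target_ginv target_comp
          comp_ginv_cancel)
    have "act g (v ?h) * e k = act g (v ?h)"
      using act_absorb[of g ?h "v ?h"] h that S_in_D v by simp
    then show ?thesis
      using that h S_in_R[OF u] S_in_R[OF v] by (simp add: in_D_iff mult.assoc mult_in act_in)
  qed
  then show ?thesis
    by (auto simp: carrier_S mult_S intro!: sum_in_D)
qed

lemma add_S_closed: "\<lbrakk>u \<in> carrier S; v \<in> carrier S\<rbrakk> \<Longrightarrow> u \<oplus>\<^bsub>S\<^esub> v \<in> carrier S"
  by (simp add: carrier_S add_S add_in_D)

lemma zero_S_closed: "\<zero>\<^bsub>S\<^esub> \<in> carrier S"
  by (simp add: carrier_S zero_S zero_in_D)

lemma one_S_closed: "\<one>\<^bsub>S\<^esub> \<in> carrier S"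
  using objsD by (auto simp: carrier_S one_S zero_in_D e_in_D)

lemma uminus_S_closed: "u \<in> carrier S \<Longrightarrow> (\<lambda>g. - u g) \<in> carrier S"
  by (simp add: carrier_S uminus_in_D)

text \<open>Both sides are sums over the factorisations of k into three morphisms. Their terms agree
  because \<open>act g (v h)\<close> lies in \<open>D g\<close> and so absorbs the defect between
  \<open>act g\<close> after \<open>act h\<close> and \<open>act (comp G g h)\<close>.\<close>

lemma mult_S_assoc:
  assumes u: "u \<in> carrier S" and v: "v \<in> carrier S" and w: "w \<in> carrier S"
  shows "(u \<otimes>\<^bsub>S\<^esub> v) \<otimes>\<^bsub>S\<^esub> w = u \<otimes>\<^bsub>S\<^esub> (v \<otimes>\<^bsub>S\<^esub> w)"
proof
  fix k
  show "((u \<otimes>\<^bsub>S\<^esub> v) \<otimes>\<^bsub>S\<^esub> w) k = (u \<otimes>\<^bsub>S\<^esub> (v \<otimes>\<^bsub>S\<^esub> w)) k"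
  proof (cases "k \<in> carrier G")
    case False
    then show ?thesis by (simp add: mult_S)
  next
    case k: True
    let ?F = "fibre (target G k)"
    have "((u \<otimes>\<^bsub>S\<^esub> v) \<otimes>\<^bsub>S\<^esub> w) k =
        (\<Sum>p\<in>?F. \<Sum>g\<in>?F. u g * act g (v (comp G (ginv G g) p)) * act p (w (comp G (ginv G p) k)))"
      using k by (simp add: mult_S sum_distrib_right)
    also have "\<dots> =
        (\<Sum>g\<in>?F. \<Sum>p\<in>?F. u g * act g (v (comp G (ginv G g) p)) * act p (w (comp G (ginv G p) k)))"
      by (rule sum.swap)
    also have "\<dots> = (\<Sum>g\<in>?F. u g * act g ((v \<otimes>\<^bsub>S\<^esub> w) (comp G (ginv G g) k)))"
    proof (rule sum.cong[OF refl])
      fix g assume "g \<in> ?F"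
      then have g: "g \<in> carrier G" "target G g = target G k" by auto
      let ?k = "comp G (ginv G g) k"
      have k': "?k \<in> carrier G" "target G ?k = source G g"
        using g k by (auto simp: ginv_closed comp_closed source_ginv target_ginv target_comp)
      \<comment> \<open>For fixed g the index p, the product of the first two morphisms, is written
        as p = g h with h the middle morphism.\<close>
      have "(\<Sum>p\<in>?F. u g * act g (v (comp G (ginv G g) p)) * act p (w (comp G (ginv G p) k)))
          = (\<Sum>h\<in>fibre (source G g). u g * act g (v (comp G (ginv G g) (comp G g h)))
              * act (comp G g h) (w (comp G (ginv G (comp G g h)) k)))"
        using sum.reindex_bij_betw[OF bij_betw_comp_left[OF g(1)], symmetric] g(2) by simp
      also have "\<dots> = (\<Sum>h\<in>fibre (source G g). u g * act g (v h * act h (w (comp G (ginv G h) ?k))))"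
      proof (rule sum.cong[OF refl])
        fix h assume "h \<in> fibre (source G g)"
        then have h: "h \<in> carrier G" "source G g = target G h" by auto
        have eq: "comp G (ginv G (comp G g h)) k = comp G (ginv G h) ?k"
          using g h k by (simp add: ginv_comp_distrib comp_assoc ginv_closed source_ginv target_ginv)
        have w': "w (comp G (ginv G h) ?k) \<in> R"
          using h g k k' by (intro S_in_R[OF w] comp_closed) (auto simp: ginv_closed source_ginv)
        have v': "v h \<in> R" using S_in_R v h by blast
        have "act g (v h * act h (w (comp G (ginv G h) ?k)))
            = act g (v h) * act g (act h (w (comp G (ginv G h) ?k)))"
          using g h w' v' by (simp add: act_mult act_in)
        also have "\<dots> = act g (v h) * act (comp G g h) (w (comp G (ginv G h) ?k))"
          using g h w' v' by (intro act_act_D) (auto simp: act_in_D)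
        finally show "u g * act g (v (comp G (ginv G g) (comp G g h)))
              * act (comp G g h) (w (comp G (ginv G (comp G g h)) k))
            = u g * act g (v h * act h (w (comp G (ginv G h) ?k)))"
          unfolding eq using g h by (simp add: ginv_comp_cancel mult.assoc)
      qed
      also have "\<dots> = u g * act g ((v \<otimes>\<^bsub>S\<^esub> w) ?k)"
      proof -
        have *: "v h * act h (w (comp G (ginv G h) ?k)) \<in> R" if "h \<in> fibre (source G g)" for h
          using that g k k' by (intro mult_in act_in S_in_R[OF v] S_in_R[OF w] comp_closed)
            (auto simp: ginv_closed source_ginv)
        have "act g ((v \<otimes>\<^bsub>S\<^esub> w) ?k)
            = (\<Sum>h\<in>fibre (source G g). act g (v h * act h (w (comp G (ginv G h) ?k))))"
          using k' act_sum[where J = "fibre (source G g)", OF g(1) *] by (simp add: mult_S)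
        then show ?thesis
          by (simp add: sum_distrib_left)
      qed
      finally show "(\<Sum>p\<in>?F. u g * act g (v (comp G (ginv G g) p)) * act p (w (comp G (ginv G p) k)))
          = u g * act g ((v \<otimes>\<^bsub>S\<^esub> w) ?k)" .
    qed
    also have "\<dots> = (u \<otimes>\<^bsub>S\<^esub> (v \<otimes>\<^bsub>S\<^esub> w)) k"
      using k by (simp only: mult_S if_True)
    finally show ?thesis .
  qed
qed

end

section \<open>The partial skew groupoid ring\<close>

context unital_action
begin

abbreviation "one_R \<equiv> \<Sum>y\<in>objs G. e y"
abbreviation "emb \<equiv> skew_embedding G D"

lemma one_R_in: "one_R \<in> R"
  by (intro sum_in e_in) (simp add: objsD)

lemma mult_one_R: "r \<in> R \<Longrightarrow> r * one_R = r"
  using e_sum by (simp add: sum_distrib_left)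

lemma one_R_mult: "r \<in> R \<Longrightarrow> one_R * r = r"
proof -
  assume r: "r \<in> R"
  have "one_R * r = (\<Sum>y\<in>objs G. r * e y)"
    unfolding sum_distrib_right using e_central[OF _ r] objsD by (intro sum.cong) auto
  then show ?thesis using e_sum[OF r] by simp
qed

text \<open>\<open>set_ring\<close> takes its unit from \<open>identity_of\<close>, so that
  description has to be evaluated; by \<open>e_sum\<close> the identity is assembled from the object
  idempotents.\<close>

lemma identity_R: "identity_of R = one_R"
  unfolding identity_of_def[of R]
proof (rule the_equality)
  show "is_identity one_R R"
    using one_R_in mult_one_R one_R_mult by (simp add: is_identity_def)
  fix u assume "is_identity u R"
  then show "u = one_R"
    using one_R_in mult_one_R[of u] by (auto simp: is_identity_def)
qed

lemma ring_set_ring: "ring (set_ring R)"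
proof (rule ringI)
  show "abelian_group (set_ring R)"
  proof (rule abelian_groupI)
    fix r assume r: "r \<in> carrier (set_ring R)"
    show "\<exists>s\<in>carrier (set_ring R). s \<oplus>\<^bsub>set_ring R\<^esub> r = \<zero>\<^bsub>set_ring R\<^esub>"
      by (rule bexI[of _ "- r"]) (use r in \<open>auto simp: set_ring_def uminus_in\<close>)
  qed (auto simp: set_ring_def add_in zero_in add_ac)
  show "monoid (set_ring R)"
    by (rule monoidI)
      (auto simp: set_ring_def identity_R mult_in one_R_in mult_one_R one_R_mult mult.assoc)
qed (auto simp: set_ring_def distrib_left distrib_right)

lemma emb_S: "r \<in> R \<Longrightarrow> emb r \<in> carrier S"
  using objsD by (auto simp: carrier_S skew_embedding_def zero_in_D e_in_D mult_in_D_left)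

lemma emb_one: "emb one_R = \<one>\<^bsub>S\<^esub>"
  using objsD one_R_mult[OF e_in] by (auto simp: one_S skew_embedding_def)

lemma emb_mult_S:
  assumes r: "r \<in> R" and u: "u \<in> carrier S"
  shows "(emb r \<otimes>\<^bsub>S\<^esub> u) k = r * u k"
proof (cases "k \<in> carrier G")
  case False
  then show ?thesis using u by (simp add: mult_S carrier_S)
next
  case k: True
  have uk: "u k \<in> R" "e (target G k) * u k = u k"
    using k u S_in_R[OF u k] D_e[OF target_closed[OF k] D_target[OF k S_in_D[OF u k]]]
      e_central[of "target G k" "u k"] by (auto simp: target_closed)
  have "(emb r \<otimes>\<^bsub>S\<^esub> u) k = (\<Sum>g\<in>fibre (target G k).
      if g = target G k then r * e g * act g (u (comp G (ginv G g) k)) else 0)"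
    unfolding mult_S skew_embedding_def using k objsD
    by (auto intro!: sum.cong simp: target_in_objs)
  also have "\<dots> = r * e (target G k) * act (target G k) (u k)"
    using k by (simp add: fin target_closed target_target ginv_obj target_in_objs target_comp_id)
  also have "\<dots> = r * u k"
    using uk k e_central[OF target_closed[OF k] uk(1)]
    by (simp add: act_obj target_in_objs target_closed mult.assoc)
  finally show ?thesis .
qed

text \<open>The embedded element lives on objects, so only g = k contributes. In contrast to left
  multiplication the scalar gets twisted by \<open>act k\<close>, and this twist is what the
  balancing relation will exploit.\<close>

lemma S_mult_emb:
  assumes r: "r \<in> R" and u: "u \<in> carrier S"
  shows "(u \<otimes>\<^bsub>S\<^esub> emb r) k = u k * act k r"
proof (cases "k \<in> carrier G")
  case False
  then show ?thesis using u by (simp add: mult_S carrier_S)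
next
  case k: True
  have "u g * act g (emb r (comp G (ginv G g) k)) = (if g = k then u k * act k r else 0)"
    if g: "g \<in> carrier G" "target G g = target G k" for g
  proof (cases "g = k")
    case True
    have "comp G (ginv G g) k = source G k"
      using k True by (simp add: ginv_comp)
    then show ?thesis
      using True k r by (simp add: skew_embedding_def source_in_objs act_mult_e_source)
  next
    case False
    have "comp G (ginv G g) k \<notin> objs G"
    proof
      assume "comp G (ginv G g) k \<in> objs G"
      then have "comp G (ginv G g) k = source G g"
        using objsD[of "comp G (ginv G g) k"] g k
        by (simp add: target_comp ginv_closed source_ginv target_ginv)
      then have "k = comp G g (source G g)"
        using comp_ginv_cancel[OF g(1) k g(2)] by simp
      then show False using False comp_source g by simp
    qed
    then show ?thesis using False g by (simp add: skew_embedding_def act_zero)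
  qed
  then have "(u \<otimes>\<^bsub>S\<^esub> emb r) k = (\<Sum>g\<in>fibre (target G k). if g = k then u k * act k r else 0)"
    using k unfolding mult_S by (auto intro!: sum.cong)
  then show ?thesis using k by (simp add: fin)
qed

lemma act_one_R: "g \<in> carrier G \<Longrightarrow> act g one_R = e g"
proof -
  assume g: "g \<in> carrier G"
  have "act g one_R = act g (one_R * e (source G g))"
    using g by (simp add: act_mult_e_source one_R_in)
  then show ?thesis
    using g by (simp add: one_R_mult e_in source_closed act_source)
qed

lemma ring_S: "ring S"
proof (rule ringI)
  show "abelian_group S"
  proof (rule abelian_groupI)
    fix u assume u: "u \<in> carrier S"
    show "\<exists>v\<in>carrier S. v \<oplus>\<^bsub>S\<^esub> u = \<zero>\<^bsub>S\<^esub>"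
      by (rule bexI[OF _ uminus_S_closed[OF u]]) (simp add: add_S zero_S)
  qed (auto simp: add_S_closed zero_S_closed, simp_all add: add_S zero_S add_ac)
  show "monoid S"
  proof (rule monoidI)
    fix u assume u: "u \<in> carrier S"
    have "one_R * u k = u k" "u k * act k one_R = u k" for k
      using u one_R_mult act_one_R S_in_R[OF u] S_in_D[OF u] D_e
      by (cases "k \<in> carrier G"; simp add: carrier_S)+
    then show "\<one>\<^bsub>S\<^esub> \<otimes>\<^bsub>S\<^esub> u = u" "u \<otimes>\<^bsub>S\<^esub> \<one>\<^bsub>S\<^esub> = u"
      unfolding emb_one[symmetric]
      using emb_mult_S[OF one_R_in u] S_mult_emb[OF one_R_in u] by (auto simp: fun_eq_iff)
  qed (auto simp: mult_S_closed one_S_closed mult_S_assoc)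
  fix u v w assume uvw: "u \<in> carrier S" "v \<in> carrier S" "w \<in> carrier S"
  show "(u \<oplus>\<^bsub>S\<^esub> v) \<otimes>\<^bsub>S\<^esub> w = u \<otimes>\<^bsub>S\<^esub> w \<oplus>\<^bsub>S\<^esub> v \<otimes>\<^bsub>S\<^esub> w"
    by (auto simp: add_S mult_S distrib_right sum.distrib)
  show "w \<otimes>\<^bsub>S\<^esub> (u \<oplus>\<^bsub>S\<^esub> v) = w \<otimes>\<^bsub>S\<^esub> u \<oplus>\<^bsub>S\<^esub> w \<otimes>\<^bsub>S\<^esub> v"
  proof
    fix k
    have *: "act g (u (comp G (ginv G g) k) + v (comp G (ginv G g) k))
        = act g (u (comp G (ginv G g) k)) + act g (v (comp G (ginv G g) k))"
      if "g \<in> carrier G" "target G g = target G k" "k \<in> carrier G" for g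
    proof -
      have "comp G (ginv G g) k \<in> carrier G"
        using that by (auto simp: ginv_closed comp_closed source_ginv)
      then show ?thesis using that uvw S_in_R act_add by blast
    qed
    then show "(w \<otimes>\<^bsub>S\<^esub> (u \<oplus>\<^bsub>S\<^esub> v)) k = (w \<otimes>\<^bsub>S\<^esub> u \<oplus>\<^bsub>S\<^esub> w \<otimes>\<^bsub>S\<^esub> v) k"
      by (simp add: add_S mult_S distrib_left sum.distrib)
  qed
qed

text \<open>Agreement of \<phi> with \<open>emb\<close> is asked on R only, so that the same result
  serves \<open>skew_embedding\<close> for the groupoid and \<open>delta x\<close> for the isotropy
  group.\<close>

lemma ring_extension_emb:
  assumes \<phi>: "\<And>r. r \<in> R \<Longrightarrow> \<phi> r = emb r"
  shows "ring_extension (set_ring R) S \<phi>"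
proof -
  have mult: "emb (r * s) = emb r \<otimes>\<^bsub>S\<^esub> emb s" if "r \<in> R" "s \<in> R" for r s
    using emb_mult_S[OF that(1) emb_S[OF that(2)]]
    by (auto simp: fun_eq_iff skew_embedding_def mult.assoc)
  have hom: "\<phi> \<in> ring_hom (set_ring R) S"
    by (rule ring_hom_memI)
      (use mult in \<open>auto simp: set_ring_def \<phi> emb_S emb_one identity_R one_R_in mult_in add_in\<close>,
        auto simp: skew_embedding_def add_S distrib_right)
  have "inj_on \<phi> (carrier (set_ring R))"
  proof (rule inj_onI)
    fix r s assume rs: "r \<in> carrier (set_ring R)" "s \<in> carrier (set_ring R)" "\<phi> r = \<phi> s"
    then have R: "r \<in> R" "s \<in> R" and "emb r = emb s"
      by (auto simp: set_ring_def \<phi>)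
    then have "r * e y = s * e y" if "y \<in> objs G" for y
      using that by (auto simp: skew_embedding_def fun_eq_iff split: if_splits)
    then have "(\<Sum>y\<in>objs G. r * e y) = (\<Sum>y\<in>objs G. s * e y)"
      by simp
    then show "r = s" using e_sum R by simp
  qed
  then show ?thesis
    unfolding ring_extension_def using ring_set_ring ring_S hom by simp
qed

section \<open>Monomials of the skew groupoid ring\<close>

lemma delta_S: "\<lbrakk>g \<in> carrier G; c \<in> D g\<rbrakk> \<Longrightarrow> delta g c \<in> carrier S"
  by (auto simp: carrier_S delta_def zero_in_D)

lemma delta_mult_S:
  assumes "g \<in> carrier G" "k \<in> carrier G"
  shows "(delta g a \<otimes>\<^bsub>S\<^esub> v) k =
    (if target G g = target G k then a * act g (v (comp G (ginv G g) k)) else 0)"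
proof -
  have "(delta g a \<otimes>\<^bsub>S\<^esub> v) k =
      (\<Sum>p\<in>fibre (target G k). if p = g then a * act g (v (comp G (ginv G g) k)) else 0)"
    unfolding mult_S using assms by (auto simp: delta_def intro!: sum.cong)
  then show ?thesis using assms by (simp add: fin)
qed

lemma delta_mult_delta:
  assumes g: "g \<in> carrier G" and h: "h \<in> carrier G"
  shows "delta g a \<otimes>\<^bsub>S\<^esub> delta h b =
    (if source G g = target G h then delta (comp G g h) (a * act g b) else \<zero>\<^bsub>S\<^esub>)"
proof
  fix k
  show "(delta g a \<otimes>\<^bsub>S\<^esub> delta h b) k =
    (if source G g = target G h then delta (comp G g h) (a * act g b) else \<zero>\<^bsub>S\<^esub>) k"
  proof (cases "k \<in> carrier G")
    case False
    then show ?thesis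
      using comp_closed[OF g h] by (auto simp: mult_S delta_def zero_S)
  next
    case k: True
    have "comp G (ginv G g) k = h \<and> target G g = target G k \<longleftrightarrow>
        source G g = target G h \<and> comp G g h = k"
      using g h k comp_ginv_cancel[OF g k] ginv_comp_cancel[OF g h]
      by (auto simp: target_comp ginv_closed source_ginv target_ginv)
    then show ?thesis
      using delta_mult_S[OF g k] by (auto simp: delta_def zero_S act_zero g)
  qed
qed

lemma finsum_S:
  assumes "finite J" "\<And>j. j \<in> J \<Longrightarrow> f j \<in> carrier S"
  shows "finsum S f J = (\<lambda>k. \<Sum>j\<in>J. f j k)"
proof -
  interpret S: ring S by (rule ring_S)
  show ?thesis
    using assms by (induction J rule: finite_induct) (auto simp: zero_S Pi_def, simp add: add_S)
qed

text \<open>Reduces identities that are additive in u to monomials.\<close>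

lemma S_decomp:
  assumes u: "u \<in> carrier S"
  shows "u = finsum S (\<lambda>g. delta g (u g)) (carrier G)"
proof -
  have "finsum S (\<lambda>g. delta g (u g)) (carrier G) = (\<lambda>k. \<Sum>g\<in>carrier G. delta g (u g) k)"
    using fin u by (intro finsum_S) (auto intro: delta_S S_in_D)
  also have "\<dots> = (\<lambda>k. \<Sum>g\<in>carrier G. if g = k then u k else 0)"
    by (intro ext sum.cong) (auto simp: delta_def)
  also have "\<dots> = u"
    using fin u by (auto simp: carrier_S)
  finally show ?thesis by simp
qed

end

section \<open>Semisimplicity from a trace element\<close>

lemma complement_projection:
  fixes M :: "('s, 'm) module" (structure)
  assumes M: "abelian_group M" and N: "submodule N S M"
    and \<phi>: "\<And>r. r \<in> carrier R \<Longrightarrow> \<phi> r \<in> carrier S"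
    and distr: "\<And>s v w. \<lbrakk>s \<in> carrier S; v \<in> carrier M; w \<in> carrier M\<rbrakk> \<Longrightarrow> s \<odot> (v \<oplus> w) = s \<odot> v \<oplus> s \<odot> w"
    and compl: "has_complement R (restrict_scalars \<phi> M) N"
  obtains p where "\<And>v. v \<in> carrier M \<Longrightarrow> p v \<in> N" "\<And>v. v \<in> N \<Longrightarrow> p v = v"
    "\<And>v w. \<lbrakk>v \<in> carrier M; w \<in> carrier M\<rbrakk> \<Longrightarrow> p (v \<oplus> w) = p v \<oplus> p w"
    "\<And>r v. \<lbrakk>r \<in> carrier R; v \<in> carrier M\<rbrakk> \<Longrightarrow> p (\<phi> r \<odot> v) = \<phi> r \<odot> p v"
proof -
  interpret M: abelian_group M by (rule M)
  obtain K where K: "submodule K R (restrict_scalars \<phi> M)" "N \<inter> K = {\<zero>}" "N <+>\<^bsub>M\<^esub> K = carrier M"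
    using compl by (auto simp: has_complement_def restrict_scalars_def set_add_def set_mult_def)
  have N_sub: "subgroup N (add_monoid M)" and N_smult: "\<And>s v. \<lbrakk>s \<in> carrier S; v \<in> N\<rbrakk> \<Longrightarrow> s \<odot> v \<in> N"
    using N by (auto simp: submodule_def submodule_axioms_def)
  have K_sub: "subgroup K (add_monoid M)" and K_smult: "\<And>r v. \<lbrakk>r \<in> carrier R; v \<in> K\<rbrakk> \<Longrightarrow> \<phi> r \<odot> v \<in> K"
    using K(1) by (auto simp: submodule_def submodule_axioms_def restrict_scalars_def subgroup_def m_inv_def)
  note N_rules = subgroup.subset[OF N_sub, simplified] subgroup.m_closed[OF N_sub, simplified]
    subgroup.m_inv_closed[OF N_sub, folded a_inv_def] subgroup.one_closed[OF N_sub, simplified]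
  note K_rules = subgroup.subset[OF K_sub, simplified] subgroup.m_closed[OF K_sub, simplified]
    subgroup.m_inv_closed[OF K_sub, folded a_inv_def] subgroup.one_closed[OF K_sub, simplified]
  define p where "p v = (THE n. n \<in> N \<and> (\<exists>k\<in>K. v = n \<oplus> k))" for v
  \<comment> \<open>The difference n - n' = k' - k lies in both N and K, hence vanishes; this makes
    the description defining p meaningful.\<close>
  have uniq: "n = n'" if "n \<in> N" "n' \<in> N" "k \<in> K" "k' \<in> K" "n \<oplus> k = n' \<oplus> k'" for n n' k k'
  proof -
    have c: "n \<in> carrier M" "n' \<in> carrier M" "k \<in> carrier M" "k' \<in> carrier M"
      using that N_rules(1) K_rules(1) by auto
    have "n = (n' \<oplus> k') \<ominus> k"
      using c that(5)[symmetric] by (simp add: a_minus_def M.a_assoc M.r_neg)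
    then have "n \<ominus> n' = k' \<ominus> k"
      using c M.a_assoc[of n' "\<ominus> n'" "\<ominus> k"]
      by (simp add: a_minus_def M.a_ac M.r_neg)
    moreover have "n \<ominus> n' \<in> N" "k' \<ominus> k \<in> K"
      using that N_rules K_rules by (auto simp: a_minus_def)
    ultimately have "n \<ominus> n' = \<zero>"
      using K(2) by auto
    then show ?thesis
      using c M.minus_equality[of n "\<ominus> n'"] by (simp add: a_minus_def)
  qed
  have p_eq: "p (n \<oplus> k) = n" if "n \<in> N" "k \<in> K" for n k
    unfolding p_def using that uniq by (intro the_equality) auto
  have decomp: "\<exists>n\<in>N. \<exists>k\<in>K. v = n \<oplus> k" if "v \<in> carrier M" for v
    using that unfolding K(3)[symmetric] by (auto simp: set_add_def set_mult_def)
  show thesis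
  proof
    show "p v \<in> N" if "v \<in> carrier M" for v
      using decomp[OF that] p_eq by auto
    show "p v = v" if "v \<in> N" for v
      using p_eq[OF that K_rules(4)] that N_rules(1) by auto
    show "p (v \<oplus> w) = p v \<oplus> p w" if vw: "v \<in> carrier M" "w \<in> carrier M" for v w
    proof -
      obtain n k n' k' where nk: "n \<in> N" "k \<in> K" "v = n \<oplus> k" "n' \<in> N" "k' \<in> K" "w = n' \<oplus> k'"
        using decomp vw by metis
      then have c: "n \<in> carrier M" "n' \<in> carrier M" "k \<in> carrier M" "k' \<in> carrier M"
        using N_rules(1) K_rules(1) by auto
      have "v \<oplus> w = (n \<oplus> n') \<oplus> (k \<oplus> k')"
        using c nk by (simp add: M.add.m_ac)
      then show ?thesis
        using p_eq[of "n \<oplus> n'" "k \<oplus> k'"] p_eq nk N_rules(2) K_rules(2) by simp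
    qed
    show "p (\<phi> r \<odot> v) = \<phi> r \<odot> p v" if rv: "r \<in> carrier R" "v \<in> carrier M" for r v
    proof -
      obtain n k where nk: "n \<in> N" "k \<in> K" "v = n \<oplus> k"
        using decomp rv by metis
      then have "\<phi> r \<odot> v = \<phi> r \<odot> n \<oplus> \<phi> r \<odot> k"
        using distr[OF \<phi>[OF rv(1)]] N_rules(1) K_rules(1) by blast
      then show ?thesis
        using p_eq nk N_smult[OF \<phi>[OF rv(1)]] K_smult[OF rv(1)] by simp
    qed
  qed
qed

text \<open>The kernel of p is the complement, by the splitting of v into p v and v - p v. The order
  of scalars in a product never enters, so left and right modules are both covered.\<close>

lemma projection_complement:
  fixes M :: "('s, 'm) module" (structure)
  assumes M: "abelian_group M" and N: "submodule N S M"
    and smult: "\<And>s v. \<lbrakk>s \<in> carrier S; v \<in> carrier M\<rbrakk> \<Longrightarrow> s \<odot> v \<in> carrier M"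
    and distr: "\<And>s v w. \<lbrakk>s \<in> carrier S; v \<in> carrier M; w \<in> carrier M\<rbrakk> \<Longrightarrow> s \<odot> (v \<oplus> w) = s \<odot> v \<oplus> s \<odot> w"
    and p: "\<And>v. v \<in> carrier M \<Longrightarrow> p v \<in> N" "\<And>v. v \<in> N \<Longrightarrow> p v = v"
    "\<And>v w. \<lbrakk>v \<in> carrier M; w \<in> carrier M\<rbrakk> \<Longrightarrow> p (v \<oplus> w) = p v \<oplus> p w"
    "\<And>s v. \<lbrakk>s \<in> carrier S; v \<in> carrier M\<rbrakk> \<Longrightarrow> p (s \<odot> v) = s \<odot> p v"
  shows "has_complement S M N"
proof -
  interpret M: abelian_group M by (rule M)
  have N_sub: "subgroup N (add_monoid M)"
    using N by (auto simp: submodule_def)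
  note N_rules = subgroup.subset[OF N_sub, simplified] subgroup.m_closed[OF N_sub, simplified]
    subgroup.m_inv_closed[OF N_sub, folded a_inv_def] subgroup.one_closed[OF N_sub, simplified]
  have p_c: "p v \<in> carrier M" if "v \<in> carrier M" for v
    using p(1)[OF that] N_rules(1) by blast
  have p0: "p \<zero> = \<zero>" using p(2) N_rules(4) by blast
  have p_inv: "p (\<ominus> v) = \<ominus> p v" if "v \<in> carrier M" for v
  proof -
    have "p v \<oplus> p (\<ominus> v) = \<zero>"
      using p(3)[OF that M.a_inv_closed[OF that]] that p0 by (simp add: M.r_neg)
    then show ?thesis using that p_c by (metis M.a_inv_closed M.minus_equality M.a_comm)
  qed
  define K where "K = {v \<in> carrier M. p v = \<zero>}"
  have smult0: "s \<odot> \<zero> = \<zero>" if "s \<in> carrier S" for s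
  proof -
    have "s \<odot> \<zero> \<oplus> s \<odot> \<zero> = s \<odot> \<zero>" using distr[OF that, of \<zero> \<zero>] by simp
    then show ?thesis using smult[OF that, of \<zero>] M.add.r_cancel_one' by auto
  qed
  have "subgroup K (add_monoid M)"
    by (rule group.subgroupI) (auto simp: M.a_group K_def p0 p(3) p_inv simp flip: a_inv_def)
  then have "submodule K S M"
    by (auto simp: submodule_def submodule_axioms_def K_def smult p(4) smult0)
  moreover have "N \<inter> K = {\<zero>}"
    using p(2) N_rules(1,4) p0 by (auto simp: K_def)
  moreover have "v \<in> N <+>\<^bsub>M\<^esub> K" if v: "v \<in> carrier M" for v
  proof -
    have c: "p v \<in> carrier M" using p_c v by blast
    have "p (v \<ominus> p v) = \<zero>"
      using v c p(3)[of v "\<ominus> p v"] p_inv[OF c] p(2)[OF p(1)[OF v]]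
      by (simp add: a_minus_def M.r_neg)
    then have "v \<ominus> p v \<in> K" using v c by (simp add: K_def)
    moreover have "v = p v \<oplus> (v \<ominus> p v)"
      using v c by (simp add: a_minus_def M.add.m_comm M.add.m_assoc M.l_neg)
        (metis M.a_comm M.a_inv_closed M.a_assoc M.l_neg M.r_zero)
    ultimately show ?thesis
      using p(1)[OF v] by (auto simp: set_add_def set_mult_def)
  qed
  moreover have "N <+>\<^bsub>M\<^esub> K \<subseteq> carrier M"
    using N_rules(1) by (auto simp: set_add_def set_mult_def K_def)
  ultimately show ?thesis
    unfolding has_complement_def by blast
qed

text \<open>Such maps correspond to homomorphisms from the tensor square over R into B. The target
  is written multiplicatively so that the \<open>add_monoid\<close> of a module or a ring can be
  inserted.\<close>

definition balanced_map ::
  "'r ring \<Rightarrow> 's ring \<Rightarrow> ('r \<Rightarrow> 's) \<Rightarrow> ('b, 'c) monoid_scheme \<Rightarrow> ('s \<Rightarrow> 's \<Rightarrow> 'b) \<Rightarrow> bool" where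
  "balanced_map R S \<phi> B f \<longleftrightarrow>
     (\<forall>u\<in>carrier S. \<forall>v\<in>carrier S. f u v \<in> carrier B) \<and>
     (\<forall>u\<in>carrier S. \<forall>u'\<in>carrier S. \<forall>v\<in>carrier S. f (u \<oplus>\<^bsub>S\<^esub> u') v = f u v \<otimes>\<^bsub>B\<^esub> f u' v) \<and>
     (\<forall>u\<in>carrier S. \<forall>v\<in>carrier S. \<forall>v'\<in>carrier S. f u (v \<oplus>\<^bsub>S\<^esub> v') = f u v \<otimes>\<^bsub>B\<^esub> f u v') \<and>
     (\<forall>u\<in>carrier S. \<forall>r\<in>carrier R. \<forall>v\<in>carrier S. f (u \<otimes>\<^bsub>S\<^esub> \<phi> r) v = f u (\<phi> r \<otimes>\<^bsub>S\<^esub> v))"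

section \<open>The separability element attached to a central element\<close>

locale embedded_action = unital_action G R D \<alpha>
  for G :: "'g groupoid" and R :: "'a::ring set" and D \<alpha> +
  fixes \<phi> :: "'a \<Rightarrow> 'g \<Rightarrow> 'a"
  assumes \<phi>_eq: "r \<in> R \<Longrightarrow> \<phi> r = emb r"
begin

sublocale S: ring S by (rule ring_S)

text \<open>The right leg of the separability element. The trace element sits entirely in the left
  leg \<open>casimir_l\<close>.\<close>

definition "casimir_r g = delta (ginv G g) (e (ginv G g))"

lemma casimir_r_S: "g \<in> carrier G \<Longrightarrow> casimir_r g \<in> carrier S"
  by (simp add: casimir_r_def delta_S e_in_D ginv_closed)

context
  fixes a assumes a: "a \<in> center_of R"
begin

definition "casimir_l g = delta g (act g a)"

lemma center_in: "a \<in> R"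
  using a by (simp add: center_of_def)

lemma casimir_l_S: "g \<in> carrier G \<Longrightarrow> casimir_l g \<in> carrier S"
  by (simp add: casimir_l_def delta_S act_in_D center_in)

lemma delta_casimir_l:
  assumes h: "h \<in> carrier G" and c: "c \<in> D h" and g: "g \<in> carrier G"
  shows "delta h c \<otimes>\<^bsub>S\<^esub> casimir_l g =
    (if source G h = target G g then delta (comp G h g) (c * act (comp G h g) a) else \<zero>\<^bsub>S\<^esub>)"
  using act_act_D[OF h g _ center_in c] by (simp add: casimir_l_def delta_mult_delta h g)

text \<open>The coefficient is split off on the left as an element of the base ring, so that
  balancing can move it over to the left leg.\<close>

lemma casimir_r_delta:
  assumes h: "h \<in> carrier G" and c: "c \<in> D h" and g: "g \<in> carrier G"
  shows "casimir_r g \<otimes>\<^bsub>S\<^esub> delta h c =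
    (if target G g = target G h
     then emb (act (ginv G g) c) \<otimes>\<^bsub>S\<^esub> delta (comp G (ginv G g) h) (e (comp G (ginv G g) h))
     else \<zero>\<^bsub>S\<^esub>)"
proof (cases "target G g = target G h")
  case True
  let ?g = "ginv G g" let ?k = "comp G ?g h"
  have g': "?g \<in> carrier G" "source G ?g = target G h" and k: "?k \<in> carrier G"
    using g h True by (auto simp: ginv_closed source_ginv comp_closed)
  have cR: "c \<in> R" using c h D_in by blast
  have "e ?g * act ?g c = act ?g c"
    using e_central[OF g'(1) act_in[OF g'(1) cR]] act_e[OF g'(1) cR] by simp
  then have "casimir_r g \<otimes>\<^bsub>S\<^esub> delta h c = delta ?k (act ?g c)"
    using g' by (simp add: casimir_r_def delta_mult_delta h)
  also have "\<dots> = emb (act ?g c) \<otimes>\<^bsub>S\<^esub> delta ?k (e ?k)"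
    using emb_mult_S[OF act_in[OF g'(1) cR] delta_S[OF k e_in_D[OF k]]]
      act_absorb[OF g'(1) h g'(2) c] by (auto simp: delta_def)
  finally show ?thesis using True by simp
qed (simp add: casimir_r_def delta_mult_delta g h ginv_closed source_ginv)

text \<open>The scalar arriving from the right leg is untwisted by \<open>act g\<close>, and the
  centrality of \<open>act g a\<close> carries it to the front. The result has the shape produced by
  \<open>delta_casimir_l\<close>.\<close>

lemma casimir_l_emb:
  assumes g: "g \<in> carrier G" and c: "c \<in> R"
  shows "casimir_l g \<otimes>\<^bsub>S\<^esub> emb (act (ginv G g) c) = delta g (c * act g a)"
proof -
  have "act g a * act g (act (ginv G g) c) = act g a * (e g * c)"
    using act_act_ginv[OF g c] e_central[OF g c] by simp
  also have "\<dots> = c * act g a"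
    using act_mult_absorb[OF g center_in c] act_central[OF g a c] by simp
  finally show ?thesis
    using S_mult_emb[OF act_in[OF ginv_closed[OF g] c] casimir_l_S[OF g]]
    by (auto simp: casimir_l_def delta_def)
qed

text \<open>The two legs at g multiply to a monomial at \<open>target G g\<close> with coefficient
  \<open>act g a\<close>, so collecting by targets produces exactly the traces.\<close>

lemma casimir_mult:
  assumes trace: "\<And>z. z \<in> objs G \<Longrightarrow> (\<Sum>g\<in>fibre z. act g a) = e z"
  shows "finsum S (\<lambda>g. casimir_l g \<otimes>\<^bsub>S\<^esub> casimir_r g) (carrier G) = \<one>\<^bsub>S\<^esub>"
proof -
  have eq: "casimir_l g \<otimes>\<^bsub>S\<^esub> casimir_r g = delta (target G g) (act g a)" if g: "g \<in> carrier G" for g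
    using act_e[OF g center_in]
    by (simp add: casimir_l_def casimir_r_def delta_mult_delta g ginv_closed target_ginv comp_ginv
        act_e_ginv)
  have "finsum S (\<lambda>g. casimir_l g \<otimes>\<^bsub>S\<^esub> casimir_r g) (carrier G)
      = (\<lambda>k. \<Sum>g\<in>carrier G. (casimir_l g \<otimes>\<^bsub>S\<^esub> casimir_r g) k)"
    by (intro finsum_S fin S.m_closed casimir_l_S casimir_r_S)
  also have "\<dots> = (\<lambda>k. \<Sum>g\<in>carrier G. if target G g = k then act g a else 0)"
    by (intro ext sum.cong) (auto simp: eq delta_def)
  also have "\<dots> = (\<lambda>k. \<Sum>g\<in>fibre k. act g a)"
    using fin by (intro ext sum.mono_neutral_cong_right) auto
  also have "\<dots> = \<one>\<^bsub>S\<^esub>"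
  proof
    fix k show "(\<Sum>g\<in>fibre k. act g a) = \<one>\<^bsub>S\<^esub> k"
    proof (cases "k \<in> objs G")
      case False
      then have empty: "fibre k = {}" using target_in_objs by auto
      show ?thesis unfolding empty using False by (simp add: one_S)
    qed (simp add: one_S trace)
  qed
  finally show ?thesis .
qed

text \<open>
  The element \<open>\<Sum>g. casimir_l g \<otimes> casimir_r g\<close> of the tensor square is centralised by the skew
  groupoid ring; stated on the values of balanced maps, this needs no tensor product.
\<close>

lemma casimir_balanced:
  assumes B: "comm_group B" and f: "balanced_map (set_ring R) S \<phi> B f" and s: "s \<in> carrier S"
  shows "finprod B (\<lambda>g. f (s \<otimes>\<^bsub>S\<^esub> casimir_l g) (casimir_r g)) (carrier G)
    = finprod B (\<lambda>g. f (casimir_l g) (casimir_r g \<otimes>\<^bsub>S\<^esub> s)) (carrier G)" (is "?P s")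
proof -
  interpret B: comm_group B by (rule B)
  have f_c: "\<And>u v. \<lbrakk>u \<in> carrier S; v \<in> carrier S\<rbrakk> \<Longrightarrow> f u v \<in> carrier B"
    and f_l: "\<And>u u' v. \<lbrakk>u \<in> carrier S; u' \<in> carrier S; v \<in> carrier S\<rbrakk> \<Longrightarrow> f (u \<oplus>\<^bsub>S\<^esub> u') v = f u v \<otimes>\<^bsub>B\<^esub> f u' v"
    and f_r: "\<And>u v v'. \<lbrakk>u \<in> carrier S; v \<in> carrier S; v' \<in> carrier S\<rbrakk> \<Longrightarrow> f u (v \<oplus>\<^bsub>S\<^esub> v') = f u v \<otimes>\<^bsub>B\<^esub> f u v'"
    and f_b: "\<And>u r v. \<lbrakk>u \<in> carrier S; r \<in> R; v \<in> carrier S\<rbrakk> \<Longrightarrow> f (u \<otimes>\<^bsub>S\<^esub> emb r) v = f u (emb r \<otimes>\<^bsub>S\<^esub> v)"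
    using f by (auto simp: balanced_map_def set_ring_def \<phi>_eq)
  note cl = casimir_l_S casimir_r_S
  have f_0l: "f \<zero>\<^bsub>S\<^esub> v = \<one>\<^bsub>B\<^esub>" if "v \<in> carrier S" for v
    using f_l[of "\<zero>\<^bsub>S\<^esub>" "\<zero>\<^bsub>S\<^esub>" v] f_c[of "\<zero>\<^bsub>S\<^esub>" v] that B.r_cancel_one' by simp
  have f_0r: "f u \<zero>\<^bsub>S\<^esub> = \<one>\<^bsub>B\<^esub>" if "u \<in> carrier S" for u
    using f_r[of u "\<zero>\<^bsub>S\<^esub>" "\<zero>\<^bsub>S\<^esub>"] f_c[of u "\<zero>\<^bsub>S\<^esub>"] that B.r_cancel_one' by simp
  have P_0: "?P \<zero>\<^bsub>S\<^esub>"
    by (intro B.finprod_cong') (auto simp: cl f_0l f_0r)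
  have P_add: "?P (s \<oplus>\<^bsub>S\<^esub> t)" if st: "s \<in> carrier S" "t \<in> carrier S" "?P s" "?P t" for s t
  proof -
    have "finprod B (\<lambda>g. f ((s \<oplus>\<^bsub>S\<^esub> t) \<otimes>\<^bsub>S\<^esub> casimir_l g) (casimir_r g)) (carrier G)
        = finprod B (\<lambda>g. f (s \<otimes>\<^bsub>S\<^esub> casimir_l g) (casimir_r g)
            \<otimes>\<^bsub>B\<^esub> f (t \<otimes>\<^bsub>S\<^esub> casimir_l g) (casimir_r g)) (carrier G)"
      using st by (intro B.finprod_cong') (auto simp: S.l_distr cl f_l f_c)
    also have "\<dots> = finprod B (\<lambda>g. f (casimir_l g) (casimir_r g \<otimes>\<^bsub>S\<^esub> s)
            \<otimes>\<^bsub>B\<^esub> f (casimir_l g) (casimir_r g \<otimes>\<^bsub>S\<^esub> t)) (carrier G)"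
      using st by (simp add: B.finprod_multf cl f_c Pi_def)
    also have "\<dots> = finprod B (\<lambda>g. f (casimir_l g) (casimir_r g \<otimes>\<^bsub>S\<^esub> (s \<oplus>\<^bsub>S\<^esub> t))) (carrier G)"
      using st by (intro B.finprod_cong') (auto simp: S.r_distr cl f_r f_c)
    finally show ?thesis .
  qed
  have P_delta: "?P (delta h c)" if h: "h \<in> carrier G" and c: "c \<in> D h" for h c
  proof -
    \<comment> \<open>Common form of both sides, summed over the k with the target of h: the left
      side reaches it by the substitution k = h g, the right side with k = g by balancing the scalar
      across the legs.\<close>
    let ?F = "\<lambda>k. f (delta k (c * act k a)) (delta (comp G (ginv G k) h) (e (comp G (ginv G k) h)))"
    have cR: "c \<in> R" using c h D_in by blast
    have F_c: "?F k \<in> carrier B" if "k \<in> fibre (target G h)" for k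
      using that h cR by (intro f_c delta_S mult_in_D_left act_in_D center_in e_in_D)
        (auto simp: comp_closed ginv_closed source_ginv)
    have "finprod B (\<lambda>g. f (delta h c \<otimes>\<^bsub>S\<^esub> casimir_l g) (casimir_r g)) (carrier G)
        = finprod B (\<lambda>g. ?F (comp G h g)) (fibre (source G h))"
    proof (rule B.finprod_mono_neutral_cong_left[symmetric])
      show "f (delta h c \<otimes>\<^bsub>S\<^esub> casimir_l g) (casimir_r g) = \<one>\<^bsub>B\<^esub>"
        if "g \<in> carrier G - fibre (source G h)" for g
        using that delta_casimir_l[OF h c, of g] by (auto simp: f_0l cl)
      show "?F (comp G h g) = f (delta h c \<otimes>\<^bsub>S\<^esub> casimir_l g) (casimir_r g)"
        if "g \<in> fibre (source G h)" for g
      proof -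
        have "comp G (ginv G (comp G h g)) h = ginv G g"
          using that h by (simp add: ginv_comp_distrib comp_ginv_cancel_right ginv_closed source_ginv
              target_ginv comp_assoc ginv_comp comp_source)
            (metis comp_source ginv_closed source_ginv)
        then show ?thesis
          using that delta_casimir_l[OF h c, of g] by (simp add: casimir_r_def)
      qed
    qed (use h c in \<open>auto simp: fin cl delta_S f_c\<close>)
    also have "\<dots> = finprod B ?F (comp G h ` fibre (source G h))"
      using bij_betw_comp_left[OF h] F_c
      by (intro B.finprod_reindex[symmetric]) (auto simp: bij_betw_def)
    also have "comp G h ` fibre (source G h) = fibre (target G h)"
      using bij_betw_comp_left[OF h] by (simp add: bij_betw_def)
    also have "finprod B ?F (fibre (target G h))
        = finprod B (\<lambda>g. f (casimir_l g) (casimir_r g \<otimes>\<^bsub>S\<^esub> delta h c)) (carrier G)"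
    proof (rule B.finprod_mono_neutral_cong_left)
      show "f (casimir_l g) (casimir_r g \<otimes>\<^bsub>S\<^esub> delta h c) = \<one>\<^bsub>B\<^esub>"
        if "g \<in> carrier G - fibre (target G h)" for g
        using that casimir_r_delta[OF h c, of g] by (auto simp: f_0r cl)
      show "?F g = f (casimir_l g) (casimir_r g \<otimes>\<^bsub>S\<^esub> delta h c)"
        if g: "g \<in> fibre (target G h)" for g
      proof -
        have k: "comp G (ginv G g) h \<in> carrier G"
          using g h by (auto simp: comp_closed ginv_closed source_ginv)
        have "?F g = f (casimir_l g \<otimes>\<^bsub>S\<^esub> emb (act (ginv G g) c))
            (delta (comp G (ginv G g) h) (e (comp G (ginv G g) h)))"
          using g casimir_l_emb[OF _ cR, of g] by simp
        also have "\<dots> = f (casimir_l g) (emb (act (ginv G g) c)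
            \<otimes>\<^bsub>S\<^esub> delta (comp G (ginv G g) h) (e (comp G (ginv G g) h)))"
          using g k cR by (intro f_b) (auto simp: cl act_in ginv_closed delta_S e_in_D)
        finally show ?thesis
          using g casimir_r_delta[OF h c, of g] by simp
      qed
    qed (use h c in \<open>auto simp: fin cl delta_S f_c\<close>)
    finally show ?thesis .
  qed
  \<comment> \<open>Every s is the sum of its monomials, and \<open>?P\<close> is preserved by sums,
    so the monomial case is enough.\<close>
  have "?P (finsum S (\<lambda>g. delta g (s g)) J)" if "finite J" "J \<subseteq> carrier G" for J
    using that
  proof (induction J rule: finite_induct)
    case (insert h J)
    have d: "delta g (s g) \<in> carrier S" if "g \<in> insert h J" for g
      using that insert.prems S_in_D[OF s] by (auto intro!: delta_S)
    have "finsum S (\<lambda>g. delta g (s g)) (insert h J)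
        = delta h (s h) \<oplus>\<^bsub>S\<^esub> finsum S (\<lambda>g. delta g (s g)) J"
      using insert.hyps d by (intro S.finsum_insert) auto
    then show ?case
      using P_add[of "delta h (s h)" "finsum S (\<lambda>g. delta g (s g)) J"] insert d
        P_delta[of h "s h"] S_in_D[OF s]
      by (simp add: Pi_def S.finsum_closed)
  qed (simp add: P_0)
  from this[OF fin order_refl] show ?thesis
    using S_decomp[OF s] by simp
qed

end

end

text \<open>Bare additivity is assumed so that it applies to scalar multiplication in either
  argument: from the ring to the module, and from the module to itself.\<close>

lemma additive_finsum:
  assumes M: "abelian_group M" and M': "abelian_group M'"
    and closed: "\<And>v. v \<in> carrier M \<Longrightarrow> h v \<in> carrier M'"
    and add: "\<And>v w. \<lbrakk>v \<in> carrier M; w \<in> carrier M\<rbrakk> \<Longrightarrow> h (v \<oplus>\<^bsub>M\<^esub> w) = h v \<oplus>\<^bsub>M'\<^esub> h w"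
    and "finite J" "\<And>j. j \<in> J \<Longrightarrow> f j \<in> carrier M"
  shows "h (finsum M f J) = finsum M' (\<lambda>j. h (f j)) J"
proof -
  interpret M: abelian_group M by (rule M)
  interpret M': abelian_group M' by (rule M')
  have "h \<zero>\<^bsub>M\<^esub> = \<zero>\<^bsub>M'\<^esub>"
    using add[of "\<zero>\<^bsub>M\<^esub>" "\<zero>\<^bsub>M\<^esub>"] closed[of "\<zero>\<^bsub>M\<^esub>"] M'.add.r_cancel_one' by simp
  with assms(5,6) show ?thesis
    by (induction J rule: finite_induct) (auto simp: add closed Pi_def)
qed

lemma subgroup_finsum:
  assumes M: "abelian_group M" and N: "subgroup N (add_monoid M)"
    and "finite J" "\<And>j. j \<in> J \<Longrightarrow> f j \<in> N"
  shows "finsum M f J \<in> N"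
proof -
  interpret M: abelian_group M by (rule M)
  have "N \<subseteq> carrier M"
    using subgroup.subset[OF N] by simp
  with assms(3,4) show ?thesis
    using subgroup.one_closed[OF N] subgroup.m_closed[OF N]
    by (induction J rule: finite_induct) (auto simp: Pi_def subset_iff)
qed

section \<open>Averaging a projection over the separability element\<close>

context embedded_action
begin

lemma \<phi>_S: "r \<in> carrier (set_ring R) \<Longrightarrow> \<phi> r \<in> carrier S"
  by (simp add: set_ring_def \<phi>_eq emb_S)

lemma ring_ext: "ring_extension (set_ring R) S \<phi>"
  using ring_extension_emb \<phi>_eq by blast

context
  fixes a
  assumes a: "a \<in> center_of R" and trace: "\<And>z. z \<in> objs G \<Longrightarrow> (\<Sum>g\<in>fibre z. act g a) = e z"
begin

lemma left_semisimple: "left_semisimple_extension TYPE('m) (set_ring R) S \<phi>"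
proof -
  have "has_complement S M N"
    if M: "left_module S M" and N: "submodule N S M"
      and compl: "has_complement (set_ring R) (restrict_scalars \<phi> M) N"
    for M :: "('g \<Rightarrow> 'a, 'm) module" and N
  proof -
    interpret M: left_module S M by (rule M)
    obtain p where p: "\<And>v. v \<in> carrier M \<Longrightarrow> p v \<in> N" "\<And>v. v \<in> N \<Longrightarrow> p v = v"
      "\<And>v w. \<lbrakk>v \<in> carrier M; w \<in> carrier M\<rbrakk> \<Longrightarrow> p (v \<oplus>\<^bsub>M\<^esub> w) = p v \<oplus>\<^bsub>M\<^esub> p w"
      "\<And>r v. \<lbrakk>r \<in> carrier (set_ring R); v \<in> carrier M\<rbrakk> \<Longrightarrow> p (\<phi> r \<odot>\<^bsub>M\<^esub> v) = \<phi> r \<odot>\<^bsub>M\<^esub> p v"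
      using complement_projection[OF M.abelian_group_axioms N \<phi>_S M.smult_r_distr compl] by blast
    have NM: "N \<subseteq> carrier M" and N_smult: "\<And>s v. \<lbrakk>s \<in> carrier S; v \<in> N\<rbrakk> \<Longrightarrow> s \<odot>\<^bsub>M\<^esub> v \<in> N"
      and N_sub: "subgroup N (add_monoid M)"
      using N by (auto simp: submodule_def submodule_axioms_def subgroup_def)
    have p_c: "p v \<in> carrier M" if "v \<in> carrier M" for v
      using p(1)[OF that] NM by blast
    let ?x = "casimir_l a" and ?y = casimir_r
    note cl = casimir_l_S[OF a] casimir_r_S
    define q where "q v = finsum M (\<lambda>g. ?x g \<odot>\<^bsub>M\<^esub> p (?y g \<odot>\<^bsub>M\<^esub> v)) (carrier G)" for v
    have term_N: "?x g \<odot>\<^bsub>M\<^esub> p (?y g \<odot>\<^bsub>M\<^esub> v) \<in> N" if "g \<in> carrier G" "v \<in> carrier M" for g v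
      using that by (intro N_smult p(1) M.smult_closed cl)
    have term_c: "?x g \<odot>\<^bsub>M\<^esub> p (?y g \<odot>\<^bsub>M\<^esub> v) \<in> carrier M" if "g \<in> carrier G" "v \<in> carrier M" for g v
      using term_N[OF that] NM by blast
    show ?thesis
    proof (rule projection_complement[OF M.abelian_group_axioms N M.smult_closed M.smult_r_distr])
      show "q v \<in> N" if "v \<in> carrier M" for v
        unfolding q_def by (rule subgroup_finsum[OF M.abelian_group_axioms N_sub fin term_N[OF _ that]])
      show "q v = v" if v: "v \<in> N" for v
      proof -
        have vM: "v \<in> carrier M" using v NM by blast
        \<comment> \<open>The right leg keeps v inside N, where p is the identity, so p drops out
          and the legs come together.\<close>
        have "q v = finsum M (\<lambda>g. (?x g \<otimes>\<^bsub>S\<^esub> ?y g) \<odot>\<^bsub>M\<^esub> v) (carrier G)"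
          unfolding q_def using vM v
          by (intro M.finsum_cong') (auto simp: p(2) N_smult cl M.smult_assoc intro!: M.smult_closed)
        also have "\<dots> = finsum S (\<lambda>g. ?x g \<otimes>\<^bsub>S\<^esub> ?y g) (carrier G) \<odot>\<^bsub>M\<^esub> v"
          by (rule additive_finsum[OF S.abelian_group_axioms M.abelian_group_axioms _ _ fin, symmetric])
            (auto simp: vM cl M.smult_closed M.smult_l_distr)
        also have "\<dots> = v"
          using casimir_mult[OF a trace] vM by (simp add: M.smult_one)
        finally show ?thesis .
      qed
      show "q (v \<oplus>\<^bsub>M\<^esub> w) = q v \<oplus>\<^bsub>M\<^esub> q w" if vw: "v \<in> carrier M" "w \<in> carrier M" for v w
      proof -
        have "q (v \<oplus>\<^bsub>M\<^esub> w) = finsum M (\<lambda>g. ?x g \<odot>\<^bsub>M\<^esub> p (?y g \<odot>\<^bsub>M\<^esub> v) \<oplus>\<^bsub>M\<^esub> ?x g \<odot>\<^bsub>M\<^esub> p (?y g \<odot>\<^bsub>M\<^esub> w)) (carrier G)"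
          unfolding q_def using vw
          by (intro M.finsum_cong') (auto simp: term_c cl M.smult_r_distr p_c M.smult_closed p(3))
        then show ?thesis
          unfolding q_def using vw term_c by (simp add: M.finsum_addf Pi_def)
      qed
      show "q (s \<odot>\<^bsub>M\<^esub> v) = s \<odot>\<^bsub>M\<^esub> q v" if s: "s \<in> carrier S" and v: "v \<in> carrier M" for s v
      proof -
        \<comment> \<open>For fixed v this is balanced because p is linear over the base ring. The
          centralising identity then moves s from the left leg, where it stands outside p, to the
          right leg inside p.\<close>
        define f where "f u w = u \<odot>\<^bsub>M\<^esub> p (w \<odot>\<^bsub>M\<^esub> v)" for u w
        have f_c: "f u w \<in> carrier M" if "u \<in> carrier S" "w \<in> carrier S" for u w
          unfolding f_def using that v by (intro M.smult_closed p_c)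
        have bal: "balanced_map (set_ring R) S \<phi> (add_monoid M) f"
          unfolding balanced_map_def using v f_c \<phi>_S
          by (auto simp: f_def M.smult_l_distr M.smult_r_distr M.smult_assoc M.smult_closed p p_c)
        have "finsum M (\<lambda>g. f (s \<otimes>\<^bsub>S\<^esub> ?x g) (?y g)) (carrier G)
            = finsum M (\<lambda>g. f (?x g) (?y g \<otimes>\<^bsub>S\<^esub> s)) (carrier G)"
          unfolding finsum_def by (rule casimir_balanced[OF a M.a_comm_group bal s])
        moreover have "finsum M (\<lambda>g. f (?x g) (?y g \<otimes>\<^bsub>S\<^esub> s)) (carrier G) = q (s \<odot>\<^bsub>M\<^esub> v)"
          unfolding q_def f_def using s v
          by (intro M.finsum_cong') (auto simp: cl M.smult_assoc M.smult_closed p_c)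
        moreover have "finsum M (\<lambda>g. f (s \<otimes>\<^bsub>S\<^esub> ?x g) (?y g)) (carrier G)
            = finsum M (\<lambda>g. s \<odot>\<^bsub>M\<^esub> (?x g \<odot>\<^bsub>M\<^esub> p (?y g \<odot>\<^bsub>M\<^esub> v))) (carrier G)"
          unfolding f_def using s v
          by (intro M.finsum_cong') (auto simp: cl M.smult_assoc M.smult_closed p_c)
        moreover have "\<dots> = s \<odot>\<^bsub>M\<^esub> q v"
          unfolding q_def
          by (rule additive_finsum[OF M.abelian_group_axioms M.abelian_group_axioms _ _ fin, symmetric])
            (use s v in \<open>auto simp: M.smult_closed M.smult_r_distr term_c\<close>)
        ultimately show ?thesis by simp
      qed
    qed
  qed
  then show ?thesis
    unfolding left_semisimple_extension_def using ring_ext by blast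
qed

text \<open>A right action reverses the order of application: the left leg acts before p and the
  right leg after it. The same centralising identity, read in the opposite direction, gives
  linearity.\<close>

lemma right_semisimple: "right_semisimple_extension TYPE('m) (set_ring R) S \<phi>"
proof -
  have "has_complement S M N"
    if M: "right_module S M" and N: "submodule N S M"
      and compl: "has_complement (set_ring R) (restrict_scalars \<phi> M) N"
    for M :: "('g \<Rightarrow> 'a, 'm) module" and N
  proof -
    interpret M: right_module S M by (rule M)
    obtain p where p: "\<And>v. v \<in> carrier M \<Longrightarrow> p v \<in> N" "\<And>v. v \<in> N \<Longrightarrow> p v = v"
      "\<And>v w. \<lbrakk>v \<in> carrier M; w \<in> carrier M\<rbrakk> \<Longrightarrow> p (v \<oplus>\<^bsub>M\<^esub> w) = p v \<oplus>\<^bsub>M\<^esub> p w"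
      "\<And>r v. \<lbrakk>r \<in> carrier (set_ring R); v \<in> carrier M\<rbrakk> \<Longrightarrow> p (\<phi> r \<odot>\<^bsub>M\<^esub> v) = \<phi> r \<odot>\<^bsub>M\<^esub> p v"
      using complement_projection[OF M.abelian_group_axioms N \<phi>_S M.smult_r_distr compl] by blast
    have NM: "N \<subseteq> carrier M" and N_smult: "\<And>s v. \<lbrakk>s \<in> carrier S; v \<in> N\<rbrakk> \<Longrightarrow> s \<odot>\<^bsub>M\<^esub> v \<in> N"
      and N_sub: "subgroup N (add_monoid M)"
      using N by (auto simp: submodule_def submodule_axioms_def subgroup_def)
    have p_c: "p v \<in> carrier M" if "v \<in> carrier M" for v
      using p(1)[OF that] NM by blast
    let ?x = "casimir_l a" and ?y = casimir_r
    note cl = casimir_l_S[OF a] casimir_r_S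
    define q where "q v = finsum M (\<lambda>g. ?y g \<odot>\<^bsub>M\<^esub> p (?x g \<odot>\<^bsub>M\<^esub> v)) (carrier G)" for v
    have term_N: "?y g \<odot>\<^bsub>M\<^esub> p (?x g \<odot>\<^bsub>M\<^esub> v) \<in> N" if "g \<in> carrier G" "v \<in> carrier M" for g v
      using that by (intro N_smult p(1) M.smult_closed cl)
    have term_c: "?y g \<odot>\<^bsub>M\<^esub> p (?x g \<odot>\<^bsub>M\<^esub> v) \<in> carrier M" if "g \<in> carrier G" "v \<in> carrier M" for g v
      using term_N[OF that] NM by blast
    show ?thesis
    proof (rule projection_complement[OF M.abelian_group_axioms N M.smult_closed M.smult_r_distr])
      show "q v \<in> N" if "v \<in> carrier M" for v
        unfolding q_def by (rule subgroup_finsum[OF M.abelian_group_axioms N_sub fin term_N[OF _ that]])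
      show "q v = v" if v: "v \<in> N" for v
      proof -
        have vM: "v \<in> carrier M" using v NM by blast
        have "q v = finsum M (\<lambda>g. (?x g \<otimes>\<^bsub>S\<^esub> ?y g) \<odot>\<^bsub>M\<^esub> v) (carrier G)"
          unfolding q_def using vM v
          by (intro M.finsum_cong') (auto simp: p(2) N_smult cl M.smult_assoc intro!: M.smult_closed)
        also have "\<dots> = finsum S (\<lambda>g. ?x g \<otimes>\<^bsub>S\<^esub> ?y g) (carrier G) \<odot>\<^bsub>M\<^esub> v"
          by (rule additive_finsum[OF S.abelian_group_axioms M.abelian_group_axioms _ _ fin, symmetric])
            (auto simp: vM cl M.smult_closed M.smult_l_distr)
        also have "\<dots> = v"
          using casimir_mult[OF a trace] vM by (simp add: M.smult_one)
        finally show ?thesis .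
      qed
      show "q (v \<oplus>\<^bsub>M\<^esub> w) = q v \<oplus>\<^bsub>M\<^esub> q w" if vw: "v \<in> carrier M" "w \<in> carrier M" for v w
      proof -
        have "q (v \<oplus>\<^bsub>M\<^esub> w) = finsum M (\<lambda>g. ?y g \<odot>\<^bsub>M\<^esub> p (?x g \<odot>\<^bsub>M\<^esub> v) \<oplus>\<^bsub>M\<^esub> ?y g \<odot>\<^bsub>M\<^esub> p (?x g \<odot>\<^bsub>M\<^esub> w)) (carrier G)"
          unfolding q_def using vw
          by (intro M.finsum_cong') (auto simp: term_c cl M.smult_r_distr p_c M.smult_closed p(3))
        then show ?thesis
          unfolding q_def using vw term_c by (simp add: M.finsum_addf Pi_def)
      qed
      show "q (s \<odot>\<^bsub>M\<^esub> v) = s \<odot>\<^bsub>M\<^esub> q v" if s: "s \<in> carrier S" and v: "v \<in> carrier M" for s v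
      proof -
        define f where "f u w = w \<odot>\<^bsub>M\<^esub> p (u \<odot>\<^bsub>M\<^esub> v)" for u w
        have f_c: "f u w \<in> carrier M" if "u \<in> carrier S" "w \<in> carrier S" for u w
          unfolding f_def using that v by (intro M.smult_closed p_c)
        have bal: "balanced_map (set_ring R) S \<phi> (add_monoid M) f"
          unfolding balanced_map_def using v f_c \<phi>_S
          by (auto simp: f_def M.smult_l_distr M.smult_r_distr M.smult_assoc M.smult_closed p p_c)
        have "finsum M (\<lambda>g. f (s \<otimes>\<^bsub>S\<^esub> ?x g) (?y g)) (carrier G)
            = finsum M (\<lambda>g. f (?x g) (?y g \<otimes>\<^bsub>S\<^esub> s)) (carrier G)"
          unfolding finsum_def by (rule casimir_balanced[OF a M.a_comm_group bal s])
        moreover have "finsum M (\<lambda>g. f (s \<otimes>\<^bsub>S\<^esub> ?x g) (?y g)) (carrier G) = q (s \<odot>\<^bsub>M\<^esub> v)"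
          unfolding q_def f_def using s v
          by (intro M.finsum_cong') (auto simp: cl M.smult_assoc M.smult_closed p_c)
        moreover have "finsum M (\<lambda>g. f (?x g) (?y g \<otimes>\<^bsub>S\<^esub> s)) (carrier G)
            = finsum M (\<lambda>g. s \<odot>\<^bsub>M\<^esub> (?y g \<odot>\<^bsub>M\<^esub> p (?x g \<odot>\<^bsub>M\<^esub> v))) (carrier G)"
          unfolding f_def using s v
          by (intro M.finsum_cong') (auto simp: cl M.smult_assoc M.smult_closed p_c)
        moreover have "\<dots> = s \<odot>\<^bsub>M\<^esub> q v"
          unfolding q_def
          by (rule additive_finsum[OF M.abelian_group_axioms M.abelian_group_axioms _ _ fin, symmetric])
            (use s v in \<open>auto simp: M.smult_closed M.smult_r_distr term_c\<close>)
        ultimately show ?thesis by simp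
      qed
    qed
  qed
  then show ?thesis
    unfolding right_semisimple_extension_def using ring_ext by blast
qed

end

end

section \<open>A trace element from separability\<close>

lemma free_hom_unique:
  assumes B: "group B" and h: "h \<in> hom (free_Abelian_group P) B" and h': "h' \<in> hom (free_Abelian_group P) B"
    and gens: "\<And>p. p \<in> P \<Longrightarrow> h (frag_of p) = h' (frag_of p)" and c: "Poly_Mapping.keys c \<subseteq> P"
  shows "h c = h' c"
proof -
  interpret h: group_hom "free_Abelian_group P" B h
    using B h by (simp add: group_hom_def group_hom_axioms_def)
  interpret h': group_hom "free_Abelian_group P" B h'
    using B h' by (simp add: group_hom_def group_hom_axioms_def)
  show ?thesis
  proof (rule free_Abelian_group_induct[OF c])
    show "h 0 = h' 0" using h.hom_one h'.hom_one by simp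
    show "h (x - y) = h' (x - y)" if "Poly_Mapping.keys x \<subseteq> P" "Poly_Mapping.keys y \<subseteq> P" "h x = h' x" "h y = h' y" for x y
      using that h.hom_mult[of x "- y"] h'.hom_mult[of x "- y"] h.hom_inv[of y] h'.hom_inv[of y] by simp
  qed (rule gens)
qed

text \<open>Brings a homomorphism into the shape of the explicit sum by which
  \<open>tensor_mult\<close> is defined.\<close>

lemma free_hom_eq_finprod:
  assumes B: "comm_group B" and h: "h \<in> hom (free_Abelian_group P) B" and c: "Poly_Mapping.keys c \<subseteq> P"
  shows "h c = finprod B (\<lambda>p. h (frag_of p) [^]\<^bsub>B\<^esub> Poly_Mapping.lookup c p) (Poly_Mapping.keys c)"
proof -
  interpret B: comm_group B by (rule B)
  interpret h: group_hom "free_Abelian_group P" B h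
    using B.is_group h by (simp add: group_hom_def group_hom_axioms_def)
  have "h (\<Sum>p\<in>Q. frag_cmul (n p) (frag_of p)) = finprod B (\<lambda>p. h (frag_of p) [^]\<^bsub>B\<^esub> n p) Q"
    if "finite Q" "Q \<subseteq> P" for Q and n :: "_ \<Rightarrow> int"
    using that
  proof (induction Q rule: finite_induct)
    case empty
    then show ?case using h.hom_one by simp
  next
    case (insert q Q)
    have k: "Poly_Mapping.keys (\<Sum>p\<in>Q. frag_cmul (n p) (frag_of p)) \<subseteq> P"
      using insert.prems sum_closed_free_Abelian_group[of Q "\<lambda>p. frag_cmul (n p) (frag_of p)" P]
        keys_cmul by fastforce
    have q: "Poly_Mapping.keys (frag_of q) \<subseteq> P" using insert.prems by simp
    have kq: "Poly_Mapping.keys (frag_cmul (n q) (frag_of q)) \<subseteq> P"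
      using q keys_cmul by blast
    have hp: "h (frag_of p) \<in> carrier B" if "p \<in> P" for p
      using that by (intro h.hom_closed) simp
    have hq: "h (frag_cmul (n q) (frag_of q)) = h (frag_of q) [^]\<^bsub>B\<^esub> n q"
      using h.hom_int_pow[of "frag_of q" "n q"] q by simp
    have "h (\<Sum>p\<in>insert q Q. frag_cmul (n p) (frag_of p))
        = h (frag_cmul (n q) (frag_of q)) \<otimes>\<^bsub>B\<^esub> h (\<Sum>p\<in>Q. frag_cmul (n p) (frag_of p))"
      using h.hom_mult[of "frag_cmul (n q) (frag_of q)" "\<Sum>p\<in>Q. frag_cmul (n p) (frag_of p)"] k kq insert.hyps
      by simp
    then show ?case
      using insert hq hp by (subst B.finprod_insert) (auto simp: B.int_pow_closed)
  qed
  from this[OF finite_keys c, of "Poly_Mapping.lookup c"] show ?thesis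
    using frag_expansion[of c] by (simp add: frag_extend_def)
qed

section \<open>The relations of the tensor square\<close>

lemma tensor_rel_subgroup:
  fixes S :: "'s ring"
  assumes "ring S" "\<And>r. r \<in> carrier R \<Longrightarrow> \<phi> r \<in> carrier S"
  shows "subgroup (tensor_rel R S \<phi>) (tensor_free S)"
proof -
  interpret ring S by (rule assms)
  have keys3: "Poly_Mapping.keys (frag_of p - frag_of q - frag_of r) \<subseteq> {p, q, r}" for p q r :: "'s \<times> 's"
    using keys_diff[of "frag_of p - frag_of q" "frag_of r"] keys_diff[of "frag_of p" "frag_of q"] by auto
  have keys2: "Poly_Mapping.keys (frag_of p - frag_of q) \<subseteq> {p, q}" for p q :: "'s \<times> 's"
    using keys_diff[of "frag_of p" "frag_of q"] by auto
  show ?thesis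
    unfolding tensor_rel_def tensor_free_def
    by (rule group.generate_is_subgroup)
      (auto dest!: subsetD[OF keys3] subsetD[OF keys2] simp: assms(2))
qed

text \<open>Minimality of the generated subgroup: a property that cuts out a subgroup need only be
  tested on the three kinds of generators.\<close>

lemma tensor_rel_incl:
  assumes "subgroup H (tensor_free S)"
    and "\<And>a a' b. \<lbrakk>a \<in> carrier S; a' \<in> carrier S; b \<in> carrier S\<rbrakk>
      \<Longrightarrow> frag_of (a \<oplus>\<^bsub>S\<^esub> a', b) - frag_of (a, b) - frag_of (a', b) \<in> H"
    and "\<And>a b b'. \<lbrakk>a \<in> carrier S; b \<in> carrier S; b' \<in> carrier S\<rbrakk>
      \<Longrightarrow> frag_of (a, b \<oplus>\<^bsub>S\<^esub> b') - frag_of (a, b) - frag_of (a, b') \<in> H"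
    and "\<And>a r b. \<lbrakk>a \<in> carrier S; r \<in> carrier R; b \<in> carrier S\<rbrakk>
      \<Longrightarrow> frag_of (a \<otimes>\<^bsub>S\<^esub> \<phi> r, b) - frag_of (a, \<phi> r \<otimes>\<^bsub>S\<^esub> b) \<in> H"
  shows "tensor_rel R S \<phi> \<subseteq> H"
  unfolding tensor_rel_def
  by (rule group.generate_subgroup_incl) (use assms in \<open>auto simp: tensor_free_def\<close>)

lemma frag_extend_hom:
  assumes "\<And>p. p \<in> P \<Longrightarrow> k p \<in> Q"
  shows "frag_extend (\<lambda>p. frag_of (k p)) \<in> hom (free_Abelian_group P) (free_Abelian_group Q)"
proof (rule homI)
  fix c assume "c \<in> carrier (free_Abelian_group P)"
  then show "frag_extend (\<lambda>p. frag_of (k p)) c \<in> carrier (free_Abelian_group Q)"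
    using keys_frag_extend[of "\<lambda>p. frag_of (k p)" c] assms by fastforce
qed (simp add: frag_extend_add)

text \<open>The universal property of the tensor square, kept at the level of the free group:
  instead of factoring through the quotient, h is recorded to vanish on the relations.\<close>

lemma balanced_hom:
  assumes S: "ring S" and \<phi>: "\<And>r. r \<in> carrier R \<Longrightarrow> \<phi> r \<in> carrier S"
    and B: "comm_group B" and f: "balanced_map R S \<phi> B f"
  obtains h where "h \<in> hom (tensor_free S) B"
    "\<And>u v. \<lbrakk>u \<in> carrier S; v \<in> carrier S\<rbrakk> \<Longrightarrow> h (frag_of (u, v)) = f u v"
    "\<And>k. k \<in> tensor_rel R S \<phi> \<Longrightarrow> h k = \<one>\<^bsub>B\<^esub>"
proof -
  interpret S: ring S by (rule S)
  interpret B: comm_group B by (rule B)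
  have f_c: "\<And>u v. \<lbrakk>u \<in> carrier S; v \<in> carrier S\<rbrakk> \<Longrightarrow> f u v \<in> carrier B"
    using f by (auto simp: balanced_map_def)
  obtain h where h: "h \<in> hom (free_Abelian_group (carrier S \<times> carrier S)) B"
    and gens: "\<And>p. p \<in> carrier S \<times> carrier S \<Longrightarrow> h (frag_of p) = case_prod f p"
    by (rule B.free_Abelian_group_universal[of "case_prod f" "carrier S \<times> carrier S"])
      (use f_c in auto)
  interpret h: group_hom "free_Abelian_group (carrier S \<times> carrier S)" B h
    using B.is_group h by (simp add: group_hom_def group_hom_axioms_def)
  have diff: "h (x - y) = h x \<otimes>\<^bsub>B\<^esub> inv\<^bsub>B\<^esub> h y"
    if "Poly_Mapping.keys x \<subseteq> carrier S \<times> carrier S" "Poly_Mapping.keys y \<subseteq> carrier S \<times> carrier S" for x y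
    using that h.hom_mult[of x "- y"] h.hom_inv[of y] by simp
  have keys2: "Poly_Mapping.keys (frag_of p - frag_of q) \<subseteq> carrier S \<times> carrier S"
    if "p \<in> carrier S \<times> carrier S" "q \<in> carrier S \<times> carrier S" for p q
    using keys_diff[of "frag_of p" "frag_of q"] that by auto
  have keys3: "Poly_Mapping.keys (frag_of p - frag_of q - frag_of r) \<subseteq> carrier S \<times> carrier S"
    if "p \<in> carrier S \<times> carrier S" "q \<in> carrier S \<times> carrier S" "r \<in> carrier S \<times> carrier S" for p q r
    using keys_diff[of "frag_of p - frag_of q" "frag_of r"] keys2[OF that(1,2)] that by auto
  \<comment> \<open>The value of h on a biadditivity relation, once f has been expanded.\<close>
  have cancel: "x \<otimes>\<^bsub>B\<^esub> y \<otimes>\<^bsub>B\<^esub> inv\<^bsub>B\<^esub> x \<otimes>\<^bsub>B\<^esub> inv\<^bsub>B\<^esub> y = \<one>\<^bsub>B\<^esub>"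
    if "x \<in> carrier B" "y \<in> carrier B" for x y
    using that by (simp add: B.m_comm[of x y] B.m_assoc)
  let ?K = "kernel (free_Abelian_group (carrier S \<times> carrier S)) B h"
  have "tensor_rel R S \<phi> \<subseteq> ?K"
  proof (rule tensor_rel_incl)
    show "subgroup ?K (tensor_free S)"
      unfolding tensor_free_def by (rule h.subgroup_kernel)
  next
    fix a a' b assume "a \<in> carrier S" "a' \<in> carrier S" "b \<in> carrier S"
    moreover from this have "f (a \<oplus>\<^bsub>S\<^esub> a') b = f a b \<otimes>\<^bsub>B\<^esub> f a' b"
      using f by (auto simp: balanced_map_def)
    ultimately show "frag_of (a \<oplus>\<^bsub>S\<^esub> a', b) - frag_of (a, b) - frag_of (a', b) \<in> ?K"
      by (simp add: kernel_def keys3 keys2 diff gens f_c cancel)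
  next
    fix a b b' assume "a \<in> carrier S" "b \<in> carrier S" "b' \<in> carrier S"
    moreover from this have "f a (b \<oplus>\<^bsub>S\<^esub> b') = f a b \<otimes>\<^bsub>B\<^esub> f a b'"
      using f by (auto simp: balanced_map_def)
    ultimately show "frag_of (a, b \<oplus>\<^bsub>S\<^esub> b') - frag_of (a, b) - frag_of (a, b') \<in> ?K"
      by (simp add: kernel_def keys3 keys2 diff gens f_c cancel)
  next
    fix a r b assume "a \<in> carrier S" "r \<in> carrier R" "b \<in> carrier S"
    moreover from this have "f (a \<otimes>\<^bsub>S\<^esub> \<phi> r) b = f a (\<phi> r \<otimes>\<^bsub>S\<^esub> b)"
      using f by (auto simp: balanced_map_def)
    ultimately show "frag_of (a \<otimes>\<^bsub>S\<^esub> \<phi> r, b) - frag_of (a, \<phi> r \<otimes>\<^bsub>S\<^esub> b) \<in> ?K"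
      by (simp add: kernel_def keys2 diff gens f_c \<phi>)
  qed
  then show thesis
    using that[of h] h gens by (auto simp: tensor_free_def kernel_def)
qed

lemma separable_casimir:
  assumes sep: "separable_extension R S \<phi>"
  obtains c where "Poly_Mapping.keys c \<subseteq> carrier S \<times> carrier S"
    "\<And>s. s \<in> carrier S \<Longrightarrow> frag_extend (\<lambda>p. frag_of (s \<otimes>\<^bsub>S\<^esub> fst p, snd p)) c
        - frag_extend (\<lambda>p. frag_of (fst p, snd p \<otimes>\<^bsub>S\<^esub> s)) c \<in> tensor_rel R S \<phi>"
    "\<And>m. \<lbrakk>m \<in> hom (tensor_free S) (add_monoid S);
        \<forall>u\<in>carrier S. \<forall>v\<in>carrier S. m (frag_of (u, v)) = u \<otimes>\<^bsub>S\<^esub> v\<rbrakk> \<Longrightarrow> m c = \<one>\<^bsub>S\<^esub>"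
proof -
  from sep have S: "ring S" and \<phi>: "\<And>r. r \<in> carrier R \<Longrightarrow> \<phi> r \<in> carrier S"
    by (auto simp: separable_extension_def ring_extension_def ring_hom_closed)
  interpret S: ring S by (rule S)
  obtain \<sigma> where \<sigma>: "\<sigma> \<in> hom (add_monoid S) (tensor_self R S \<phi>)"
    and bimod: "\<And>s a. \<lbrakk>s \<in> carrier S; a \<in> carrier S\<rbrakk> \<Longrightarrow>
           \<sigma> (s \<otimes>\<^bsub>S\<^esub> a) = tensor_lmult R S \<phi> s (\<sigma> a) \<and> \<sigma> (a \<otimes>\<^bsub>S\<^esub> s) = tensor_rmult R S \<phi> (\<sigma> a) s"
    and split: "\<And>a. a \<in> carrier S \<Longrightarrow> tensor_mult S (\<sigma> a) = a"
    using sep unfolding separable_extension_def by blast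
  let ?P = "carrier S \<times> carrier S"
  let ?K = "tensor_rel R S \<phi>"
  let ?l = "\<lambda>s. frag_extend (\<lambda>p. frag_of (s \<otimes>\<^bsub>S\<^esub> fst p, snd p))"
  let ?r = "\<lambda>s. frag_extend (\<lambda>p. frag_of (fst p, snd p \<otimes>\<^bsub>S\<^esub> s))"
  have K: "subgroup ?K (tensor_free S)"
    by (rule tensor_rel_subgroup[OF S \<phi>])
  have K0: "0 \<in> ?K" and Kadd: "\<And>x y. \<lbrakk>x \<in> ?K; y \<in> ?K\<rbrakk> \<Longrightarrow> x + y \<in> ?K"
    using subgroup.one_closed[OF K] subgroup.m_closed[OF K] by (auto simp: tensor_free_def)
  have Kkeys: "Poly_Mapping.keys x \<subseteq> ?P" if "x \<in> ?K" for x
    using subsetD[OF subgroup.subset[OF K] that] by (simp add: tensor_free_def)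
  have "\<sigma> \<one>\<^bsub>S\<^esub> \<in> rcosets\<^bsub>tensor_free S\<^esub> ?K"
    using \<sigma> by (auto simp: hom_def tensor_self_def FactGroup_def)
  then obtain c where c: "Poly_Mapping.keys c \<subseteq> ?P" and X: "\<sigma> \<one>\<^bsub>S\<^esub> = (\<Union>k\<in>?K. {k + c})"
    by (auto simp: RCOSETS_def r_coset_def tensor_free_def)
  have K_add_l: "frag_of (a \<oplus>\<^bsub>S\<^esub> a', b) - frag_of (a, b) - frag_of (a', b) \<in> ?K"
    if "a \<in> carrier S" "a' \<in> carrier S" "b \<in> carrier S" for a a' b
    unfolding tensor_rel_def by (rule generate.incl) (use that in blast)
  have K_add_r: "frag_of (a, b \<oplus>\<^bsub>S\<^esub> b') - frag_of (a, b) - frag_of (a, b') \<in> ?K"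
    if "a \<in> carrier S" "b \<in> carrier S" "b' \<in> carrier S" for a b b'
    unfolding tensor_rel_def by (rule generate.incl) (use that in blast)
  have K_bal: "frag_of (a \<otimes>\<^bsub>S\<^esub> \<phi> r, b) - frag_of (a, \<phi> r \<otimes>\<^bsub>S\<^esub> b) \<in> ?K"
    if "a \<in> carrier S" "r \<in> carrier R" "b \<in> carrier S" for a r b
    unfolding tensor_rel_def by (rule generate.incl) (use that in blast)
  \<comment> \<open>\<open>tensor_rmult\<close> is computed from all representatives of the coset,
    so its elements involve \<open>?r s (k' + c)\<close> with an unknown relation k'; that k' has to
    stay a relation under \<open>?r s\<close>.\<close>
  have rK: "?r s k \<in> ?K" if s: "s \<in> carrier S" and k: "k \<in> ?K" for s k
  proof -
    have keys: "Poly_Mapping.keys (?r s x) \<subseteq> ?P" if "Poly_Mapping.keys x \<subseteq> ?P" for x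
      using hom_in_carrier[OF frag_extend_hom[where k = "\<lambda>p. (fst p, snd p \<otimes>\<^bsub>S\<^esub> s)" and P = ?P and Q = ?P], of x]
        s that by auto
    have Kneg: "- x \<in> ?K" if "x \<in> ?K" for x
      using subgroup.m_inv_closed[OF K that] Kkeys[OF that] by (simp add: tensor_free_def)
    have "?K \<subseteq> {x. Poly_Mapping.keys x \<subseteq> ?P \<and> ?r s x \<in> ?K}"
    proof (rule tensor_rel_incl)
      show "subgroup {x. Poly_Mapping.keys x \<subseteq> ?P \<and> ?r s x \<in> ?K} (tensor_free S)"
        unfolding tensor_free_def
      proof (rule group.subgroupI)
        show "{x. Poly_Mapping.keys x \<subseteq> ?P \<and> ?r s x \<in> ?K} \<noteq> {}"
          using K0 by (auto intro: exI[of _ 0])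
      next
        fix x y assume "x \<in> {x. Poly_Mapping.keys x \<subseteq> ?P \<and> ?r s x \<in> ?K}"
          "y \<in> {x. Poly_Mapping.keys x \<subseteq> ?P \<and> ?r s x \<in> ?K}"
        then show "x \<otimes>\<^bsub>free_Abelian_group ?P\<^esub> y \<in> {x. Poly_Mapping.keys x \<subseteq> ?P \<and> ?r s x \<in> ?K}"
          using keys_add[of x y] by (auto simp: frag_extend_add Kadd)
      qed (auto simp: frag_extend_minus Kneg)
    next
      fix a a' b assume ab: "a \<in> carrier S" "a' \<in> carrier S" "b \<in> carrier S"
      then have "frag_of (a \<oplus>\<^bsub>S\<^esub> a', b) - frag_of (a, b) - frag_of (a', b) \<in> ?K"
        "frag_of (a \<oplus>\<^bsub>S\<^esub> a', b \<otimes>\<^bsub>S\<^esub> s) - frag_of (a, b \<otimes>\<^bsub>S\<^esub> s) - frag_of (a', b \<otimes>\<^bsub>S\<^esub> s) \<in> ?K"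
        using s K_add_l by simp_all
      then show "frag_of (a \<oplus>\<^bsub>S\<^esub> a', b) - frag_of (a, b) - frag_of (a', b)
          \<in> {x. Poly_Mapping.keys x \<subseteq> ?P \<and> ?r s x \<in> ?K}"
        using Kkeys by (simp add: frag_extend_diff)
    next
      fix a b b' assume ab: "a \<in> carrier S" "b \<in> carrier S" "b' \<in> carrier S"
      then have "frag_of (a, b \<oplus>\<^bsub>S\<^esub> b') - frag_of (a, b) - frag_of (a, b') \<in> ?K"
        "frag_of (a, b \<otimes>\<^bsub>S\<^esub> s \<oplus>\<^bsub>S\<^esub> b' \<otimes>\<^bsub>S\<^esub> s) - frag_of (a, b \<otimes>\<^bsub>S\<^esub> s) - frag_of (a, b' \<otimes>\<^bsub>S\<^esub> s) \<in> ?K"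
        using s K_add_r by simp_all
      then show "frag_of (a, b \<oplus>\<^bsub>S\<^esub> b') - frag_of (a, b) - frag_of (a, b')
          \<in> {x. Poly_Mapping.keys x \<subseteq> ?P \<and> ?r s x \<in> ?K}"
        using Kkeys ab s by (simp add: frag_extend_diff S.l_distr)
    next
      fix a r b assume ab: "a \<in> carrier S" "r \<in> carrier R" "b \<in> carrier S"
      then have "frag_of (a \<otimes>\<^bsub>S\<^esub> \<phi> r, b) - frag_of (a, \<phi> r \<otimes>\<^bsub>S\<^esub> b) \<in> ?K"
        "frag_of (a \<otimes>\<^bsub>S\<^esub> \<phi> r, b \<otimes>\<^bsub>S\<^esub> s) - frag_of (a, \<phi> r \<otimes>\<^bsub>S\<^esub> (b \<otimes>\<^bsub>S\<^esub> s)) \<in> ?K"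
        using s K_bal by simp_all
      then show "frag_of (a \<otimes>\<^bsub>S\<^esub> \<phi> r, b) - frag_of (a, \<phi> r \<otimes>\<^bsub>S\<^esub> b)
          \<in> {x. Poly_Mapping.keys x \<subseteq> ?P \<and> ?r s x \<in> ?K}"
        using Kkeys ab s \<phi> by (simp add: frag_extend_diff S.m_assoc)
    qed
    then show ?thesis using k by blast
  qed
  have rel: "?l s c - ?r s c \<in> ?K" if s: "s \<in> carrier S" for s
  proof -
    have "tensor_lmult R S \<phi> s (\<sigma> \<one>\<^bsub>S\<^esub>) = tensor_rmult R S \<phi> (\<sigma> \<one>\<^bsub>S\<^esub>) s"
      using bimod[OF s S.one_closed] s by (metis S.l_one S.r_one)
    \<comment> \<open>On the left the representative can be chosen to be c itself, with zero as the
      relation added.\<close>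
    moreover have "?l s c \<in> tensor_lmult R S \<phi> s (\<sigma> \<one>\<^bsub>S\<^esub>)"
      unfolding tensor_lmult_def X set_mult_def case_prod_unfold
      using K0 by (force simp: tensor_free_def)
    ultimately obtain k k' where "k \<in> ?K" "k' \<in> ?K" "?l s c = k + ?r s (k' + c)"
      unfolding tensor_rmult_def X set_mult_def case_prod_unfold by (auto simp: tensor_free_def)
    then show ?thesis
      using rK[OF s] Kadd by (simp add: frag_extend_add)
  qed
  have unit: "m c = \<one>\<^bsub>S\<^esub>" if m: "m \<in> hom (tensor_free S) (add_monoid S)"
    and gens: "\<And>u v. \<lbrakk>u \<in> carrier S; v \<in> carrier S\<rbrakk> \<Longrightarrow> m (frag_of (u, v)) = u \<otimes>\<^bsub>S\<^esub> v" for m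
  proof -
    have bal: "balanced_map R S \<phi> (add_monoid S) (\<lambda>u v. u \<otimes>\<^bsub>S\<^esub> v)"
      using \<phi> by (auto simp: balanced_map_def S.l_distr S.r_distr S.m_assoc)
    obtain m' where m': "m' \<in> hom (tensor_free S) (add_monoid S)"
      "\<And>u v. \<lbrakk>u \<in> carrier S; v \<in> carrier S\<rbrakk> \<Longrightarrow> m' (frag_of (u, v)) = u \<otimes>\<^bsub>S\<^esub> v"
      "\<And>k. k \<in> ?K \<Longrightarrow> m' k = \<zero>\<^bsub>S\<^esub>"
      using balanced_hom[OF S \<phi> S.a_comm_group bal] by auto
    \<comment> \<open>m and m' agree on generators, so m inherits from m' that it vanishes on the
      relations and is constant on the coset.\<close>
    have mm': "m x = m' x" if "Poly_Mapping.keys x \<subseteq> ?P" for x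
      by (rule free_hom_unique[OF S.a_group m[unfolded tensor_free_def] m'(1)[unfolded tensor_free_def]])
        (use that gens m'(2) in auto)
    have mK: "m (k + c) = m c" if "k \<in> ?K" for k
    proof -
      have "m' (k + c) = m' k \<oplus>\<^bsub>S\<^esub> m' c"
        using m'(1) Kkeys[OF that] c by (auto simp: hom_def tensor_free_def)
      moreover have "m' c \<in> carrier S"
        using m'(1) c by (auto simp: hom_def tensor_free_def)
      moreover have "Poly_Mapping.keys (k + c) \<subseteq> ?P"
        using Kkeys[OF that] c keys_add[of k c] by blast
      ultimately show ?thesis
        using mm'[of "k + c"] mm'[OF c] m'(3)[OF that] by simp
    qed
    have eval: "(\<Oplus>\<^bsub>S\<^esub>p\<in>Poly_Mapping.keys x. [Poly_Mapping.lookup x p] \<cdot>\<^bsub>S\<^esub> (fst p \<otimes>\<^bsub>S\<^esub> snd p)) = m x"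
      if x: "Poly_Mapping.keys x \<subseteq> ?P" for x
    proof -
      have "m x = finprod (add_monoid S) (\<lambda>p. m (frag_of p) [^]\<^bsub>add_monoid S\<^esub> Poly_Mapping.lookup x p)
          (Poly_Mapping.keys x)"
        using free_hom_eq_finprod[OF S.a_comm_group _ x] m by (simp add: tensor_free_def)
      also have "\<dots> = (\<Oplus>\<^bsub>S\<^esub>p\<in>Poly_Mapping.keys x. [Poly_Mapping.lookup x p] \<cdot>\<^bsub>S\<^esub> (fst p \<otimes>\<^bsub>S\<^esub> snd p))"
        unfolding finsum_def add_pow_def
        by (intro comm_monoid.finprod_cong'[OF S.a_comm_monoid])
          (use x gens group.int_pow_closed[OF S.a_group] in auto)
      finally show ?thesis by simp
    qed
    have "tensor_mult S (\<sigma> \<one>\<^bsub>S\<^esub>) = m c"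
    proof -
      \<comment> \<open>The set of values over the whole coset is a singleton, as
        \<open>the_elem\<close> in \<open>tensor_mult\<close> requires.\<close>
      have "(\<lambda>x. \<Oplus>\<^bsub>S\<^esub>p\<in>Poly_Mapping.keys x. [Poly_Mapping.lookup x p] \<cdot>\<^bsub>S\<^esub> (fst p \<otimes>\<^bsub>S\<^esub> snd p))
          ` \<sigma> \<one>\<^bsub>S\<^esub> = m ` \<sigma> \<one>\<^bsub>S\<^esub>"
      proof (rule image_cong[OF refl])
        fix x assume "x \<in> \<sigma> \<one>\<^bsub>S\<^esub>"
        then have "Poly_Mapping.keys x \<subseteq> ?P"
          unfolding X using Kkeys c keys_add[of _ c] by fast
        then show "(\<Oplus>\<^bsub>S\<^esub>p\<in>Poly_Mapping.keys x. [Poly_Mapping.lookup x p] \<cdot>\<^bsub>S\<^esub> (fst p \<otimes>\<^bsub>S\<^esub> snd p)) = m x"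
          by (rule eval)
      qed
      also have "\<dots> = {m c}"
        unfolding X using mK K0 by auto
      finally show ?thesis by (simp add: tensor_mult_def)
    qed
    then show ?thesis
      using split[of "\<one>\<^bsub>S\<^esub>"] by simp
  qed
  show thesis
    using that[OF c] rel unit by blast
qed

section \<open>Recovering a trace element from a splitting\<close>

context embedded_action
begin

lemma mult_act_obj:
  assumes "u \<in> carrier S" "y \<in> objs G" "r \<in> R"
  shows "u y * act y r = u y * r"
proof -
  have y: "y \<in> carrier G" using assms objsD by blast
  have "u y * act y r = u y * e y * r"
    using assms act_obj[of y r] e_central[OF y, of r] by (simp add: mult.assoc)
  then show ?thesis using D_e[OF y S_in_D[OF assms(1) y]] by simp
qed

text \<open>
  The trace element is the image of the separability element \<open>c\<close> under \<open>T u v = (\<Sum>y. u y * v y)\<close>.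
  It is central because \<open>r c = c r\<close>. The auxiliary map \<open>\<lambda>u v. u g * act g (v (source G g))\<close>, applied
  to \<open>\<delta>\<^sub>g c = c \<delta>\<^sub>g\<close>, shows that \<open>act g (T c)\<close> is the contribution of \<open>g\<close> to the coefficient of
  the product of \<open>c\<close> at \<open>target G g\<close>, and these contributions add up to those of the identity.
\<close>

lemma separable_trace:
  assumes sep: "separable_extension (set_ring R) S \<phi>"
  obtains a where "a \<in> center_of R" "\<And>z. z \<in> objs G \<Longrightarrow> (\<Sum>g\<in>fibre z. act g a) = e z"
proof -
  let ?P = "carrier S \<times> carrier S" and ?R = "add_monoid (set_ring R)"
  interpret R: ring "set_ring R" by (rule ring_set_ring)
  obtain c where c: "Poly_Mapping.keys c \<subseteq> ?P"
    and rel: "\<And>s. s \<in> carrier S \<Longrightarrow> frag_extend (\<lambda>p. frag_of (s \<otimes>\<^bsub>S\<^esub> fst p, snd p)) c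
        - frag_extend (\<lambda>p. frag_of (fst p, snd p \<otimes>\<^bsub>S\<^esub> s)) c \<in> tensor_rel (set_ring R) S \<phi>"
    and unit: "\<And>m. \<lbrakk>m \<in> hom (tensor_free S) (add_monoid S);
        \<forall>u\<in>carrier S. \<forall>v\<in>carrier S. m (frag_of (u, v)) = u \<otimes>\<^bsub>S\<^esub> v\<rbrakk> \<Longrightarrow> m c = \<one>\<^bsub>S\<^esub>"
    by (rule separable_casimir[OF sep]) blast
  \<comment> \<open>Being a homomorphism from the free group into R, spelt out pointwise: it is then
    immediate that \<open>\<lambda>x. r * hT x\<close>, \<open>\<lambda>x. act g (hT x)\<close> and
    finite sums of homomorphisms are again homomorphisms.\<close>
  define additive where "additive h \<longleftrightarrow> (\<forall>x. Poly_Mapping.keys x \<subseteq> ?P \<longrightarrow> h x \<in> R) \<and>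
      (\<forall>x y. Poly_Mapping.keys x \<subseteq> ?P \<longrightarrow> Poly_Mapping.keys y \<subseteq> ?P \<longrightarrow> h (x + y) = h x + h y)"
    for h :: "(('g \<Rightarrow> 'a) \<times> ('g \<Rightarrow> 'a) \<Rightarrow>\<^sub>0 int) \<Rightarrow> 'a"
  define extends where "extends f h \<longleftrightarrow> additive h \<and>
      (\<forall>u\<in>carrier S. \<forall>v\<in>carrier S. h (frag_of (u, v)) = f u v)" for f h
  have additive_iff: "additive h \<longleftrightarrow> h \<in> hom (tensor_free S) ?R" for h
    by (auto simp: additive_def hom_def tensor_free_def Pi_iff set_ring_def)
  have unique: "h c = h' c"
    if "extends f h" "extends f' h'" "\<And>u v. \<lbrakk>u \<in> carrier S; v \<in> carrier S\<rbrakk> \<Longrightarrow> f u v = f' u v" for f f' h h'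
    by (rule free_hom_unique[OF R.a_group _ _ _ c, of h h'])
      (use that in \<open>auto simp: extends_def additive_iff tensor_free_def\<close>)
  \<comment> \<open>The two translates of f have the same value at c because h vanishes on the
    relation saying that s commutes with c. Together with \<open>unique\<close>, everything reduces
    to comparing formulas on pairs.\<close>
  have ex: "\<exists>h. extends f h \<and> (\<forall>s\<in>carrier S. \<exists>k k'. extends (\<lambda>u v. f (s \<otimes>\<^bsub>S\<^esub> u) v) k \<and>
      extends (\<lambda>u v. f u (v \<otimes>\<^bsub>S\<^esub> s)) k' \<and> k c = k' c)"
    if f: "balanced_map (set_ring R) S \<phi> ?R f" for f
  proof -
    obtain h where h: "h \<in> hom (tensor_free S) ?R"
      "\<And>u v. \<lbrakk>u \<in> carrier S; v \<in> carrier S\<rbrakk> \<Longrightarrow> h (frag_of (u, v)) = f u v"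
      "\<And>k. k \<in> tensor_rel (set_ring R) S \<phi> \<Longrightarrow> h k = 0"
      using balanced_hom[OF S.ring_axioms \<phi>_S R.a_comm_group f] by (auto simp: set_ring_def)
    have "\<exists>k k'. extends (\<lambda>u v. f (s \<otimes>\<^bsub>S\<^esub> u) v) k \<and> extends (\<lambda>u v. f u (v \<otimes>\<^bsub>S\<^esub> s)) k' \<and> k c = k' c"
      if s: "s \<in> carrier S" for s
    proof -
      let ?l = "frag_extend (\<lambda>p. frag_of (s \<otimes>\<^bsub>S\<^esub> fst p, snd p))"
      let ?r = "frag_extend (\<lambda>p. frag_of (fst p, snd p \<otimes>\<^bsub>S\<^esub> s))"
      have l: "?l \<in> hom (tensor_free S) (tensor_free S)" and r: "?r \<in> hom (tensor_free S) (tensor_free S)"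
        unfolding tensor_free_def by (intro frag_extend_hom; use s in auto)+
      have l': "extends (\<lambda>u v. f (s \<otimes>\<^bsub>S\<^esub> u) v) (\<lambda>x. h (?l x))"
        using Group.hom_compose[OF l h(1)] h(2) s by (simp add: extends_def additive_iff o_def)
      have r': "extends (\<lambda>u v. f u (v \<otimes>\<^bsub>S\<^esub> s)) (\<lambda>x. h (?r x))"
        using Group.hom_compose[OF r h(1)] h(2) s by (simp add: extends_def additive_iff o_def)
      have keys: "Poly_Mapping.keys (?l c) \<subseteq> ?P" "Poly_Mapping.keys (?r c) \<subseteq> ?P"
        using hom_in_carrier[OF l, of c] hom_in_carrier[OF r, of c] c by (simp_all add: tensor_free_def)
      have "Poly_Mapping.keys (?l c - ?r c) \<subseteq> ?P"
        using keys keys_diff[of "?l c" "?r c"] by blast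
      then have "h (?l c - ?r c + ?r c) = h (?l c - ?r c) + h (?r c)"
        using h(1)[folded additive_iff] keys unfolding additive_def by blast
      then have "h (?l c) = h (?r c)"
        using h(3)[OF rel[OF s]] by simp
      then show ?thesis using l' r' by blast
    qed
    then show ?thesis using h unfolding extends_def additive_iff by blast
  qed
  have T_bal: "balanced_map (set_ring R) S \<phi> ?R (\<lambda>u v. \<Sum>y\<in>objs G. u y * v y)"
  proof -
    have *: "(u \<otimes>\<^bsub>S\<^esub> emb r) y * v y = u y * (emb r \<otimes>\<^bsub>S\<^esub> v) y"
      if "u \<in> carrier S" "v \<in> carrier S" "r \<in> R" "y \<in> objs G" for u v r y
      using that by (simp add: S_mult_emb emb_mult_S mult_act_obj mult.assoc)
    have **: "u y \<in> R" if "u \<in> carrier S" "y \<in> objs G" for u y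
      using that S_in_R objsD by blast
    show ?thesis
      unfolding balanced_map_def
      by (auto simp: set_ring_def \<phi>_eq * ** add_S distrib_left distrib_right sum.distrib
          intro!: sum_in mult_in)
  qed
  define T where "T u v = (\<Sum>y\<in>objs G. u y * v y)" for u v :: "'g \<Rightarrow> 'a"
  have T_R: "T u v \<in> R" if "u \<in> carrier S" "v \<in> carrier S" for u v
    unfolding T_def using that objsD by (intro sum_in mult_in S_in_R) auto
  obtain hT where hT: "extends T hT" and hT_bal: "\<And>s. s \<in> carrier S \<Longrightarrow>
      \<exists>k k'. extends (\<lambda>u v. T (s \<otimes>\<^bsub>S\<^esub> u) v) k \<and> extends (\<lambda>u v. T u (v \<otimes>\<^bsub>S\<^esub> s)) k' \<and> k c = k' c"
    using ex[OF T_bal] unfolding T_def by blast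
  define a where "a = hT c"
  have a_R: "a \<in> R"
    using hT c unfolding a_def extends_def additive_def by blast
  have "a * r = r * a" if r: "r \<in> R" for r
  proof -
    obtain k k' where k: "extends (\<lambda>u v. T (emb r \<otimes>\<^bsub>S\<^esub> u) v) k" "extends (\<lambda>u v. T u (v \<otimes>\<^bsub>S\<^esub> emb r)) k'"
      "k c = k' c"
      using hT_bal[OF emb_S[OF r]] by blast
    \<comment> \<open>Base ring elements slide out of T on either side, so the equal values of k and
      k' at c are r a and a r.\<close>
    have "extends (\<lambda>u v. r * T u v) (\<lambda>x. r * hT x)" "extends (\<lambda>u v. T u v * r) (\<lambda>x. hT x * r)"
      using hT r by (auto simp: extends_def additive_def mult_in distrib_left distrib_right)
    moreover have "T (emb r \<otimes>\<^bsub>S\<^esub> u) v = r * T u v" "T u (v \<otimes>\<^bsub>S\<^esub> emb r) = T u v * r"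
      if "u \<in> carrier S" "v \<in> carrier S" for u v
      using that r by (auto simp: T_def emb_mult_S S_mult_emb mult_act_obj sum_distrib_left
          sum_distrib_right mult.assoc intro!: sum.cong)
    ultimately have "k c = r * hT c" "k' c = hT c * r"
      using unique[OF k(1)] unique[OF k(2)] by blast+
    then show ?thesis using k(3) by (simp add: a_def)
  qed
  then have a_center: "a \<in> center_of R"
    using a_R by (simp add: center_of_def)
  have "\<exists>H. extends (\<lambda>u v. u g * act g (v (ginv G g))) H \<and> H c = act g a" if g: "g \<in> carrier G" for g
  proof -
    \<comment> \<open>The second argument is read at \<open>source G g\<close> because left
      translation by \<open>?d\<close> turns \<open>u g\<close> into
      \<open>act g (u (source G g))\<close>, giving \<open>act g (T u v)\<close>. Right translation
      turns \<open>v (source G g)\<close> into \<open>v (ginv G g)\<close> instead, giving a term of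
      the product.\<close>
    let ?T = "\<lambda>u v. u g * act g (v (source G g))"
    let ?d = "delta g (e g)"
    have sg: "source G g \<in> carrier G" "source G g \<in> objs G"
      using g by (auto simp: source_closed source_in_objs)
    have d: "?d \<in> carrier S"
      using g by (simp add: delta_S e_in_D)
    have "balanced_map (set_ring R) S \<phi> ?R ?T"
      unfolding balanced_map_def
      using g sg S_in_R by (auto simp: set_ring_def \<phi>_eq add_S S_mult_emb emb_mult_S act_mult act_add
          distrib_left distrib_right mult.assoc intro!: mult_in act_in)
    from ex[OF this] d obtain k k' where k: "extends (\<lambda>u v. ?T (?d \<otimes>\<^bsub>S\<^esub> u) v) k"
      "extends (\<lambda>u v. ?T u (v \<otimes>\<^bsub>S\<^esub> ?d)) k'" "k c = k' c"
      by blast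
    have "?T (?d \<otimes>\<^bsub>S\<^esub> u) v = act g (T u v)" if uv: "u \<in> carrier S" "v \<in> carrier S" for u v
    proof -
      have R: "u y \<in> R" "v y \<in> R" "y \<in> carrier G" if "y \<in> objs G" for y
        using uv that S_in_R objsD by blast+
      have "act g (T u v) = (\<Sum>y\<in>objs G. act g (u y * v y))"
        unfolding T_def using g R by (intro act_sum mult_in) auto
      also have "\<dots> = (\<Sum>y\<in>objs G. if y = source G g then act g (u y * v y) else 0)"
      proof (rule sum.cong[OF refl])
        fix y assume y: "y \<in> objs G"
        have "u y * v y \<in> D y"
          by (intro mult_in_D_left S_in_D R uv y)
        then show "act g (u y * v y) = (if y = source G g then act g (u y * v y) else 0)"
          using act_eq_zero[OF g _ y] by simp
      qed
      also have "\<dots> = act g (u (source G g) * v (source G g))"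
        using sg fin_objs by simp
      also have "\<dots> = act g (u (source G g)) * act g (v (source G g))"
        using g R sg by (simp add: act_mult)
      moreover have "(?d \<otimes>\<^bsub>S\<^esub> u) g = act g (u (source G g))"
        using delta_mult_S[OF g g, of "e g" u] g e_central[OF g act_in[OF g R(1)[OF sg(2)]]]
          act_e[OF g R(1)[OF sg(2)]] by (simp add: ginv_comp)
      ultimately show ?thesis by simp
    qed
    moreover have "extends (\<lambda>u v. act g (T u v)) (\<lambda>x. act g (hT x))"
      using hT g by (auto simp: extends_def additive_def act_in act_add)
    ultimately have "k c = act g a"
      unfolding a_def using unique[OF k(1)] by blast
    moreover have "(v \<otimes>\<^bsub>S\<^esub> ?d) (source G g) = v (ginv G g)" if v: "v \<in> carrier S" for v
    proof -
      have "(v \<otimes>\<^bsub>S\<^esub> ?d) (source G g) = (\<Sum>p\<in>fibre (source G g). if p = ginv G g then v p else 0)"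
      proof -
        \<comment> \<open>A coefficient of \<open>?d\<close> is hit only if the right factor is g,
          which forces p = \<open>ginv G g\<close>; the idempotent \<open>e g\<close> is then
          absorbed by \<open>act_e_ginv\<close>.\<close>
        have "v p * act p (?d (comp G (ginv G p) (source G g))) = (if p = ginv G g then v p else 0)"
          if p: "p \<in> carrier G" "target G p = source G g" for p
        proof -
          have eq: "comp G (ginv G p) (source G g) = ginv G p"
            using p comp_source[of "ginv G p"] by (simp add: ginv_closed source_ginv)
          show ?thesis
          proof (cases "p = ginv G g")
            case True
            then show ?thesis
              unfolding eq using g p v D_e[OF p(1) S_in_D[OF v p(1)]] act_e_ginv[OF p(1)]
              by (simp add: ginv_ginv delta_def)
          next
            case False
            then have "ginv G p \<noteq> g" using ginv_ginv[OF p(1)] by auto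
            then show ?thesis
              unfolding eq using False by (simp add: delta_def act_zero p)
          qed
        qed
        then show ?thesis
          using sg target_source[OF g] by (auto simp: mult_S intro!: sum.cong)
      qed
      then show ?thesis
        using g by (simp add: fin ginv_closed target_ginv)
    qed
    then have "extends (\<lambda>u v. u g * act g (v (ginv G g))) k'"
      using k(2) by (simp add: extends_def)
    ultimately show ?thesis using k(3) by auto
  qed
  then obtain H where H: "\<And>g. g \<in> carrier G \<Longrightarrow> extends (\<lambda>u v. u g * act g (v (ginv G g))) (H g)"
    "\<And>g. g \<in> carrier G \<Longrightarrow> H g c = act g a"
    by metis
  have bal: "balanced_map (set_ring R) S \<phi> (add_monoid S) (\<lambda>u v. u \<otimes>\<^bsub>S\<^esub> v)"
    using \<phi>_S by (auto simp: balanced_map_def S.l_distr S.r_distr S.m_assoc)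
  obtain m where m: "m \<in> hom (tensor_free S) (add_monoid S)"
    "\<And>u v. \<lbrakk>u \<in> carrier S; v \<in> carrier S\<rbrakk> \<Longrightarrow> m (frag_of (u, v)) = u \<otimes>\<^bsub>S\<^esub> v"
    by (rule balanced_hom[OF S.ring_axioms \<phi>_S S.a_comm_group bal]) blast+
  have "(\<Sum>g\<in>fibre z. act g a) = e z" if z: "z \<in> objs G" for z
  proof -
    have zC: "z \<in> carrier G" "target G z = z" using objsD[OF z] by auto
    \<comment> \<open>At an object z the product formula is the sum of the maps extended by the
      \<open>H g\<close>. Evaluation at c gives the coefficient of the identity on one side and the
      trace on the other.\<close>
    have "extends (\<lambda>u v. (u \<otimes>\<^bsub>S\<^esub> v) z) (\<lambda>x. m x z)"
      using m zC S_in_R by (auto simp: extends_def additive_def hom_def tensor_free_def Pi_iff add_S)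
    moreover have "extends (\<lambda>u v. \<Sum>g\<in>fibre z. u g * act g (v (ginv G g))) (\<lambda>x. \<Sum>g\<in>fibre z. H g x)"
      using H(1) by (auto simp: extends_def additive_def sum.distrib intro!: sum_in)
    moreover have "(u \<otimes>\<^bsub>S\<^esub> v) z = (\<Sum>g\<in>fibre z. u g * act g (v (ginv G g)))" for u v
    proof -
      have "comp G (ginv G g) z = ginv G g" if "g \<in> fibre z" for g
        using that comp_source[of "ginv G g"] by (auto simp: ginv_closed source_ginv)
      then show ?thesis
        using zC by (auto simp: mult_S intro!: sum.cong)
    qed
    ultimately have "m c z = (\<Sum>g\<in>fibre z. H g c)"
      using unique by blast
    moreover have "m c = \<one>\<^bsub>S\<^esub>"
      using unit[OF m(1)] m(2) by blast
    ultimately show ?thesis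
      using H(2) z by (simp add: one_S)
  qed
  with a_center show thesis by (rule that)
qed

end

section \<open>Passage between the groupoid and its isotropy group\<close>

context unital_action
begin

lemma fin_homs: "finite (homs G y z)"
  using fin by (simp add: homs_def)

lemma trace_at_eq: "trace_at G D \<alpha> z r = (\<Sum>g\<in>fibre z. act g r)"
proof -
  have "(\<Sum>g\<in>fibre z. act g r) = (\<Sum>y\<in>objs G. \<Sum>g | g \<in> fibre z \<and> source G g = y. act g r)"
    using fin_objs fin_fibre source_in_objs by (intro sum.group[symmetric]) auto
  also have "\<dots> = trace_at G D \<alpha> z r"
    unfolding trace_at_def trace_between_def total_act_def homs_def
    by (intro sum.cong) auto
  finally show ?thesis by simp
qed

context
  fixes x assumes x: "x \<in> objs G"
begin

lemma isotropy_simps: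
  "carrier (isotropy G x) = homs G x x" "source (isotropy G x) = source G"
  "target (isotropy G x) = target G" "comp (isotropy G x) = comp G" "ginv (isotropy G x) = ginv G"
  "total_act (isotropy G x) D \<alpha> = act"
  by (auto simp: isotropy_def total_act_def fun_eq_iff)

lemma homsD: "g \<in> homs G y z \<Longrightarrow> g \<in> carrier G" "g \<in> homs G y z \<Longrightarrow> source G g = y"
  "g \<in> homs G y z \<Longrightarrow> target G g = z"
  by (auto simp: homs_def)

lemma D_x_in: "r \<in> D x \<Longrightarrow> r \<in> R"
  using D_in objsD x by blast

lemma in_D_isotropy: "g \<in> homs G x x \<Longrightarrow> r \<in> D g \<Longrightarrow> r \<in> D x"
  using D_target[of g r] homsD[of g] by simp

text \<open>On loops at x the maps and idempotents are unchanged; only the ambient ring shrinks to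
  \<open>D x\<close>, whose identity is \<open>e x\<close>. All results about the skew groupoid ring
  thereby become available for the isotropy group.\<close>

lemma isotropy_action: "unital_action (isotropy G x) (D x) D \<alpha>"
proof -
  interpret H: groupoid "isotropy G x" by (rule isotropy_groupoid)
  have xC: "x \<in> carrier G" using x objsD by blast
  show ?thesis
    unfolding unital_action_def unital_action_axioms_def action_data_def isotropy_simps objs_isotropy[OF x]
  proof (intro conjI allI impI)
    show "groupoid (isotropy G x)" by (rule isotropy_groupoid)
    show "finite (homs G x x)" by (rule fin_homs)
    show "r - s \<in> D x" if "r \<in> D x" "s \<in> D x" for r s
      using add_in_D[OF xC that(1) uminus_in_D[OF xC that(2)]] by simp
    show "r \<in> D g \<longleftrightarrow> r \<in> D x \<and> r * e g = r" if "g \<in> homs G x x" for g r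
      using in_D_isotropy[OF that] in_D_iff[of g r] homsD(1)[OF that] D_x_in by blast
    show "e g * e (target G g) = e g" if "g \<in> homs G x x" for g
      using e_target homsD(1)[OF that] by blast
    show "e g \<in> D x" if "g \<in> homs G x x" for g
      using in_D_isotropy[OF that e_in_D] homsD(1)[OF that] by blast
    show "act g r \<in> D x" if "g \<in> homs G x x" "r \<in> D x" for g r
      using in_D_isotropy[OF that(1) act_in_D] homsD(1)[OF that(1)] D_x_in[OF that(2)] by blast
    show "act g (e (source G g)) = e g" if "g \<in> homs G x x" for g
      using act_source homsD(1)[OF that] by blast
    show "act g (act h r) = act (comp G g h) r * e g"
      if "g \<in> homs G x x" "h \<in> homs G x x" "r \<in> D x" for g h r
      using that homsD D_x_in by (intro act_act) auto
  qed (use x xC homsD in_D_isotropy D_x_in in \<open>auto intro!: zero_in_D mult_in_D_left e_in_D e_central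
      e_idem act_in_D act_e act_add act_mult act_source act_obj D_e\<close>)
qed

section \<open>Traces along a global transversal\<close>

context
  fixes \<tau>
  assumes \<tau>: "transversal G x \<tau>"
    and e_\<tau>: "\<And>y. y \<in> objs G \<Longrightarrow> e (\<tau> y) = e y"
    and e_ginv_\<tau>: "\<And>y. y \<in> objs G \<Longrightarrow> e (ginv G (\<tau> y)) = e x"
begin

lemma \<tau>_homs: "y \<in> objs G \<Longrightarrow> \<tau> y \<in> homs G x y"
  using \<tau> by (simp add: transversal_def)

text \<open>An element of \<open>D x\<close> is seen only by morphisms starting at x. Those ending
  at z are \<tau> z h with h a loop, so the trace at z is \<open>act (\<tau> z)\<close> applied to
  the trace over the loops, and this map sends \<open>e x\<close> to \<open>e z\<close>.\<close>

lemma trace_from_isotropy: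
  assumes b: "b \<in> center_of (D x)" and trace: "(\<Sum>h\<in>homs G x x. act h b) = e x"
  shows "b \<in> center_of R" "z \<in> objs G \<Longrightarrow> (\<Sum>g\<in>fibre z. act g b) = e z"
proof -
  have xC: "x \<in> carrier G" using x objsD by blast
  have bD: "b \<in> D x" and b_comm: "\<And>r. r \<in> D x \<Longrightarrow> b * r = r * b"
    using b by (auto simp: center_of_def)
  have bR: "b \<in> R" using D_x_in bD by blast
  have "b * r = r * b" if r: "r \<in> R" for r
  proof -
    have eb: "b * e x = b" "e x * b = b"
      using D_e[OF xC bD] e_central[OF xC bR] by auto
    \<comment> \<open>Commuting with \<open>D x\<close> is enough, since \<open>e x\<close> is
      central and b sees r only through \<open>e x * r\<close>, which lies in
      \<open>D x\<close>.\<close>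
    have "b * r = b * (e x * r)"
      using eb by (simp add: mult.assoc[symmetric])
    also have "\<dots> = r * e x * b"
      using b_comm[OF mult_in_D_right[OF xC e_in_D[OF xC] r]] e_central[OF xC r] by simp
    finally show ?thesis using eb by (simp add: mult.assoc)
  qed
  then show "b \<in> center_of R"
    using bR by (simp add: center_of_def)
  show "(\<Sum>g\<in>fibre z. act g b) = e z" if z: "z \<in> objs G"
  proof -
    let ?t = "\<tau> z"
    have t: "?t \<in> carrier G" "source G ?t = x" "target G ?t = z"
      using homsD[OF \<tau>_homs[OF z]] by auto
    have "(\<Sum>g\<in>fibre z. act g b) = (\<Sum>g\<in>homs G x z. act g b)"
      using act_eq_zero[OF _ bD x] fin by (intro sum.mono_neutral_right) (auto simp: homs_def)
    also have "\<dots> = (\<Sum>h\<in>homs G x x. act (comp G ?t h) b)"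
      by (rule sum.reindex_bij_witness[where i = "comp G ?t" and j = "comp G (ginv G ?t)"])
        (use t in \<open>auto simp: homs_def comp_ginv_cancel ginv_comp_cancel comp_closed ginv_closed
          source_comp target_comp source_ginv target_ginv\<close>)
    also have "\<dots> = (\<Sum>h\<in>homs G x x. act ?t (act h b))"
    proof (rule sum.cong[OF refl])
      fix h assume "h \<in> homs G x x"
      then have h: "h \<in> carrier G" "source G ?t = target G h" using homsD t by auto
      have k: "comp G ?t h \<in> carrier G" "target G (comp G ?t h) = z"
        using h t by (auto simp: comp_closed target_comp)
      \<comment> \<open>The idempotent left over by \<open>act_act\<close> is
        \<open>e (\<tau> z)\<close>; it equals \<open>e z\<close> by assumption and is therefore
        absorbed.\<close>
      have "act (comp G ?t h) b * e z = act (comp G ?t h) b"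
        using D_target[OF k(1) act_in_D[OF k(1) bR]] k(2) D_e objsD[OF z] by auto
      then show "act (comp G ?t h) b = act ?t (act h b)"
        using act_act[OF t(1) h bR] e_\<tau>[OF z] by simp
    qed
    also have "\<dots> = act ?t (\<Sum>h\<in>homs G x x. act h b)"
      using t homsD bR by (intro act_sum[symmetric] act_in) auto
    also have "\<dots> = e z"
      using trace act_source[OF t(1)] t e_\<tau>[OF z] by simp
    finally show ?thesis .
  qed
qed

text \<open>The witness collects the components of a at all objects inside \<open>D x\<close>. As h
  runs through the loops, h \<open>ginv G (\<tau> y)\<close> runs through the morphisms from y to x,
  so the local trace of the witness is the trace of a at x.\<close>

lemma trace_to_isotropy:
  assumes a: "a \<in> center_of R" and trace: "(\<Sum>g\<in>fibre x. act g a) = e x"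
  obtains b where "b \<in> center_of (D x)" "(\<Sum>h\<in>homs G x x. act h b) = e x"
proof
  have xC: "x \<in> carrier G" using x objsD by blast
  have aR: "a \<in> R" using a by (simp add: center_of_def)
  have t: "ginv G (\<tau> y) \<in> carrier G" "source G (ginv G (\<tau> y)) = y" "target G (ginv G (\<tau> y)) = x"
    "\<tau> y \<in> carrier G" "source G (\<tau> y) = x" "target G (\<tau> y) = y" if "y \<in> objs G" for y
    using homsD[OF \<tau>_homs[OF that]] by (auto simp: ginv_closed source_ginv target_ginv)
  let ?b = "\<Sum>y\<in>objs G. act (ginv G (\<tau> y)) a"
  have "?b \<in> D x"
    using D_target[OF t(1) act_in_D[OF t(1) aR]] t(3) by (intro sum_in_D[OF xC]) simp
  moreover have "?b * r = r * ?b" if "r \<in> D x" for r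
    unfolding sum_distrib_left sum_distrib_right
    using act_central[OF t(1) a D_x_in[OF that]] by simp
  ultimately show "?b \<in> center_of (D x)"
    by (simp add: center_of_def)
  have "(\<Sum>h\<in>homs G x x. act h ?b) = (\<Sum>h\<in>homs G x x. \<Sum>y\<in>objs G. act (comp G h (ginv G (\<tau> y))) a)"
  proof (rule sum.cong[OF refl])
    fix h assume "h \<in> homs G x x"
    then have h: "h \<in> carrier G" "source G h = x" "target G h = x" using homsD by auto
    have "act h (act (ginv G (\<tau> y)) a) = act (comp G h (ginv G (\<tau> y))) a" if y: "y \<in> objs G" for y
    proof -
      let ?k = "comp G h (ginv G (\<tau> y))"
      have k: "?k \<in> carrier G" "source G ?k = y" "comp G ?k (\<tau> y) = h"
        using h t[OF y] by (simp_all add: comp_closed source_comp comp_ginv_cancel_right)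
      \<comment> \<open>\<open>act_e_eq\<close> for h followed by \<open>ginv G (\<tau> y)\<close>,
        and for \<open>?k\<close> followed by \<tau> y, shows that each of \<open>e h\<close> and
        \<open>e ?k\<close> absorbs the other. Hence they coincide and composition leaves no
        defect.\<close>
      have "e h = e ?k * e h"
        using act_e_eq[OF h(1) t(1)[OF y]] t[OF y] h act_source[OF h(1)] e_ginv_\<tau>[OF y] by simp
      moreover have "e ?k = e h * e ?k"
        using act_e_eq[OF k(1) t(4)[OF y]] t[OF y] k act_source[OF k(1)] e_\<tau>[OF y] by simp
      moreover have "e h * e ?k = e ?k * e h"
        by (rule e_central[OF h(1) e_in[OF k(1)]])
      ultimately have "e h = e ?k" by simp
      then show ?thesis
        using act_act[OF h(1) t(1)[OF y] _ aR] h t[OF y] act_e[OF k(1) aR] by simp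
    qed
    then show "act h ?b = (\<Sum>y\<in>objs G. act (comp G h (ginv G (\<tau> y))) a)"
      using act_sum[OF h(1), of "objs G" "\<lambda>y. act (ginv G (\<tau> y)) a"] t(1) aR by (simp add: act_in)
  qed
  also have "\<dots> = (\<Sum>y\<in>objs G. \<Sum>h\<in>homs G x x. act (comp G h (ginv G (\<tau> y))) a)"
    by (rule sum.swap)
  also have "\<dots> = (\<Sum>y\<in>objs G. \<Sum>g\<in>homs G y x. act g a)"
  proof (rule sum.cong[OF refl])
    fix y assume y: "y \<in> objs G"
    show "(\<Sum>h\<in>homs G x x. act (comp G h (ginv G (\<tau> y))) a) = (\<Sum>g\<in>homs G y x. act g a)"
      by (rule sum.reindex_bij_witness[where j = "\<lambda>h. comp G h (ginv G (\<tau> y))" and i = "\<lambda>g. comp G g (\<tau> y)"])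
        (use t[OF y] comp_cancel_right comp_ginv_cancel_right in
          \<open>auto simp: homs_def comp_closed source_comp target_comp\<close>)
  qed
  also have "\<dots> = e x"
    using trace trace_at_eq[of x a]
    by (simp add: trace_at_def trace_between_def total_act_def)
  finally show "(\<Sum>h\<in>homs G x x. act h ?b) = e x" .
qed

theorem semisimple_extensions:
  assumes one_of:
      "(\<exists>a \<in> center_of R. \<forall>y\<in>objs G. trace_at G D \<alpha> y a = identity_of (D y)) \<or>
       (\<exists>b \<in> center_of (D x). group_trace (isotropy G x) D \<alpha> b = identity_of (D x)) \<or>
       separable_extension (set_ring (D x)) (skew_groupoid_ring (isotropy G x) D \<alpha>) (delta x) \<or>
       separable_extension (set_ring R) (skew_groupoid_ring G D \<alpha>) (skew_embedding G D)"
  shows "left_semisimple_extension TYPE('m) (set_ring (D x))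
           (skew_groupoid_ring (isotropy G x) D \<alpha>) (delta x) \<and>
         right_semisimple_extension TYPE('m) (set_ring (D x))
           (skew_groupoid_ring (isotropy G x) D \<alpha>) (delta x) \<and>
         left_semisimple_extension TYPE('m) (set_ring R)
           (skew_groupoid_ring G D \<alpha>) (skew_embedding G D) \<and>
         right_semisimple_extension TYPE('m) (set_ring R)
           (skew_groupoid_ring G D \<alpha>) (skew_embedding G D)"
proof -
  interpret big: embedded_action G R D \<alpha> "skew_embedding G D"
    by unfold_locales simp
  interpret small: unital_action "isotropy G x" "D x" D \<alpha>
    by (rule isotropy_action)
  \<comment> \<open>x is the only object of the isotropy group, so its embedding is an instance of
    the general one.\<close>
  have "delta x r = skew_embedding (isotropy G x) D r" if "r \<in> D x" for r
    using D_e[OF _ that] objsD[OF x] by (auto simp: delta_def skew_embedding_def objs_isotropy[OF x])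
  then interpret small: embedded_action "isotropy G x" "D x" D \<alpha> "delta x"
    by unfold_locales
  let ?global = "\<exists>a \<in> center_of R. \<forall>z\<in>objs G. (\<Sum>g\<in>fibre z. act g a) = e z"
  let ?local = "\<exists>b \<in> center_of (D x). (\<Sum>h\<in>homs G x x. act h b) = e x"
  have fibre_x: "{h \<in> homs G x x. target G h = x} = homs G x x"
    by (auto simp: homs_def)
  have "?global" if "?local"
    using that trace_from_isotropy by blast
  moreover have "?local" if "?global"
  proof -
    from that obtain a where a: "a \<in> center_of R" "\<And>z. z \<in> objs G \<Longrightarrow> (\<Sum>g\<in>fibre z. act g a) = e z"
      by blast
    show ?thesis
      by (rule trace_to_isotropy[OF a(1) a(2)[OF x]]) blast
  qed
  moreover have "?global \<or> ?local"
    using one_of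
  proof (elim disjE)
    assume "\<exists>b \<in> center_of (D x). group_trace (isotropy G x) D \<alpha> b = identity_of (D x)"
    then show ?thesis
      by (auto simp: group_trace_def isotropy_simps total_act_def)
  next
    assume "separable_extension (set_ring (D x)) (skew_groupoid_ring (isotropy G x) D \<alpha>) (delta x)"
    then show ?thesis
      by (rule small.separable_trace) (auto simp: objs_isotropy[OF x] isotropy_simps fibre_x)
  next
    assume "separable_extension (set_ring R) (skew_groupoid_ring G D \<alpha>) (skew_embedding G D)"
    then show ?thesis
      by (rule big.separable_trace) auto
  qed (auto simp: trace_at_eq)
  ultimately obtain a b where a: "a \<in> center_of R" "\<And>z. z \<in> objs G \<Longrightarrow> (\<Sum>g\<in>fibre z. act g a) = e z"
    and b: "b \<in> center_of (D x)" "(\<Sum>h\<in>homs G x x. act h b) = e x"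
    by blast
  have b': "(\<Sum>h | h \<in> carrier (isotropy G x) \<and> target (isotropy G x) h = z.
      total_act (isotropy G x) D \<alpha> h b) = e z" if "z \<in> objs (isotropy G x)" for z
    using that b(2) by (simp add: objs_isotropy[OF x] isotropy_simps fibre_x)
  show ?thesis
    using small.left_semisimple[OF b(1) b'] small.right_semisimple[OF b(1) b']
      big.left_semisimple[OF a] big.right_semisimple[OF a] by blast
qed

end

end

end

section \<open>The lifted partial action\<close>

lemma identity_of_eq: "is_identity u R \<Longrightarrow> identity_of R = u"
  unfolding identity_of_def is_identity_def by (rule the_equality) metis+

lemma is_identity_identity_of: "unital_set R \<Longrightarrow> is_identity (identity_of R) R"
  unfolding unital_set_def using identity_of_eq by blast

lemma ideal_ofD:
  assumes "ideal_of J R"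
  shows "r \<in> J \<Longrightarrow> r \<in> R" "0 \<in> J" "\<lbrakk>r \<in> J; s \<in> J\<rbrakk> \<Longrightarrow> r - s \<in> J"
    "\<lbrakk>r \<in> J; s \<in> J\<rbrakk> \<Longrightarrow> r + s \<in> J" "\<lbrakk>r \<in> R; s \<in> J\<rbrakk> \<Longrightarrow> r * s \<in> J" "\<lbrakk>r \<in> J; s \<in> R\<rbrakk> \<Longrightarrow> r * s \<in> J"
proof -
  show *: "r \<in> J \<Longrightarrow> r \<in> R" "0 \<in> J" "\<lbrakk>r \<in> J; s \<in> J\<rbrakk> \<Longrightarrow> r - s \<in> J"
    "\<lbrakk>r \<in> R; s \<in> J\<rbrakk> \<Longrightarrow> r * s \<in> J" "\<lbrakk>r \<in> J; s \<in> R\<rbrakk> \<Longrightarrow> r * s \<in> J" for r s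
    using assms by (auto simp: ideal_of_def)
  show "r + s \<in> J" if "r \<in> J" "s \<in> J"
    using *(3)[OF that(1) *(3)[OF *(2) that(2)]] by simp
qed

text \<open>The substantial axiom is \<open>act_act\<close>. The extension law only speaks of
  elements on which the composite is defined, so the domain and range of the composite have to be
  described by idempotents first.\<close>

lemma unital_partial_group_action_imp:
  assumes H: "groupoid H" and fin: "finite (carrier H)" and obj: "objs H = {x}"
    and R: "ideal_of R UNIV" and act: "unital_partial_group_action H R D \<alpha>"
  shows "unital_action H R D \<alpha>"
proof -
  interpret H: groupoid H by (rule H)
  have xH: "x \<in> carrier H" using H.objsD[of x] obj by blast
  have st: "source H h = x" "target H h = x" if "h \<in> carrier H" for h
    using H.source_in_objs[OF that] H.target_in_objs[OF that] obj by auto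
  have Dx: "D x = R"
    using act obj by (auto simp: unital_partial_group_action_def partial_group_action_def)
  let ?e = "\<lambda>h. identity_of (D h)"
  let ?a = "total_act H D \<alpha>"
  have pa: "partial_action H R D \<alpha>"
    using act by (simp add: unital_partial_group_action_def partial_group_action_def)
  have D: "ideal_of (D h) R" and iso: "ring_iso_on (\<alpha> h) (D (ginv H h)) (D h)" if "h \<in> carrier H" for h
    using pa that st[OF that] Dx by (auto simp: partial_action_def)
  have \<alpha>_x: "\<alpha> x r = r" if "r \<in> R" for r
    using pa that obj Dx by (auto simp: partial_action_def)
  have \<alpha>_comp: "r \<in> D (ginv H (comp H h k)) \<and> \<alpha> (comp H h k) r = \<alpha> h (\<alpha> k r)"
    if "h \<in> carrier H" "k \<in> carrier H" "r \<in> D (ginv H k)" "\<alpha> k r \<in> D (ginv H h)" for h k r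
    using pa that st by (simp add: partial_action_def)
  have idn: "is_identity (?e h) (D h)" and cen: "?e h \<in> center_of R" if "h \<in> carrier H" for h
    using act that by (auto simp: unital_partial_group_action_def is_identity_identity_of)
  have e_D: "?e h \<in> D h" and e_l: "r \<in> D h \<Longrightarrow> ?e h * r = r" and e_r: "r \<in> D h \<Longrightarrow> r * ?e h = r"
    if "h \<in> carrier H" for h r
    using idn[OF that] by (auto simp: is_identity_def)
  have e_R: "?e h \<in> R" and e_c: "r \<in> R \<Longrightarrow> ?e h * r = r * ?e h" if "h \<in> carrier H" for h r
    using cen[OF that] by (auto simp: center_of_def)
  have D_R: "r \<in> R" if "h \<in> carrier H" "r \<in> D h" for h r
    using ideal_ofD(1)[OF D[OF that(1)] that(2)] .
  have re: "r * ?e h \<in> D h" if "h \<in> carrier H" "r \<in> R" for h r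
    using ideal_ofD(5)[OF D[OF that(1)] that(2) e_D[OF that(1)]] .
  have D_iff: "r \<in> D h \<longleftrightarrow> r \<in> R \<and> r * ?e h = r" if "h \<in> carrier H" for h r
    using e_r[OF that] D_R[OF that] re[OF that] by metis
  have \<alpha>_D: "\<alpha> h r \<in> D h" if "h \<in> carrier H" "r \<in> D (ginv H h)" for h r
    using iso[OF that(1)] that(2) by (auto simp: ring_iso_on_def bij_betw_def)
  have \<alpha>_surj: "\<exists>s\<in>D (ginv H h). \<alpha> h s = r" if "h \<in> carrier H" "r \<in> D h" for h r
    using iso[OF that(1)] that(2) by (force simp: ring_iso_on_def bij_betw_def)
  have \<alpha>_inj: "r = s" if "h \<in> carrier H" "r \<in> D (ginv H h)" "s \<in> D (ginv H h)" "\<alpha> h r = \<alpha> h s" for h r s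
    using iso[OF that(1)] that(2-) by (auto simp: ring_iso_on_def bij_betw_def inj_on_def)
  have \<alpha>_add: "\<alpha> h (r + s) = \<alpha> h r + \<alpha> h s" and \<alpha>_mult: "\<alpha> h (r * s) = \<alpha> h r * \<alpha> h s"
    if "h \<in> carrier H" "r \<in> D (ginv H h)" "s \<in> D (ginv H h)" for h r s
    using iso[OF that(1)] that(2-) by (auto simp: ring_iso_on_def)
  have \<alpha>_e: "\<alpha> h (?e (ginv H h)) = ?e h" if h: "h \<in> carrier H" for h
  proof -
    have i: "ginv H h \<in> carrier H" using h by (rule H.ginv_closed)
    obtain s where s: "s \<in> D (ginv H h)" "\<alpha> h s = ?e h"
      using \<alpha>_surj[OF h e_D[OF h]] by blast
    have "\<alpha> h (?e (ginv H h)) = ?e h * \<alpha> h (?e (ginv H h))"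
      using e_l[OF h \<alpha>_D[OF h e_D[OF i]]] by simp
    also have "\<dots> = \<alpha> h (s * ?e (ginv H h))"
      using \<alpha>_mult[OF h s(1) e_D[OF i]] s(2) by simp
    finally show ?thesis using e_r[OF i s(1)] s(2) by simp
  qed
  have a_D: "?a h r \<in> D h" if "h \<in> carrier H" "r \<in> R" for h r
    unfolding total_act_def using \<alpha>_D that re H.ginv_closed by blast
  have a_mult: "?a h (r * s) = ?a h r * ?a h s" if h: "h \<in> carrier H" and rs: "r \<in> R" "s \<in> R" for h r s
  proof -
    have i: "ginv H h \<in> carrier H" using h by (rule H.ginv_closed)
    have "r * s * ?e (ginv H h) = r * (s * ?e (ginv H h))"
      by (simp add: mult.assoc)
    also have "\<dots> = r * (?e (ginv H h) * (s * ?e (ginv H h)))"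
      using e_l[OF i re[OF i rs(2)]] by simp
    finally show ?thesis
      using \<alpha>_mult[OF h re[OF i rs(1)] re[OF i rs(2)]] by (simp add: total_act_def mult.assoc)
  qed
  have \<alpha>_ginv: "\<alpha> (ginv H h) (\<alpha> h r) = r" if h: "h \<in> carrier H" and r: "r \<in> D (ginv H h)" for h r
    using \<alpha>_comp[OF H.ginv_closed[OF h] h r] \<alpha>_D[OF h r] H.ginv_comp[OF h] st[OF h] \<alpha>_x
      D_R[OF H.ginv_closed[OF h] r] by (simp add: H.ginv_ginv[OF h])
  have a_a: "?a h (?a k r) = ?a (comp H h k) r * ?e h"
    if h: "h \<in> carrier H" and k: "k \<in> carrier H" and r: "r \<in> R" for h k r
  proof -
    let ?h = "ginv H h" and ?k = "ginv H k" and ?hk = "comp H h k"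
    have i: "?h \<in> carrier H" "?k \<in> carrier H" "?hk \<in> carrier H" "ginv H ?hk \<in> carrier H"
      using h k st by (simp_all add: H.ginv_closed H.comp_closed)
    have ee: "?e k * ?e ?h \<in> D k" "?e k * ?e ?h \<in> D ?h"
      using ideal_ofD(6)[OF D[OF k] e_D[OF k] e_R[OF i(1)]]
        ideal_ofD(5)[OF D[OF i(1)] e_R[OF k] e_D[OF i(1)]] by auto
    \<comment> \<open>f is the preimage under \<open>\<alpha> k\<close> of the identity of the
      intersection of \<open>D k\<close> and \<open>D ?h\<close>; multiplication by f cuts an
      element down to the domain of the composite.\<close>
    obtain f where f: "f \<in> D ?k" "\<alpha> k f = ?e k * ?e ?h"
      using \<alpha>_surj[OF k ee(1)] by blast
    have f': "f \<in> D (ginv H ?hk)" "\<alpha> ?hk f = \<alpha> h (?e k * ?e ?h)"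
      using \<alpha>_comp[OF h k f(1)] f(2) ee(2) by auto
    \<comment> \<open>\<open>q\<close> is the identity of \<open>D h \<inter> D (h k)\<close>, which gives \<open>q_eq\<close>.\<close>
    define q where "q = \<alpha> h (?e k * ?e ?h)"
    have q: "q \<in> D h" "q \<in> D ?hk"
      using \<alpha>_D[OF h ee(2)] \<alpha>_D[OF i(3) f'(1)] f'(2) by (auto simp: q_def)
    \<comment> \<open>Write v as \<open>\<alpha> h u\<close>. The extension law for
      \<open>?h\<close> and \<open>?hk\<close> shows that u is a value of \<open>\<alpha> k\<close>,
      so u lies in both \<open>D k\<close> and \<open>D ?h\<close> and is fixed by the product of
      their identities.\<close>
    have vq: "v * q = v" if v: "v \<in> D h" "v \<in> D ?hk" for v
    proof -
      obtain u where u: "u \<in> D ?h" "\<alpha> h u = v"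
        using \<alpha>_surj[OF h v(1)] by blast
      obtain v' where v': "v' \<in> D (ginv H ?hk)" "\<alpha> ?hk v' = v"
        using \<alpha>_surj[OF i(3) v(2)] by blast
      have hhk: "comp H ?h ?hk = k"
        using H.ginv_comp_cancel[OF h k] st h k by simp
      have "v' \<in> D ?k \<and> \<alpha> k v' = \<alpha> ?h v"
        using \<alpha>_comp[OF i(1,3) v'(1)] v'(2) v(1) by (simp add: H.ginv_ginv[OF h] hhk)
      then have "u \<in> D k"
        using \<alpha>_ginv[OF h u(1)] u(2) \<alpha>_D[OF k] by metis
      then have "u * (?e k * ?e ?h) = u"
        using e_r[OF k] e_r[OF i(1) u(1)] by (simp add: mult.assoc[symmetric])
      then show ?thesis
        using \<alpha>_mult[OF h u(1) ee(2)] u(2) by (simp add: q_def)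
    qed
    have q_eq: "q = ?e ?hk * ?e h"
    proof -
      have "?e ?hk * ?e h * q = ?e ?hk * ?e h"
        using ideal_ofD(5)[OF D[OF h] e_R[OF i(3)] e_D[OF h]]
          ideal_ofD(6)[OF D[OF i(3)] e_D[OF i(3)] e_R[OF h]] by (rule vq)
      then show ?thesis
        using e_l[OF h q(1)] e_l[OF i(3) q(2)] by (simp add: mult.assoc)
    qed
    have d: "r * ?e ?k \<in> D ?k" using re[OF i(2) r] .
    \<comment> \<open>Truncating to the domain of \<open>\<alpha> h\<close> after
      \<open>\<alpha> k\<close> is the same as multiplying by f before it.\<close>
    have "\<alpha> k (r * ?e ?k) * ?e ?h = \<alpha> k (r * ?e ?k) * (?e k * ?e ?h)"
      using e_r[OF k \<alpha>_D[OF k d]] by (simp add: mult.assoc[symmetric])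
    also have "\<dots> = \<alpha> k (r * ?e ?k * f)"
      using \<alpha>_mult[OF k d f(1)] f(2) by simp
    also have "r * ?e ?k * f = r * f"
      using e_l[OF i(2) f(1)] by (simp add: mult.assoc)
    finally have w: "\<alpha> k (r * ?e ?k) * ?e ?h = \<alpha> k (r * f)" .
    have rf: "r * f \<in> D ?k" using ideal_ofD(5)[OF D[OF i(2)] r f(1)] .
    have wD: "\<alpha> k (r * f) \<in> D ?h"
      unfolding w[symmetric] by (rule re[OF i(1) D_R[OF k \<alpha>_D[OF k d]]])
    have "?a h (?a k r) = \<alpha> ?hk (r * f)"
      unfolding total_act_def w using \<alpha>_comp[OF h k rf wD] by simp
    also have "r * f = r * ?e (ginv H ?hk) * f"
      using e_l[OF i(4) f'(1)] by (simp add: mult.assoc)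
    also have "\<alpha> ?hk \<dots> = ?a ?hk r * q"
      using \<alpha>_mult[OF i(3) re[OF i(4) r] f'(1)] f'(2) by (simp add: total_act_def q_def)
    also have "\<dots> = ?a ?hk r * ?e h"
      using e_r[OF i(3) a_D[OF i(3) r]] by (simp add: q_eq mult.assoc[symmetric])
    finally show ?thesis .
  qed
  show ?thesis
    unfolding unital_action_def unital_action_axioms_def action_data_def
  proof (intro conjI allI impI)
    show "?a h (r + s) = ?a h r + ?a h s" if "h \<in> carrier H" "r \<in> R" "s \<in> R" for h r s
      using \<alpha>_add[OF that(1)] re that H.ginv_closed by (simp add: total_act_def distrib_right)
    show "?a h (?e (source H h)) = ?e h" if "h \<in> carrier H" for h
      using e_l[OF xH] e_D[OF H.ginv_closed[OF that]] D_R[OF H.ginv_closed[OF that]] Dx \<alpha>_e[OF that] st[OF that]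
      by (simp add: total_act_def)
    show "?e h * ?e (target H h) = ?e h" if "h \<in> carrier H" for h
      using e_r[OF xH, of "?e h"] e_R[OF that] st[OF that] Dx by simp
    show "?a y r = r * ?e y" if "y \<in> objs H" "r \<in> R" for y r
      using that obj H.ginv_obj[of x] \<alpha>_x e_r[OF xH, of r] Dx by (simp add: total_act_def)
    show "(\<Sum>y\<in>objs H. r * ?e y) = r" if "r \<in> R" for r
      using e_r[OF xH, of r] that Dx obj by simp
    show "?e h * ?e h = ?e h" if "h \<in> carrier H" for h
      using e_r[OF that e_D[OF that]] .
    show "groupoid H" "finite (carrier H)" by (fact H fin)+
    show "r - s \<in> R" "r * s \<in> R" if "r \<in> R" "s \<in> R" for r s
      using ideal_ofD(3,5)[OF R] that by auto
    show "0 \<in> R" by (rule ideal_ofD(2)[OF R])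
    show "r \<in> D h \<longleftrightarrow> r \<in> R \<and> r * ?e h = r" if "h \<in> carrier H" for h r
      by (rule D_iff[OF that])
    show "?e h \<in> R" if "h \<in> carrier H" for h by (rule e_R[OF that])
    show "?e h * r = r * ?e h" if "h \<in> carrier H" "r \<in> R" for h r by (rule e_c[OF that])
    show "?e y * ?e z = 0" if "y \<in> objs H" "z \<in> objs H" "y \<noteq> z" for y z
      using that obj by simp
    show "?a h r \<in> R" "?a h r * ?e h = ?a h r" if "h \<in> carrier H" "r \<in> R" for h r
      using D_R[OF that(1) a_D[OF that]] e_r[OF that(1) a_D[OF that]] by auto
    show "?a h (r * s) = ?a h r * ?a h s" if "h \<in> carrier H" "r \<in> R" "s \<in> R" for h r s
      by (rule a_mult[OF that])
    show "?a h (?a k r) = ?a (comp H h k) r * ?e h" if "h \<in> carrier H" "k \<in> carrier H" "r \<in> R" for h k r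
      by (rule a_a[OF that])
  qed
qed

text \<open>A nonzero r placed at y and r placed at z would be two different families with the same
  sum.\<close>

lemma direct_sum_disjoint:
  assumes sum: "direct_sum_of Y I UNIV" and zero: "\<And>y. y \<in> Y \<Longrightarrow> 0 \<in> I y"
    and yz: "y \<in> Y" "z \<in> Y" "y \<noteq> z" and r: "r \<in> I y" "r \<in> I z"
  shows "r = 0"
proof (rule ccontr)
  assume nz: "r \<noteq> 0"
  let ?f = "\<lambda>w. \<lambda>u\<in>Y. if u = w then r else 0"
  let ?Q = "\<lambda>f. f \<in> (\<Pi>\<^sub>E u\<in>Y. I u) \<and> finite {u\<in>Y. f u \<noteq> 0} \<and> r = (\<Sum>u | u \<in> Y \<and> f u \<noteq> 0. f u)"
  have Q: "?Q (?f w)" if "w \<in> Y" "r \<in> I w" for w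
  proof -
    have supp: "{u\<in>Y. ?f w u \<noteq> 0} = {w}" using that nz by auto
    show ?thesis unfolding supp using that zero by auto
  qed
  have "\<exists>!f. ?Q f"
    using sum unfolding direct_sum_of_def by blast
  then have "?f y = ?f z"
    using Q[OF yz(1) r(1)] Q[OF yz(2) r(2)] by blast
  then have "?f y y = ?f z y" by simp
  then show False using yz nz by simp
qed

section \<open>Transport from the isotropy group along the transversal\<close>

locale lifted_action = groupoid G for G :: "'g groupoid" +
  fixes x :: 'g and \<tau> :: "'g \<Rightarrow> 'g" and I :: "'g \<Rightarrow> 'a::ring set" and \<gamma> :: "'g \<Rightarrow> 'a \<Rightarrow> 'a"
  assumes fin: "finite (carrier G)" and x: "x \<in> objs G" and \<tau>: "transversal G x \<tau>"
    and datum: "lifting_datum G x \<tau> (UNIV :: 'a set) I \<gamma>"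
    and global: "transversal_global G x \<tau> (lifted_ideal G \<tau> I \<gamma>)"
    and unital: "datum_unital G x I \<gamma>"
    and sum_I: "direct_sum_of (objs G) I (UNIV :: 'a set)"
begin

abbreviation "B \<equiv> lifted_ideal G \<tau> I \<gamma>"
abbreviation "\<beta> \<equiv> lifted_map G \<tau> I \<gamma>"
abbreviation "loop_at g \<equiv> to_isotropy G \<tau> g"
abbreviation "one_I y \<equiv> identity_of (I y)"

lemma \<tau>_props: "y \<in> objs G \<Longrightarrow> \<tau> y \<in> carrier G" "y \<in> objs G \<Longrightarrow> source G (\<tau> y) = x"
  "y \<in> objs G \<Longrightarrow> target G (\<tau> y) = y"
  using \<tau> by (auto simp: transversal_def homs_def)

lemma \<tau>_x: "\<tau> x = x"
  using \<tau> by (simp add: transversal_def)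

lemma xC: "x \<in> carrier G" "source G x = x" "target G x = x" "ginv G x = x"
  using objsD[OF x] ginv_obj[OF x] by auto

lemma ideal_I: "y \<in> objs G \<Longrightarrow> ideal_of (I y) UNIV"
  using datum by (simp add: lifting_datum_def)

lemma \<gamma>_x: "r \<in> I x \<Longrightarrow> \<gamma> x r = r"
  using datum by (simp add: lifting_datum_def)

sublocale X: unital_action "isotropy G x" "I x" I \<gamma>
  using isotropy_groupoid objs_isotropy[OF x] ideal_I[OF x] unital fin
  by (intro unital_partial_group_action_imp[where x = x])
    (auto simp: datum_unital_def isotropy_def homs_def)

lemma carrier_iso: "carrier (isotropy G x) = homs G x x"
  by (simp add: isotropy_def)

lemma iso_tau: assumes "y \<in> objs G" shows "loop_at (\<tau> y) = x" "loop_at (ginv G (\<tau> y)) = x"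
  using assms \<tau>_props[OF assms] \<tau>_x comp_source[OF xC(1)] xC target_comp_id[of "ginv G (\<tau> y)"]
  by (simp_all add: to_isotropy_def ginv_closed source_ginv target_ginv ginv_comp)

lemma iso_obj: assumes "y \<in> objs G" shows "loop_at y = x"
  using assms \<tau>_props[OF assms] objsD[OF assms] comp_source[of "ginv G (\<tau> y)"]
  by (simp add: to_isotropy_def ginv_closed source_ginv target_ginv ginv_comp)

lemma iso_homs: assumes "g \<in> carrier G" shows "loop_at g \<in> homs G x x"
  using assms \<tau>_props source_in_objs[OF assms] target_in_objs[OF assms]
  by (simp add: to_isotropy_def homs_def comp_closed source_comp target_comp ginv_closed source_ginv target_ginv)

lemma iso_ginv: assumes g: "g \<in> carrier G" shows "loop_at (ginv G g) = ginv G (loop_at g)"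
  using assms \<tau>_props source_in_objs[OF assms] target_in_objs[OF assms]
  by (simp add: to_isotropy_def ginv_comp_distrib comp_closed source_comp target_comp ginv_closed
      source_ginv target_ginv ginv_ginv comp_assoc)

text \<open>The inner transversal factors cancel. Together with \<open>iso_obj\<close> and
  \<open>iso_ginv\<close> this makes \<open>to_isotropy\<close> a functor to the isotropy
  group.\<close>

lemma iso_comp:
  assumes g: "g \<in> carrier G" and h: "h \<in> carrier G" and gh: "source G g = target G h"
  shows "loop_at (comp G g h) = comp G (loop_at g) (loop_at h)"
proof -
  have y: "source G g \<in> objs G" "target G g \<in> objs G" "source G h \<in> objs G"
    using g h by (simp_all add: source_in_objs target_in_objs)
  let ?a = "ginv G (\<tau> (target G g))" and ?b = "\<tau> (source G g)" and ?c = "\<tau> (source G h)"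
  have abc: "?a \<in> carrier G" "source G ?a = target G g" "?b \<in> carrier G" "target G ?b = source G g"
    "source G ?b = x" "?c \<in> carrier G" "target G ?c = source G h"
    using y \<tau>_props by (auto simp: ginv_closed source_ginv)
  have "comp G (loop_at g) (loop_at h) = comp G ?a (comp G g (comp G ?b (comp G (ginv G ?b) (comp G h ?c))))"
    using abc g h gh
    by (simp add: to_isotropy_def comp_assoc comp_closed source_comp target_comp ginv_closed
      source_ginv target_ginv)
  also have "comp G ?b (comp G (ginv G ?b) (comp G h ?c)) = comp G h ?c"
    using abc g h gh by (intro comp_ginv_cancel) (auto simp: comp_closed target_comp)
  finally show ?thesis
    using abc g h gh by (simp add: to_isotropy_def comp_assoc comp_closed source_comp target_comp)
qed

text \<open>Globality concerns the lifted ideals. At \<tau> y and its inverse the loop is x, where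
  \<gamma> is the identity, so there the lifted ideals are the ideals of the datum
  themselves.\<close>

lemma I_tau: assumes y: "y \<in> objs G" shows "I (\<tau> y) = I y" "I (ginv G (\<tau> y)) = I x"
proof -
  have sub: "I (ginv G (\<tau> y)) \<subseteq> I x" and iso: "\<gamma> (\<tau> y) ` I (ginv G (\<tau> y)) = I (\<tau> y)"
    using datum y by (auto simp: lifting_datum_def ideal_of_def ring_iso_on_def bij_betw_def)
  have Bo: "B z = I z" if "z \<in> objs G" for z
    using that by (simp add: lifted_ideal_def)
  have gl: "B (ginv G (\<tau> y)) = I x" "B (\<tau> y) = I y"
    using global y Bo x by (auto simp: transversal_global_def)
  have \<gamma>x: "\<gamma> x ` J = J" if "J \<subseteq> I x" for J
    using that \<gamma>_x by force
  have t: "\<tau> y \<in> carrier G" "source G (\<tau> y) = x" "target G (\<tau> y) = y"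
    using \<tau>_props y by auto
  show "I (\<tau> y) = I y"
  \<comment> \<open>\<open>lifted_ideal\<close> has a separate clause for objects, which \<tau> y
    meets at least for y = x.\<close>
  proof (cases "\<tau> y \<in> objs G")
    case True
    then have "\<tau> y = y" using objsD[OF True] t by simp
    then show ?thesis by simp
  next
    case False
    then have "B (\<tau> y) = \<gamma> (\<tau> y) ` (I (ginv G (\<tau> y)) \<inter> \<gamma> x ` (I x \<inter> I x))"
      using t iso_tau[OF y] xC by (simp add: lifted_ideal_def \<tau>_x)
    also have "\<dots> = I (\<tau> y)"
      using \<gamma>x[of "I x"] sub iso by (simp add: Int_absorb2)
    finally show ?thesis using gl by simp
  qed
  show "I (ginv G (\<tau> y)) = I x"
  proof (cases "ginv G (\<tau> y) \<in> objs G")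
    case True
    have "ginv G (\<tau> y) = x"
      using objsD[OF True] t by (metis target_ginv)
    then show ?thesis by simp
  next
    case False
    then have "B (ginv G (\<tau> y)) = \<gamma> x ` (I x \<inter> \<gamma> x ` (I (ginv G (\<tau> y)) \<inter> I x))"
      using t iso_tau[OF y] xC by (simp add: lifted_ideal_def \<tau>_x source_ginv target_ginv)
    also have "\<dots> = I (ginv G (\<tau> y))"
      using \<gamma>x[of "I (ginv G (\<tau> y))"] sub by (simp add: Int_absorb1 Int_absorb2)
    finally show ?thesis using gl by simp
  qed
qed

lemma \<theta>_iso: "y \<in> objs G \<Longrightarrow> ring_iso_on (\<gamma> (\<tau> y)) (I x) (I y)"
  using datum I_tau by (simp add: lifting_datum_def)

lemma \<theta>_bij: "y \<in> objs G \<Longrightarrow> bij_betw (\<gamma> (\<tau> y)) (I x) (I y)"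
  using \<theta>_iso by (simp add: ring_iso_on_def)

lemma \<theta>_in: "\<lbrakk>y \<in> objs G; c \<in> I x\<rbrakk> \<Longrightarrow> \<gamma> (\<tau> y) c \<in> I y"
  using \<theta>_bij by (auto simp: bij_betw_def)

lemma \<theta>_add: "\<lbrakk>y \<in> objs G; c \<in> I x; d \<in> I x\<rbrakk> \<Longrightarrow> \<gamma> (\<tau> y) (c + d) = \<gamma> (\<tau> y) c + \<gamma> (\<tau> y) d"
  and \<theta>_mult: "\<lbrakk>y \<in> objs G; c \<in> I x; d \<in> I x\<rbrakk> \<Longrightarrow> \<gamma> (\<tau> y) (c * d) = \<gamma> (\<tau> y) c * \<gamma> (\<tau> y) d"
  using \<theta>_iso by (auto simp: ring_iso_on_def)

lemma I_hom: "h \<in> homs G x x \<Longrightarrow> c \<in> I h \<Longrightarrow> c \<in> I x"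
  using X.D_in by (simp add: carrier_iso)

lemma \<gamma>_image: assumes "h \<in> homs G x x" shows "\<gamma> h ` I (ginv G h) = I h"
proof -
  have "partial_action (isotropy G x) (I x) I \<gamma>"
    using datum by (simp add: lifting_datum_def partial_group_action_def)
  then show ?thesis
    using assms by (auto simp: partial_action_def isotropy_def ring_iso_on_def bij_betw_def)
qed

lemma ginv_homs: "h \<in> homs G x x \<Longrightarrow> ginv G h \<in> homs G x x"
  by (auto simp: homs_def ginv_closed source_ginv target_ginv)

text \<open>After \<open>I_tau\<close> the intersections in \<open>lifted_ideal\<close> are taken
  with \<open>I x\<close>, which contains every ideal of the group action, so they
  disappear.\<close>

lemma B_eq: assumes g: "g \<in> carrier G" shows "B g = \<gamma> (\<tau> (target G g)) ` I (loop_at g)"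
proof (cases "g \<in> objs G")
  case True
  then show ?thesis
    using iso_obj[OF True] objsD[OF True] \<theta>_bij[OF True] by (simp add: lifted_ideal_def bij_betw_def)
next
  case False
  have h: "loop_at g \<in> homs G x x" by (rule iso_homs[OF g])
  have "I x \<inter> I (ginv G (loop_at g)) = I (ginv G (loop_at g))"
    using I_hom[OF ginv_homs[OF h]] by blast
  moreover have "I x \<inter> I (loop_at g) = I (loop_at g)"
    using I_hom[OF h] by blast
  ultimately show ?thesis
    using False I_tau(2) source_in_objs[OF g] target_in_objs[OF g] \<gamma>_image[OF h]
    by (simp add: lifted_ideal_def)
qed

text \<open>The component of r at y, carried back to \<open>I x\<close>. It is total on the ambient
  ring and replaces the inverse of \<open>\<gamma> (\<tau> y)\<close>, which makes sense only on
  \<open>I y\<close>.\<close>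

definition coord :: "'g \<Rightarrow> 'a \<Rightarrow> 'a" where
  "coord y r = inv_into (I x) (\<gamma> (\<tau> y)) (r * one_I y)"

lemma one_x: "is_identity (one_I x) (I x)"
  using unital by (simp add: datum_unital_def is_identity_identity_of)

text \<open>Unitality is given at \<open>I x\<close>; the isomorphisms
  \<open>\<gamma> (\<tau> y)\<close> carry the identity to the other summands.\<close>

lemma one_I_eq: assumes y: "y \<in> objs G" shows "one_I y = \<gamma> (\<tau> y) (one_I x)" "is_identity (one_I y) (I y)"
proof -
  have ox: "one_I x \<in> I x" "\<And>c. c \<in> I x \<Longrightarrow> one_I x * c = c" "\<And>c. c \<in> I x \<Longrightarrow> c * one_I x = c"
    using one_x by (auto simp: is_identity_def)
  have "is_identity (\<gamma> (\<tau> y) (one_I x)) (I y)"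
    unfolding is_identity_def
  proof (intro conjI ballI)
    show "\<gamma> (\<tau> y) (one_I x) \<in> I y" by (rule \<theta>_in[OF y ox(1)])
    fix a assume "a \<in> I y"
    then obtain c where c: "c \<in> I x" "a = \<gamma> (\<tau> y) c"
      using \<theta>_bij[OF y] by (auto simp: bij_betw_def)
    show "\<gamma> (\<tau> y) (one_I x) * a = a" "a * \<gamma> (\<tau> y) (one_I x) = a"
      using \<theta>_mult[OF y ox(1) c(1)] \<theta>_mult[OF y c(1) ox(1)] c ox by simp_all
  qed
  moreover from this show "one_I y = \<gamma> (\<tau> y) (one_I x)"
    by (rule identity_of_eq)
  ultimately show "is_identity (one_I y) (I y)"
    by simp
qed

text \<open>An identity of a two-sided ideal is central in the ambient ring: its products with r on
  both sides lie in the ideal, so both equal the product with the identity on both sides of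
  r.\<close>

lemma one_I_props:
  assumes y: "y \<in> objs G"
  shows "one_I y \<in> I y" "a \<in> I y \<Longrightarrow> one_I y * a = a" "a \<in> I y \<Longrightarrow> a * one_I y = a"
    "r * one_I y \<in> I y" "one_I y * r = r * one_I y"
proof -
  show *: "one_I y \<in> I y" "a \<in> I y \<Longrightarrow> one_I y * a = a" "a \<in> I y \<Longrightarrow> a * one_I y = a" for a
    using one_I_eq(2)[OF y] by (auto simp: is_identity_def)
  have **: "r * one_I y \<in> I y" "one_I y * r \<in> I y"
    using ideal_ofD(5,6)[OF ideal_I[OF y]] *(1) by auto
  then show "r * one_I y \<in> I y" by blast
  show "one_I y * r = r * one_I y"
    using *(2)[OF **(1)] *(3)[OF **(2)] by (simp add: mult.assoc)
qed

lemma \<theta>_coord: "y \<in> objs G \<Longrightarrow> \<gamma> (\<tau> y) (coord y r) = r * one_I y"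
  unfolding coord_def using one_I_props(4) \<theta>_bij by (auto simp: bij_betw_def intro!: f_inv_into_f)

lemma coord_in: "y \<in> objs G \<Longrightarrow> coord y r \<in> I x"
  unfolding coord_def using one_I_props(4) \<theta>_bij by (auto simp: bij_betw_def intro!: inv_into_into)

lemma coord_\<theta>: "\<lbrakk>y \<in> objs G; c \<in> I x\<rbrakk> \<Longrightarrow> coord y (\<gamma> (\<tau> y) c) = c"
  unfolding coord_def using one_I_props(3)[OF _ \<theta>_in] \<theta>_bij by (simp add: bij_betw_def)

lemma coord_eqI:
  assumes "y \<in> objs G" "c \<in> I x" "\<gamma> (\<tau> y) c = r * one_I y"
  shows "coord y r = c"
  using \<theta>_bij[OF assms(1)] assms(2) by (simp add: coord_def bij_betw_def assms(3)[symmetric])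

lemma coord_add: "y \<in> objs G \<Longrightarrow> coord y (r + s) = coord y r + coord y s"
  by (rule coord_eqI) (simp_all add: X.add_in coord_in \<theta>_add \<theta>_coord distrib_right)

lemma coord_mult: assumes y: "y \<in> objs G" shows "coord y (r * s) = coord y r * coord y s"
proof (rule coord_eqI[OF y])
  have "r * one_I y * (s * one_I y) = r * (one_I y * (s * one_I y))"
    by (simp add: mult.assoc)
  then show "\<gamma> (\<tau> y) (coord y r * coord y s) = r * s * one_I y"
    using one_I_props(2)[OF y one_I_props(4)[OF y]] by (simp add: \<theta>_mult[OF y coord_in[OF y] coord_in[OF y]] \<theta>_coord[OF y] mult.assoc)
qed (simp add: X.mult_in coord_in y)

lemma coord_one: "y \<in> objs G \<Longrightarrow> coord y (one_I y) = one_I x"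
  using coord_\<theta>[of y "one_I x"] one_I_eq(1)[of y] one_I_props(1)[OF x] by simp

lemma identity_B:
  assumes g: "g \<in> carrier G"
  shows "identity_of (B g) = \<gamma> (\<tau> (target G g)) (one_I (loop_at g))"
proof (rule identity_of_eq)
  have h: "loop_at g \<in> carrier (isotropy G x)" and t: "target G g \<in> objs G"
    using iso_homs[OF g] target_in_objs[OF g] by (auto simp: carrier_iso)
  have "\<gamma> (\<tau> (target G g)) (one_I (loop_at g)) * \<gamma> (\<tau> (target G g)) c = \<gamma> (\<tau> (target G g)) c"
    "\<gamma> (\<tau> (target G g)) c * \<gamma> (\<tau> (target G g)) (one_I (loop_at g)) = \<gamma> (\<tau> (target G g)) c" if c: "c \<in> I (loop_at g)" for c
    using X.D_e[OF h c] X.e_central[OF h X.D_in[OF h c]] X.e_in[OF h] X.D_in[OF h c]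
    by (simp_all flip: \<theta>_mult[OF t])
  then show "is_identity (\<gamma> (\<tau> (target G g)) (one_I (loop_at g))) (B g)"
    unfolding is_identity_def B_eq[OF g] using X.e_in_D[OF h] by auto
qed

text \<open>The lifted action is the group action conjugated by the transversal: pass to the
  coordinate at the source, act by the loop, and return at the target. Through this formula the
  axioms for the lift are pulled back to the group.\<close>

lemma total_act_B:
  assumes g: "g \<in> carrier G"
  shows "total_act G B \<beta> g r
    = \<gamma> (\<tau> (target G g)) (total_act (isotropy G x) I \<gamma> (loop_at g) (coord (source G g) r))"
proof -
  let ?h = "ginv G (loop_at g)"
  have h: "loop_at g \<in> homs G x x" "?h \<in> homs G x x"
    using iso_homs[OF g] ginv_homs by auto
  have s: "source G g \<in> objs G" using source_in_objs[OF g] .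
  have eh: "one_I ?h \<in> I x"
    using X.e_in h(2) by (simp add: carrier_iso)
  define c where "c = coord (source G g) r * one_I ?h"
  have c: "c \<in> I x" unfolding c_def using X.mult_in coord_in[OF s] eh by blast
  have e: "identity_of (B (ginv G g)) = \<gamma> (\<tau> (source G g)) (one_I ?h)"
    using identity_B[OF ginv_closed[OF g]] by (simp add: target_ginv g iso_ginv)
  \<comment> \<open>Inserting the identity of the summand at the source replaces r by its component
    there, on which the transversal isomorphism is multiplicative.\<close>
  have "r * identity_of (B (ginv G g)) = r * (one_I (source G g) * \<gamma> (\<tau> (source G g)) (one_I ?h))"
    using one_I_props(2)[OF s \<theta>_in[OF s eh]] e by simp
  also have "\<dots> = \<gamma> (\<tau> (source G g)) c"
    unfolding c_def using \<theta>_mult[OF s coord_in[OF s] eh] \<theta>_coord[OF s] by (simp add: mult.assoc)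
  finally have r: "r * identity_of (B (ginv G g)) = \<gamma> (\<tau> (source G g)) c" .
  have inv: "inv_into (I x) (\<gamma> (\<tau> (source G g))) (\<gamma> (\<tau> (source G g)) c) = c"
    using \<theta>_bij[OF s] c by (simp add: bij_betw_def)
  have act: "total_act (isotropy G x) I \<gamma> (loop_at g) (coord (source G g) r) = \<gamma> (loop_at g) c"
    by (simp add: total_act_def c_def isotropy_def)
  show ?thesis
  proof (cases "g \<in> objs G")
    case False
    then show ?thesis
      unfolding act unfolding total_act_def r by (simp add: lifted_map_def I_tau(2)[OF s] inv)
  next
    case True
    then show ?thesis
      unfolding act unfolding total_act_def r using objsD[OF True] iso_obj[OF True] \<gamma>_x[OF c]
      by (simp add: lifted_map_def)
  qed
qed

text \<open>Most axioms are those of the isotropy group transported by \<open>total_act_B\<close>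
  and \<open>identity_B\<close>. Orthogonality and completeness of the object idempotents come
  instead from the direct sum decomposition.\<close>

lemma lifted_unital_action: "unital_action G UNIV B \<beta>"
proof -
  let ?a = "total_act (isotropy G x) I \<gamma>"
  let ?e = "\<lambda>g. identity_of (B g)"
  have h: "loop_at g \<in> carrier (isotropy G x)" if "g \<in> carrier G" for g
    using iso_homs[OF that] by (simp add: carrier_iso)
  have st: "source G g \<in> objs G" "target G g \<in> objs G" if "g \<in> carrier G" for g
    using that source_in_objs target_in_objs by auto
  have Bo: "B y = I y" if "y \<in> objs G" for y
    using that by (simp add: lifted_ideal_def)
  note e = identity_B and act = total_act_B
  have E: "one_I (loop_at g) \<in> I x" if "g \<in> carrier G" for g
    using X.e_in[OF h[OF that]] .
  have a_in: "?a (loop_at g) (coord y r) \<in> I x" if "g \<in> carrier G" "y \<in> objs G" for g y r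
    using X.act_in[OF h[OF that(1)] coord_in[OF that(2)]] .
  have e_t: "r * ?e g = \<gamma> (\<tau> (target G g)) (coord (target G g) r * one_I (loop_at g))"
    "?e g * r = \<gamma> (\<tau> (target G g)) (one_I (loop_at g) * coord (target G g) r)" if g: "g \<in> carrier G" for g r
  proof -
    have \<theta>E: "\<gamma> (\<tau> (target G g)) (one_I (loop_at g)) \<in> I (target G g)"
      by (rule \<theta>_in[OF st(2)[OF g] E[OF g]])
    show "r * ?e g = \<gamma> (\<tau> (target G g)) (coord (target G g) r * one_I (loop_at g))"
      using one_I_props(2)[OF st(2)[OF g] \<theta>E]
      by (simp add: e[OF g] \<theta>_mult[OF st(2)[OF g] coord_in[OF st(2)[OF g]] E[OF g]] \<theta>_coord[OF st(2)[OF g]] mult.assoc)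
    show "?e g * r = \<gamma> (\<tau> (target G g)) (one_I (loop_at g) * coord (target G g) r)"
    proof -
      have "\<gamma> (\<tau> (target G g)) (one_I (loop_at g) * coord (target G g) r)
          = \<gamma> (\<tau> (target G g)) (one_I (loop_at g)) * (one_I (target G g) * r)"
        by (simp add: \<theta>_mult[OF st(2)[OF g] E[OF g] coord_in[OF st(2)[OF g]]] \<theta>_coord[OF st(2)[OF g]]
            one_I_props(5)[OF st(2)[OF g]])
      then show ?thesis
        using one_I_props(3)[OF st(2)[OF g] \<theta>E] by (simp add: e[OF g] mult.assoc[symmetric])
    qed
  qed
  show ?thesis
    unfolding unital_action_def unital_action_axioms_def action_data_def
  proof (intro conjI allI impI)
    show "groupoid G" by (rule groupoid_axioms)
    show "finite (carrier G)" by (rule fin)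
    show "r \<in> B g \<longleftrightarrow> r \<in> UNIV \<and> r * ?e g = r" if g: "g \<in> carrier G" for g r
    proof -
      have "\<gamma> (\<tau> (target G g)) c * ?e g = \<gamma> (\<tau> (target G g)) c" if "c \<in> I (loop_at g)" for c
        using e[OF g] \<theta>_mult[OF st(2)[OF g] X.D_in[OF h[OF g] that] E[OF g], symmetric]
          X.D_e[OF h[OF g] that] by simp
      moreover have "\<gamma> (\<tau> (target G g)) (coord (target G g) r * one_I (loop_at g)) \<in> B g"
        unfolding B_eq[OF g] by (intro imageI X.mult_in_D_left h g coord_in st X.e_in_D)
      then have "r * ?e g \<in> B g"
        by (simp only: e_t(1)[OF g])
      ultimately show ?thesis using B_eq[OF g] by auto
    qed
    show e_c: "?e g * r = r * ?e g" if "g \<in> carrier G" for g r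
      using X.e_central[OF h[OF that] coord_in[OF st(2)[OF that]]] e_t[OF that] by simp
    show "?e g * ?e g = ?e g" if "g \<in> carrier G" for g
      using \<theta>_mult[OF st(2)[OF that] E[OF that] E[OF that]] X.e_idem[OF h[OF that]] e[OF that] by simp
    show "?e g * ?e (target G g) = ?e g" if "g \<in> carrier G" for g
      using Bo[OF st(2)[OF that]] one_I_props(3)[OF st(2)[OF that] \<theta>_in[OF st(2)[OF that] E[OF that]]] e[OF that]
      by simp
    \<comment> \<open>The product lies in two different summands.\<close>
    show orth: "?e y * ?e z = 0" if "y \<in> objs G" "z \<in> objs G" "y \<noteq> z" for y z
      using direct_sum_disjoint[OF sum_I ideal_ofD(2)[OF ideal_I] that, of "one_I y * one_I z"]
        one_I_props(4)[OF that(2), of "one_I y"] one_I_props(4)[OF that(1), of "one_I z"]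
        one_I_props(5)[OF that(2), of "one_I y"] Bo that by simp
    show "(\<Sum>y\<in>objs G. r * ?e y) = r" for r
    proof -
      have finO: "finite (objs G)" using fin by (simp add: objs_def)
      obtain f where f: "f \<in> (\<Pi>\<^sub>E y\<in>objs G. I y)" "r = (\<Sum>y | y \<in> objs G \<and> f y \<noteq> 0. f y)"
        using sum_I unfolding direct_sum_of_def by blast
      have r: "r = (\<Sum>y\<in>objs G. f y)"
        using f(2) finO by (auto intro: sum.mono_neutral_left)
      have fy: "f y \<in> I y" if "y \<in> objs G" for y using f(1) that by auto
      \<comment> \<open>Multiplication by the idempotent at z picks out the component at z, by
        orthogonality.\<close>
      have "r * ?e z = f z" if z: "z \<in> objs G" for z
      proof -
        have "f y * ?e z = (if y = z then f z else 0)" if y: "y \<in> objs G" for y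
        proof (cases "y = z")
          case False
          have "f y * ?e z = f y * (?e y * ?e z)"
            using one_I_props(3)[OF y fy[OF y]] Bo[OF y] by (simp add: mult.assoc[symmetric])
          then show ?thesis using orth[OF y z False] False by simp
        qed (use one_I_props(3)[OF z fy[OF z]] Bo[OF z] in simp)
        then show ?thesis
          unfolding r sum_distrib_right using z finO by simp
      qed
      then show ?thesis using r by simp
    qed
    show "total_act G B \<beta> g r * ?e g = total_act G B \<beta> g r" if g: "g \<in> carrier G" for g r
      using \<theta>_mult[OF st(2)[OF g] a_in[OF g st(1)[OF g]] E[OF g], symmetric]
        X.act_e[OF h[OF g] coord_in[OF st(1)[OF g]]] act[OF g] e[OF g] by simp
    show "total_act G B \<beta> g (r + s) = total_act G B \<beta> g r + total_act G B \<beta> g s" if g: "g \<in> carrier G" for g r s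
      using act[OF g] \<theta>_add[OF st(2)[OF g] a_in[OF g st(1)[OF g]] a_in[OF g st(1)[OF g]]]
        X.act_add[OF h[OF g] coord_in[OF st(1)[OF g]] coord_in[OF st(1)[OF g]]] coord_add[OF st(1)[OF g]] by simp
    show "total_act G B \<beta> g (r * s) = total_act G B \<beta> g r * total_act G B \<beta> g s" if g: "g \<in> carrier G" for g r s
      using act[OF g] \<theta>_mult[OF st(2)[OF g] a_in[OF g st(1)[OF g]] a_in[OF g st(1)[OF g]]]
        X.act_mult[OF h[OF g] coord_in[OF st(1)[OF g]] coord_in[OF st(1)[OF g]]] coord_mult[OF st(1)[OF g]] by simp
    show "total_act G B \<beta> g (?e (source G g)) = ?e g" if g: "g \<in> carrier G" for g
      using act[OF g] Bo[OF st(1)[OF g]] coord_one[OF st(1)[OF g]] X.act_source[OF h[OF g]] iso_homs[OF g] e[OF g]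
      by (simp add: isotropy_def homs_def)
    show "total_act G B \<beta> g (total_act G B \<beta> k r) = total_act G B \<beta> (comp G g k) r * ?e g"
      if g: "g \<in> carrier G" and k: "k \<in> carrier G" and gk: "source G g = target G k" for g k r
    proof -
      let ?c = "coord (source G k) r"
      have hh: "source (isotropy G x) (loop_at g) = target (isotropy G x) (loop_at k)"
        using iso_homs[OF g] iso_homs[OF k] by (simp add: isotropy_def homs_def)
      have gkC: "comp G g k \<in> carrier G" using g k gk by (rule comp_closed)
      \<comment> \<open>Taking coordinates undoes the return map of the inner action, so the two
        loops act in succession and functoriality of \<open>to_isotropy\<close> applies.\<close>
      have "total_act G B \<beta> g (total_act G B \<beta> k r) = \<gamma> (\<tau> (target G g)) (?a (loop_at g) (?a (loop_at k) ?c))"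
        using act[OF g] act[OF k] gk coord_\<theta>[OF st(2)[OF k] a_in[OF k st(1)[OF k]]] by simp
      also have "?a (loop_at g) (?a (loop_at k) ?c) = ?a (loop_at (comp G g k)) ?c * one_I (loop_at g)"
        using X.act_act[OF h[OF g] h[OF k] hh coord_in[OF st(1)[OF k]]] iso_comp[OF g k gk]
        by (simp add: isotropy_def)
      also have "\<gamma> (\<tau> (target G g)) \<dots> = total_act G B \<beta> (comp G g k) r * ?e g"
        using \<theta>_mult[OF st(2)[OF g] a_in[OF gkC st(1)[OF k]] E[OF g]] act[OF gkC] e[OF g]
          source_comp[OF g k gk] target_comp[OF g k gk] by simp
      finally show ?thesis .
    qed
    show "total_act G B \<beta> y r = r * ?e y" if y: "y \<in> objs G" for y r
    proof -
      have yC: "y \<in> carrier G" "source G y = y" "target G y = y" using objsD[OF y] by auto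
      have xo: "x \<in> objs (isotropy G x)" using objs_isotropy[OF x] by simp
      show ?thesis
        using act[OF yC(1)] yC iso_obj[OF y] X.act_obj[OF xo coord_in[OF y]] one_I_props(3)[OF x coord_in[OF y]]
          \<theta>_coord[OF y] Bo[OF y] by simp
    qed
  qed auto
qed

end

theorem corollary8p3:
  fixes G :: "'g groupoid" and x :: 'g and \<tau> :: "'g \<Rightarrow> 'g"
    and I B :: "'g \<Rightarrow> 'a::ring set" and \<gamma> \<beta> :: "'g \<Rightarrow> 'a \<Rightarrow> 'a"
  assumes groupoid: "groupoid G" and finite: "finite (carrier G)"
    and connected: "connected_groupoid G"
    and object: "x \<in> objs G" and transversal: "transversal G x \<tau>"
    and datum: "lifting_datum G x \<tau> (UNIV :: 'a set) I \<gamma>"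
    and B: "B = lifted_ideal G \<tau> I \<gamma>" and \<beta>: "\<beta> = lifted_map G \<tau> I \<gamma>"
    and global: "transversal_global G x \<tau> B"
    and unital: "datum_unital G x I \<gamma>"
    and sum_I: "direct_sum_of (objs G) I (UNIV :: 'a set)"
    and sum_B: "direct_sum_of (objs G) B (UNIV :: 'a set)"
    and one_of:
      "(\<exists>a \<in> center_of (UNIV :: 'a set). \<forall>y\<in>objs G. trace_at G B \<beta> y a = identity_of (B y)) \<or>
       (\<exists>b \<in> center_of (B x). group_trace (isotropy G x) B \<beta> b = identity_of (B x)) \<or>
       separable_extension (set_ring (B x)) (skew_groupoid_ring (isotropy G x) B \<beta>) (delta x) \<or>
       separable_extension (set_ring (UNIV :: 'a set)) (skew_groupoid_ring G B \<beta>)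
         (skew_embedding G B)"
  shows "left_semisimple_extension TYPE('m) (set_ring (B x))
           (skew_groupoid_ring (isotropy G x) B \<beta>) (delta x) \<and>
         right_semisimple_extension TYPE('m) (set_ring (B x))
           (skew_groupoid_ring (isotropy G x) B \<beta>) (delta x) \<and>
         left_semisimple_extension TYPE('m) (set_ring (UNIV :: 'a set))
           (skew_groupoid_ring G B \<beta>) (skew_embedding G B) \<and>
         right_semisimple_extension TYPE('m) (set_ring (UNIV :: 'a set))
           (skew_groupoid_ring G B \<beta>) (skew_embedding G B)"
proof -
  interpret lifted_action G x \<tau> I \<gamma>
    using assms by (simp add: lifted_action_def lifted_action_axioms_def)
  interpret unital_action G UNIV "lifted_ideal G \<tau> I \<gamma>" "lifted_map G \<tau> I \<gamma>"
    by (rule lifted_unital_action)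
  \<comment> \<open>The two remaining premises compare idempotents at \<tau> y and its inverse with
    those at y and x; by globality the ideals themselves coincide.\<close>
  show ?thesis
    using semisimple_extensions[OF object transversal _ _ one_of[unfolded B \<beta>]] global
    unfolding B \<beta> transversal_global_def by simp
qed

end
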